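(* Let $d\ge1$, let $\gamma$ be a measure on $(\mathbb{R}^d,\mathcal{B}(\mathbb{R}^d))$ with $\gamma(\mathbb{R}^d)<1$ (offspring intensity), let $\nu$ be a locally finite measure on $\mathbb{R}^d$ (immigrant intensity), and let $\xi$ be the descendant cluster with offspring intensity $\gamma$. Let $f:\mathbb{R}^d\to\mathbb{R}$ be measurable such that, for all $n\ge1$, $\mathbb{E}\big[\big(|f(z)|+\sum_{x\in\xi}|f(z+x)|\big)^n\big]<\infty$ for all $z\in\mathbb{R}^d$ and $\int_{\mathbb{R}^d}\mathbb{E}\big[\big(|f(z)|+\sum_{x\in\xi}|f(z+x)|\big)^n\big]\nu(dz)<\infty$. For $z\in\mathbb{R}^d$ let $\kappa_z^{(n)}(f)$ be the $n$-th cumulant of the sum of $f$ over the cluster started from a single point at $z$, i.e. of $f(z)+\sum_{x\in\xi}f(z+x)$, and let $\kappa^{(n)}(f)$ be the $n$-th cumulant of the sum of $f$ over all points of the Hawkes process with immigrant intensity $\nu$. Then, for every $n\ge2$, $$\kappa^{(n)}(f)=\int_{\mathbb{R}^d}B_n\big(\kappa_z^{(1)}(f),\ldots,\kappa_z^{(n)}(f)\big)\,\nu(dz),$$ with, for all $z\in\mathbb{R}^d$, $$B_n\big(\kappa_z^{(1)}(f),\ldots,\kappa_z^{(n)}(f)\big)=\big((I_d-\Gamma)^{-1}h_n\big)(z)=\sum_{k=2}^n\big((I_d-\Gamma)^{-1}h_{n,k}\big)(z),$$ where, for $y\in\mathbb{R}^d$, $$h_n(y)=B_n\big(\kappa_y^{(1)}(f),\ldots,\kappa_y^{(n)}(f)\big)-\kappa_y^{(n)}(f),\qquad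 h_{n,k}(y)=B_{n,k}\big(\kappa_y^{(1)}(f),\ldots,\kappa_y^{(n-k+1)}(f)\big).$$
   Context: Cluster: start from an ancestor at $0\in\mathbb{R}^d$. Each point $y$ of each generation independently produces offspring located at $y+u$, where $u$ ranges over the points of a Poisson point process on $\mathbb{R}^d$ with intensity measure $\gamma$. The random point configuration $\xi$ (identified with a point measure, points counted with multiplicity) consists of all descendants, of all generations $\ge1$, of the ancestor at $0$; the ancestor itself is not included. Since $\gamma(\mathbb{R}^d)<1$, $\xi$ is almost surely finite. The cluster started from a single point at $z$ consists of $z$ together with the points $z+x$, $x\in\xi$. Hawkes process with immigrant intensity $\nu$: immigrants form a Poisson point process on $\mathbb{R}^d$ with intensity $\nu$; each immigrant $z$ starts an independent cluster distributed as the cluster started from $z$ (containing $z$); the Hawkes process is the superposition of all these clusters. Cumulants: the cumulants $(\kappa_Y^{(n)})_{n\ge1}$ of a random variable $Y$ with moments of all orders are the coefficients in $\log\mathbb{E}[e^{tY}]=\sum_{n\ge1}\kappa_Y^{(n)}t^n/n!$ (as formal power series in $t$, with $\mathbb{E}[e^{tY}]=1+\sum_{n\ge1}\mathbb{E}[Y^n]t^n/n!$); equivalently $\kappa_Y^{(n)}=\sum_{k=1}^n(k-1)!(-1)^{k-1}\sum_{\pi_1\cup\cdots\cup\pi_k=\{1,\ldots,n\}}\mathbb{E}[Y^{|\pi_1|}]\cdots\mathbb{E}[Y^{|\pi_k|}]$, the inner sum being over partitions of $\{1,\ldots,n\}$ into $k$ blocks. Operators: $\Gamma g(z)=\int_{\mathbb{R}^d}g(z+y)\,\gamma(dy)$,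 and $(I_d-\Gamma)^{-1}$ denotes the operator $$(I_d-\Gamma)^{-1}g(z)=g(z)+\sum_{m=1}^\infty\int_{\mathbb{R}^d}\cdots\int_{\mathbb{R}^d}g(z+x_1+\cdots+x_m)\,\gamma(dx_1)\cdots\gamma(dx_m).$$ Bell polynomials: for $1\le k\le n$, $$B_{n,k}(a_1,\ldots,a_{n-k+1})=\frac{n!}{k!}\sum_{\substack{l_1+\cdots+l_k=n\\ l_1\ge1,\ldots,l_k\ge1}}\frac{a_{l_1}}{l_1!}\cdots\frac{a_{l_k}}{l_k!},\qquad B_n(a_1,\ldots,a_n)=\sum_{k=1}^nB_{n,k}(a_1,\ldots,a_{n-k+1}).$$ *)

theory Defs
  imports "HOL-Probability.Probability" "HOL-Computational_Algebra.Formal_Power_Series"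
begin

section \<open>Point configurations and Poisson point processes\<close>

text \<open>
  A countable configuration of points with multiplicity is given by an enumeration \<open>(K, x)\<close>: it
  consists of the points \<open>x i\<close> with \<open>i < K\<close>, where \<open>K\<close> may be infinite. The enumeration is only an
  auxiliary labelling of the points; the values \<open>x i\<close> for \<open>i \<ge> K\<close> are irrelevant.
\<close>

type_synonym 'a enumeration = "enat \<times> (nat \<Rightarrow> 'a)"

definition enum_space :: "'a::topological_space enumeration measure" where
  "enum_space = count_space UNIV \<Otimes>\<^sub>M (\<Pi>\<^sub>M i\<in>UNIV. borel)"

definition indices :: "'a enumeration \<Rightarrow> nat set" where
  "indices c = {i. enat i < fst c}"

text \<open>The point measure \<open>\<Sum>i\<in>I. \<delta>\<^bsub>p i\<^esub>\<close>; integrals with respect to it are sums over the points.\<close>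

definition points :: "'i set \<Rightarrow> ('i \<Rightarrow> 'a) \<Rightarrow> 'a::topological_space measure" where
  "points I p = distr (count_space I) borel p"

definition enum_points :: "'a enumeration \<Rightarrow> 'a::topological_space measure" where
  "enum_points c = points (indices c) (snd c)"

text \<open>
  The Poisson law with parameter \<open>0\<close> is \<open>\<delta>\<^sub>0\<close> (note \<open>0 ^ 0 = 1\<close>), and with parameter \<open>\<infinity>\<close> it is \<open>\<delta>\<^sub>\<infinity>\<close>.
\<close>

definition poisson_distributed :: "'w measure \<Rightarrow> ('w \<Rightarrow> ennreal) \<Rightarrow> ennreal \<Rightarrow> bool" where
  "poisson_distributed M N r \<longleftrightarrow> N \<in> borel_measurable M \<and>
     (if r = \<infinity> then AE \<omega> in M. N \<omega> = \<infinity>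
      else \<forall>k::nat. measure M {\<omega> \<in> space M. N \<omega> = of_nat k} =
             enn2real r ^ k / fact k * exp (- enn2real r))"

definition poisson_process ::
  "'w measure \<Rightarrow> 'a::topological_space measure \<Rightarrow> ('w \<Rightarrow> 'a enumeration) \<Rightarrow> bool" where
  "poisson_process M \<mu> \<eta> \<longleftrightarrow>
     \<eta> \<in> measurable M enum_space \<and>
     (\<forall>B \<in> sets borel. poisson_distributed M (\<lambda>\<omega>. emeasure (enum_points (\<eta> \<omega>)) B) (emeasure \<mu> B)) \<and>
     (\<forall>n. \<forall>B :: nat \<Rightarrow> 'a set. B ` {..<n} \<subseteq> sets borel \<longrightarrow> disjoint_family_on B {..<n} \<longrightarrow>
        prob_space.indep_vars M (\<lambda>_. borel) (\<lambda>i \<omega>. emeasure (enum_points (\<eta> \<omega>)) (B i)) {..<n})"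


section \<open>Clusters\<close>

text \<open>
  Potential individuals of a cluster are labelled by lists: \<open>[]\<close> is the ancestor and \<open>i # u\<close> is the
  \<open>i\<close>-th child of \<open>u\<close>. A genealogy \<open>c\<close> assigns to each label \<open>u\<close> the enumerated configuration of the
  displacements of the children of \<open>u\<close> relative to \<open>u\<close>.
\<close>

type_synonym 'a genealogy = "nat list \<Rightarrow> 'a enumeration"

fun alive :: "'a genealogy \<Rightarrow> nat list \<Rightarrow> bool" where
  "alive c [] \<longleftrightarrow> True"
| "alive c (i # u) \<longleftrightarrow> alive c u \<and> i \<in> indices (c u)"

fun position :: "'a::monoid_add genealogy \<Rightarrow> nat list \<Rightarrow> 'a" where
  "position c [] = 0"
| "position c (i # u) = position c u + snd (c u) i"

definition descendants :: "'a genealogy \<Rightarrow> 'a::{topological_space,monoid_add} measure" where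
  "descendants c = points {u. alive c u \<and> u \<noteq> []} (position c)"

definition branching_family ::
  "'w measure \<Rightarrow> 'a::topological_space measure \<Rightarrow> (nat list \<Rightarrow> 'w \<Rightarrow> 'a enumeration) \<Rightarrow> bool" where
  "branching_family M \<gamma> \<eta> \<longleftrightarrow>
     (\<forall>u. poisson_process M \<gamma> (\<eta> u)) \<and> prob_space.indep_vars M (\<lambda>_. enum_space) \<eta> UNIV"

definition cluster ::
  "(nat list \<Rightarrow> 'w \<Rightarrow> 'a enumeration) \<Rightarrow> 'w \<Rightarrow> 'a::{topological_space,monoid_add} measure" where
  "cluster \<eta> \<omega> = descendants (\<lambda>u. \<eta> u \<omega>)"

definition cluster_sum ::
  "(nat list \<Rightarrow> 'w \<Rightarrow> 'a enumeration) \<Rightarrow> ('a::{topological_space,monoid_add} \<Rightarrow> real) \<Rightarrow> 'a \<Rightarrow> 'w \<Rightarrow> real" where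
  "cluster_sum \<eta> f z \<omega> = f z + (\<integral>x. f (z + x) \<partial>cluster \<eta> \<omega>)"

definition abs_cluster_sum ::
  "(nat list \<Rightarrow> 'w \<Rightarrow> 'a enumeration) \<Rightarrow> ('a::{topological_space,monoid_add} \<Rightarrow> real) \<Rightarrow> 'a \<Rightarrow> 'w \<Rightarrow> ennreal" where
  "abs_cluster_sum \<eta> f z \<omega> = ennreal \<bar>f z\<bar> + (\<integral>\<^sup>+x. ennreal \<bar>f (z + x)\<bar> \<partial>cluster \<eta> \<omega>)"


section \<open>Hawkes processes\<close>

text \<open>
  \<open>\<zeta>\<close> enumerates the immigrants and \<open>\<theta> i\<close> is the genealogy of the cluster of the \<open>i\<close>-th immigrant;
  the immigrants and all the offspring processes are jointly independent.
\<close>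

definition hawkes_family ::
  "'w measure \<Rightarrow> 'a::topological_space measure \<Rightarrow> 'a measure \<Rightarrow>
   ('w \<Rightarrow> 'a enumeration) \<Rightarrow> (nat \<Rightarrow> nat list \<Rightarrow> 'w \<Rightarrow> 'a enumeration) \<Rightarrow> bool" where
  "hawkes_family M \<gamma> \<nu> \<zeta> \<theta> \<longleftrightarrow>
     poisson_process M \<nu> \<zeta> \<and> (\<forall>i u. poisson_process M \<gamma> (\<theta> i u)) \<and>
     prob_space.indep_vars M (\<lambda>_. enum_space) (case_option \<zeta> (\<lambda>(i, u). \<theta> i u)) UNIV"

definition hawkes_process ::
  "('w \<Rightarrow> 'a enumeration) \<Rightarrow> (nat \<Rightarrow> nat list \<Rightarrow> 'w \<Rightarrow> 'a enumeration) \<Rightarrow> 'w \<Rightarrow>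
   'a::{topological_space,monoid_add} measure" where
  "hawkes_process \<zeta> \<theta> \<omega> =
     points {(i, u). i \<in> indices (\<zeta> \<omega>) \<and> alive (\<lambda>v. \<theta> i v \<omega>) u}
            (\<lambda>(i, u). snd (\<zeta> \<omega>) i + position (\<lambda>v. \<theta> i v \<omega>) u)"


section \<open>Cumulants, Bell polynomials and the operator \<open>(I\<^sub>d - \<Gamma>)\<^sup>-\<^sup>1\<close>\<close>

definition moment_series :: "'w measure \<Rightarrow> ('w \<Rightarrow> real) \<Rightarrow> real fps" where
  "moment_series M Y = Abs_fps (\<lambda>n. (\<integral>\<omega>. Y \<omega> ^ n \<partial>M) / fact n)"

text \<open>\<open>fps_ln 1\<close> is the power series of \<open>ln (1 + t)\<close>.\<close>

definition cumulant :: "'w measure \<Rightarrow> ('w \<Rightarrow> real) \<Rightarrow> nat \<Rightarrow> real" where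
  "cumulant M Y n = fact n * fps_nth (fps_compose (fps_ln 1) (moment_series M Y - 1)) n"

text \<open>
  The arguments \<open>a\<^sub>1, a\<^sub>2, \<dots>\<close> are passed as a function on \<open>nat\<close>, of which only the values at
  \<open>1, \<dots>, n - k + 1\<close> (respectively \<open>1, \<dots>, n\<close>) matter. The compositions of \<open>n\<close> into \<open>k\<close> positive
  parts are represented as lists.
\<close>

definition partial_bell :: "nat \<Rightarrow> nat \<Rightarrow> (nat \<Rightarrow> real) \<Rightarrow> real" where
  "partial_bell n k a = fact n / fact k *
     (\<Sum>ls \<in> {ls. length ls = k \<and> (\<forall>l\<in>set ls. 1 \<le> l) \<and> sum_list ls = n}. \<Prod>l\<leftarrow>ls. a l / fact l)"

definition complete_bell :: "nat \<Rightarrow> (nat \<Rightarrow> real) \<Rightarrow> real" where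
  "complete_bell n a = (\<Sum>k=1..n. partial_bell n k a)"

definition convolution_power_integral ::
  "'a::euclidean_space measure \<Rightarrow> ('a \<Rightarrow> real) \<Rightarrow> 'a \<Rightarrow> nat \<Rightarrow> real" where
  "convolution_power_integral \<gamma> g z m = (\<integral>x. g (z + (\<Sum>i<m. x i)) \<partial>(\<Pi>\<^sub>M i\<in>{..<m}. \<gamma>))"

text \<open>
  \<open>resolvent \<gamma> g z\<close> is \<open>((I\<^sub>d - \<Gamma>)\<^sup>-\<^sup>1 g)(z)\<close> where \<open>\<Gamma> g z = \<integral>y. g (z + y) \<partial>\<gamma>\<close>; it is meaningful when
  \<open>resolvent_defined \<gamma> g z\<close> holds.
\<close>

definition resolvent_defined :: "'a::euclidean_space measure \<Rightarrow> ('a \<Rightarrow> real) \<Rightarrow> 'a \<Rightarrow> bool" where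
  "resolvent_defined \<gamma> g z \<longleftrightarrow>
     (\<forall>m::nat. m \<ge> 1 \<longrightarrow> integrable (\<Pi>\<^sub>M i\<in>{..<m}. \<gamma>) (\<lambda>x. g (z + (\<Sum>i<m. x i)))) \<and>
     summable (\<lambda>m. convolution_power_integral \<gamma> g z (Suc m))"

definition resolvent :: "'a::euclidean_space measure \<Rightarrow> ('a \<Rightarrow> real) \<Rightarrow> 'a \<Rightarrow> real" where
  "resolvent \<gamma> g z = g z + (\<Sum>m. convolution_power_integral \<gamma> g z (Suc m))"

end

theory Submission
  imports Defs "HOL-Complex_Analysis.Laurent_Convergence"
begin

text \<open>
  Let \<open>m\<^sub>n(z)\<close> be the \<open>n\<close>-th moment of the cluster sum started at \<open>z\<close>, so that
  \<open>m\<^sub>n(z) = B\<^sub>n(\<kappa>\<^sub>z)\<close>. Conditionally on the positions of the points of the first generation, the cluster sum is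
  \<open>f(z)\<close> plus a sum of independent marks at the points of a Poisson process. The cumulants of such a
  sum are the integrals of the moments of the marks; hence \<open>\<kappa>\<^sub>z\<^sup>(\<^sup>n\<^sup>) = \<Gamma> m\<^sub>n(z)\<close> for \<open>n \<ge> 2\<close>, and the
  \<open>n\<close>-th cumulant of the Hawkes process is \<open>\<integral> m\<^sub>n d\<nu>\<close>. So \<open>h\<^sub>n = m\<^sub>n - \<Gamma> m\<^sub>n\<close>, and it remains to see
  that \<open>\<Gamma>\<^sup>N m\<^sub>n\<close> tends to \<open>0\<close>. For \<open>\<bar>f\<bar>\<close> in place of \<open>f\<close>, with \<open>M = H + \<Gamma> M\<close> and \<open>H \<ge> 0\<close>, the moments
  of the sums over the first \<open>N\<close> generations increase to \<open>M\<close> and are bounded by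
  \<open>\<Sum>\<^sub>j\<^sub><\<^sub>N \<Gamma>\<^sup>j H\<close>, so \<open>M = \<Sum>\<^sub>j \<Gamma>\<^sup>j H\<close> and \<open>\<Gamma>\<^sup>N M\<close> tends to \<open>0\<close>; the general case is dominated by this one.

  The moment formula for marked Poisson sums is obtained by comparing power series for bounded marks
  on a set of finite intensity, and by truncation in general. Enumerations of point processes with the same
  intensity may have different laws, so the marks attached to different points are identified in law through
  their characteristic functions, generation by generation.
\<close>

unbundle no vec_syntax

section \<open>Bell polynomials and cumulants\<close>

text \<open>The mass of \<open>\<gamma>\<close> is small, but the moments need not be bounded in
  \<open>z\<close>, so a contraction estimate cannot make Gamma^N m_n vanish; what is needed is that
  the moments for |f| form the least solution of their fixed-point equation. For this reason heights
  are extended naturals: the recursion leads from \<open>L\<close> to \<open>eSuc L\<close>, and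
  since \<open>eSuc \<infinity> = \<infinity>\<close>, one and the same lemma yields the iteration
  over generations and the fixed-point equation of the whole cluster.

  Integrability runs in two directions. At a single point of a cluster the moments of the whole sum
  are given, and the integrability over \<open>\<gamma>\<close> of the moments of the marks has to
  be extracted from them; this works for |f|, because B_n(c) >= c_n for nonnegative arguments. For
  the Hawkes process the moments of the marks are integrable by hypothesis, and the moments of the
  sum are deduced.

  The condition n >= 2 enters because f(z), a deterministic shift, contributes to the first cumulant
  and to no other.\<close>

text \<open>The constant coefficient is forced to 0, whatever \<open>c 0\<close> is. The series may
  then be substituted into \<open>fps_exp 1\<close>, and everything derived from it depends on
  \<open>c k\<close> for k >= 1 only.\<close>

definition exp_gen_series :: "(nat \<Rightarrow> real) \<Rightarrow> real fps" where
  "exp_gen_series c = Abs_fps (\<lambda>k. if k = 0 then 0 else c k / fact k)"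

lemma exp_gen_series_nth_0 [simp]: "exp_gen_series c $ 0 = 0"
  by (simp add: exp_gen_series_def)

definition compositions :: "nat \<Rightarrow> nat \<Rightarrow> nat list set" where
  "compositions n k = {ls. length ls = k \<and> (\<forall>l\<in>set ls. 1 \<le> l) \<and> sum_list ls = n}"

text \<open>The power of a series expands over all lists of exponents; a list with a zero entry
  contributes the vanishing constant coefficient, so only compositions into positive parts
  survive.\<close>

lemma exp_gen_series_power_nth:
  "(exp_gen_series c ^ k) $ n = (\<Sum>ls\<in>compositions n k. \<Prod>l\<leftarrow>ls. c l / fact l)"
proof -
  have "(exp_gen_series c ^ k) $ n = (\<Sum>ls\<in>natpermute n k. \<Prod>l\<leftarrow>ls. exp_gen_series c $ l)"
  proof (cases k)
    case (Suc m)
    have "(\<Prod>j\<in>{0..m}. exp_gen_series c $ (v ! j)) = (\<Prod>l\<leftarrow>v. exp_gen_series c $ l)"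
      if "v \<in> natpermute n (m + 1)" for v
      using that
      by (subst prod.list_conv_set_nth) (auto simp: natpermute_def atLeastLessThanSuc_atLeastAtMost)
    then show ?thesis
      unfolding Suc fps_power_nth_Suc by (intro sum.cong) auto
  qed (auto simp: natpermute_0)
  also have "\<dots> = (\<Sum>ls\<in>compositions n k. \<Prod>l\<leftarrow>ls. exp_gen_series c $ l)"
  proof (rule sum.mono_neutral_right)
    show "\<forall>ls\<in>natpermute n k - compositions n k. (\<Prod>l\<leftarrow>ls. exp_gen_series c $ l) = 0"
    proof
      fix ls assume "ls \<in> natpermute n k - compositions n k"
      then have "0 \<in> set ls"
        by (auto simp: natpermute_def compositions_def Suc_le_eq)
      then show "(\<Prod>l\<leftarrow>ls. exp_gen_series c $ l) = 0"
        by (force simp: prod_list_zero_iff)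
    qed
  qed (auto simp: natpermute_finite, auto simp: compositions_def natpermute_def)
  also have "\<dots> = (\<Sum>ls\<in>compositions n k. \<Prod>l\<leftarrow>ls. c l / fact l)"
    by (intro sum.cong refl arg_cong[where f=prod_list] map_cong)
       (auto simp: compositions_def exp_gen_series_def)
  finally show ?thesis .
qed

lemma partial_bell_eq:
  "partial_bell n k c = fact n / fact k * (exp_gen_series c ^ k) $ n"
  by (simp add: partial_bell_def exp_gen_series_power_nth compositions_def)

text \<open>The exponential formula. The case n = 0 is excluded because
  \<open>complete_bell 0\<close> is an empty sum, whereas the exponential series has constant
  coefficient 1.\<close>

lemma complete_bell_eq:
  assumes "n \<ge> 1"
  shows "complete_bell n c = fact n * (fps_exp 1 oo exp_gen_series c) $ n"
proof -
  have "(fps_exp 1 oo exp_gen_series c) $ n =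
      (\<Sum>k=0..n. 1 / fact k * (exp_gen_series c ^ k) $ n)"
    by (simp add: fps_compose_nth)
  also have "\<dots> = (\<Sum>k=1..n. 1 / fact k * (exp_gen_series c ^ k) $ n)"
    using assms by (intro sum.mono_neutral_right) (auto simp: Suc_le_eq)
  finally show ?thesis
    by (simp add: complete_bell_def partial_bell_eq sum_distrib_left)
qed

lemma exp_gen_series_cong:
  assumes "\<And>k. k \<ge> 1 \<Longrightarrow> a k = b k"
  shows "exp_gen_series a = exp_gen_series b"
  using assms by (auto simp: exp_gen_series_def fps_eq_iff)

lemma partial_bell_cong:
  assumes "\<And>k. k \<ge> 1 \<Longrightarrow> a k = b k"
  shows "partial_bell n k a = partial_bell n k b"
  using exp_gen_series_cong[OF assms] by (simp add: partial_bell_eq)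

lemma complete_bell_cong:
  assumes "\<And>k. k \<ge> 1 \<Longrightarrow> a k = b k"
  shows "complete_bell n a = complete_bell n b"
  unfolding complete_bell_def by (intro sum.cong refl partial_bell_cong assms)

lemma norm_prod_list_le:
  fixes f g :: "'a \<Rightarrow> real"
  assumes "\<And>x. x \<in> set xs \<Longrightarrow> \<bar>f x\<bar> \<le> g x"
  shows "\<bar>prod_list (map f xs)\<bar> \<le> prod_list (map g xs)"
  using assms
proof (induction xs)
  case (Cons x xs)
  then show ?case
    by (auto simp: abs_mult intro!: mult_mono intro: order_trans[OF abs_ge_zero])
qed simp

text \<open>All coefficients of a Bell polynomial are nonnegative, so this is the triangle
  inequality term by term. Monotonicity, positivity and the later domination of \<open>f\<close> by
  |f| are all consequences.\<close>

lemma abs_partial_bell_le: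
  assumes "\<And>k. k \<ge> 1 \<Longrightarrow> \<bar>a k\<bar> \<le> b k"
  shows "\<bar>partial_bell n k a\<bar> \<le> partial_bell n k b"
proof -
  have "\<bar>\<Sum>ls\<in>compositions n k. \<Prod>l\<leftarrow>ls. a l / fact l\<bar>
      \<le> (\<Sum>ls\<in>compositions n k. \<bar>\<Prod>l\<leftarrow>ls. a l / fact l\<bar>)"
    by (rule sum_abs)
  also have "\<dots> \<le> (\<Sum>ls\<in>compositions n k. \<Prod>l\<leftarrow>ls. b l / fact l)"
    by (intro sum_mono norm_prod_list_le)
       (auto simp: compositions_def abs_divide intro!: divide_right_mono assms)
  finally have "fact n / fact k * \<bar>\<Sum>ls\<in>compositions n k. \<Prod>l\<leftarrow>ls. a l / fact l\<bar>
      \<le> fact n / fact k * (\<Sum>ls\<in>compositions n k. \<Prod>l\<leftarrow>ls. b l / fact l)"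
    by (intro mult_left_mono) auto
  then show ?thesis
    by (simp add: partial_bell_def compositions_def abs_mult)
qed

lemma partial_bell_mono:
  assumes "\<And>k. k \<ge> 1 \<Longrightarrow> 0 \<le> a k" "\<And>k. k \<ge> 1 \<Longrightarrow> a k \<le> b k"
  shows "partial_bell n k a \<le> partial_bell n k b"
  using abs_partial_bell_le[of a b n k] assms by force

lemma partial_bell_nonneg:
  assumes "\<And>k. k \<ge> 1 \<Longrightarrow> 0 \<le> a k"
  shows "0 \<le> partial_bell n k a"
  using abs_partial_bell_le[of a a n k] assms by force

lemma complete_bell_mono:
  assumes "\<And>k. k \<ge> 1 \<Longrightarrow> 0 \<le> a k" "\<And>k. k \<ge> 1 \<Longrightarrow> a k \<le> b k"
  shows "complete_bell n a \<le> complete_bell n b"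
  unfolding complete_bell_def by (intro sum_mono partial_bell_mono assms)

lemma partial_bell_1:
  assumes "n \<ge> 1"
  shows "partial_bell n 1 a = a n"
  using assms by (simp add: partial_bell_eq exp_gen_series_def)

text \<open>The pointwise form of h_n = sum of h_{n,k}: the term k = 1 of the Bell polynomial is its
  last argument.\<close>

lemma complete_bell_minus:
  assumes "n \<ge> 2"
  shows "complete_bell n a - a n = (\<Sum>k=2..n. partial_bell n k a)"
proof -
  have "complete_bell n a = partial_bell n 1 a + (\<Sum>k=2..n. partial_bell n k a)"
    using assms by (simp add: complete_bell_def sum.atLeast_Suc_atMost numeral_2_eq_2)
  then show ?thesis
    using assms partial_bell_1[of n a] by simp
qed

text \<open>The term k = 1 equals \<open>a n\<close> and the others are nonnegative. Read backwards,
  a bound on a moment becomes a bound on the quantity that turns out to be the cumulant.\<close>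

lemma complete_bell_ge:
  assumes "\<And>k. k \<ge> 1 \<Longrightarrow> 0 \<le> a k" "n \<ge> 1"
  shows "a n \<le> complete_bell n a"
proof -
  have "partial_bell n 1 a \<le> complete_bell n a"
    unfolding complete_bell_def using assms
    by (intro member_le_sum partial_bell_nonneg) auto
  then show ?thesis
    using partial_bell_1[OF assms(2), of a] by simp
qed

lemma tendsto_prod_list:
  fixes f :: "'a \<Rightarrow> 'b \<Rightarrow> real"
  assumes "\<And>x. x \<in> set xs \<Longrightarrow> ((\<lambda>i. f i x) \<longlongrightarrow> g x) F"
  shows "((\<lambda>i. prod_list (map (f i) xs)) \<longlongrightarrow> prod_list (map g xs)) F"
  using assms by (induction xs) (auto intro!: tendsto_mult)

lemma tendsto_complete_bell:
  assumes "\<And>k. k \<ge> 1 \<Longrightarrow> ((\<lambda>i. a i k) \<longlongrightarrow> b k) F"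
  shows "((\<lambda>i. complete_bell n (a i)) \<longlongrightarrow> complete_bell n b) F"
  unfolding complete_bell_def partial_bell_def
  by (intro tendsto_sum tendsto_mult tendsto_const tendsto_prod_list tendsto_divide)
     (auto intro: assms)

lemma borel_measurable_prod_list:
  fixes f :: "'b \<Rightarrow> 'a \<Rightarrow> real"
  assumes "\<And>x. x \<in> set xs \<Longrightarrow> (\<lambda>y. f y x) \<in> borel_measurable M"
  shows "(\<lambda>y. prod_list (map (f y) xs)) \<in> borel_measurable M"
  using assms by (induction xs) auto

lemma borel_measurable_partial_bell:
  assumes "\<And>k. k \<ge> 1 \<Longrightarrow> (\<lambda>x. a x k) \<in> borel_measurable M"
  shows "(\<lambda>x. partial_bell n k (a x)) \<in> borel_measurable M"
  unfolding partial_bell_def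
  by (intro borel_measurable_times borel_measurable_const borel_measurable_sum
      borel_measurable_prod_list borel_measurable_divide)
     (auto intro: assms)

section \<open>Formal logarithms: from moments to cumulants\<close>

text \<open>Uniqueness for the formal linear equation E' = E D: the quotient E / F has derivative 0
  and constant coefficient 1.\<close>

lemma fps_deriv_eq_mult_unique:
  fixes E F D :: "'a::field_char_0 fps"
  assumes E: "fps_deriv E = E * D" and F: "fps_deriv F = F * D" and "F $ 0 \<noteq> 0" "E $ 0 = F $ 0"
  shows "E = F"
proof -
  have F1: "F * inverse F = 1" "inverse F * F = 1"
    using \<open>F $ 0 \<noteq> 0\<close> by (simp_all add: inverse_mult_eq_1 inverse_mult_eq_1')
  have "fps_deriv (E * inverse F) = E * (- (F * D) * (inverse F)\<^sup>2) + E * D * inverse F"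
    using \<open>F $ 0 \<noteq> 0\<close> by (simp add: fps_inverse_deriv E F)
  also have "\<dots> = E * D * inverse F * (1 - F * inverse F)"
    by (simp add: algebra_simps power2_eq_square)
  finally have "fps_deriv (E * inverse F) = 0"
    by (simp add: F1)
  then have "E * inverse F = fps_const ((E * inverse F) $ 0)"
    by (simp only: fps_deriv_eq_0_iff)
  also have "(E * inverse F) $ 0 = 1"
    using assms by simp
  finally have "E * inverse F * F = F"
    by simp
  then show ?thesis
    by (simp add: mult.assoc F1)
qed

text \<open>Associativity of composition reduces this to the fact that \<open>fps_ln 1\<close> is
  the compositional inverse of \<open>fps_exp 1 - 1\<close>.\<close>

lemma fps_ln_exp_minus_one:
  assumes "C $ 0 = (0::real)"
  shows "fps_ln 1 oo ((fps_exp 1 oo C) - 1) = C"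
proof -
  have "(fps_exp 1 oo C) - 1 = (fps_exp 1 - 1) oo C"
    by (simp add: fps_compose_sub_distrib)
  then have "fps_ln 1 oo ((fps_exp 1 oo C) - 1) = fps_ln 1 oo (fps_exp 1 - 1) oo C"
    using assms by (simp add: fps_compose_assoc)
  also have "fps_ln 1 oo (fps_exp 1 - 1) = (fps_X :: real fps)"
    unfolding fps_ln_fps_exp_inv[OF one_neq_zero] by (intro fps_inv) auto
  finally show ?thesis
    by (simp add: fps_X_fps_compose_startby0 assms)
qed

lemma (in prob_space) moment_series_eq:
  assumes "\<And>n. n \<ge> 1 \<Longrightarrow> (\<integral>\<omega>. X \<omega> ^ n \<partial>M) = complete_bell n c"
  shows "moment_series M X = fps_exp 1 oo exp_gen_series c"
proof (rule fps_ext)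
  fix n show "moment_series M X $ n = (fps_exp 1 oo exp_gen_series c) $ n"
    using assms[of n] complete_bell_eq[of n c]
    by (cases n) (auto simp: moment_series_def prob_space)
qed

text \<open>The only way in which cumulants are identified below: it suffices to exhibit some
  sequence whose Bell polynomials are the moments, since the formal logarithm inverts the
  exponential formula.\<close>

lemma (in prob_space) cumulant_eq:
  assumes "\<And>n. n \<ge> 1 \<Longrightarrow> (\<integral>\<omega>. X \<omega> ^ n \<partial>M) = complete_bell n c" and "k \<ge> 1"
  shows "cumulant M X k = c k"
  using assms(2) unfolding cumulant_def
  by (simp add: moment_series_eq[OF assms(1)] fps_ln_exp_minus_one)
     (simp add: exp_gen_series_def)

text \<open>A deterministic shift multiplies the moment series by exp(a t), and therefore changes
  the first cumulant alone.\<close>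

lemma (in prob_space) moments_add_const:
  assumes int: "\<And>n. integrable M (\<lambda>\<omega>. X \<omega> ^ n :: real)"
    and X: "\<And>n. n \<ge> 1 \<Longrightarrow> (\<integral>\<omega>. X \<omega> ^ n \<partial>M) = complete_bell n c" and "n \<ge> 1"
  shows "(\<integral>\<omega>. (a + X \<omega>) ^ n \<partial>M) = complete_bell n (\<lambda>k. (if k = 1 then a else 0) + c k)"
proof -
  let ?C = "exp_gen_series c"
  have "(\<integral>\<omega>. (a + X \<omega>) ^ n \<partial>M) =
      (\<integral>\<omega>. (\<Sum>k\<le>n. of_nat (n choose k) * a ^ k * X \<omega> ^ (n - k)) \<partial>M)"
    by (simp add: binomial_ring)
  also have "\<dots> = (\<Sum>k\<le>n. of_nat (n choose k) * a ^ k * (\<integral>\<omega>. X \<omega> ^ (n - k) \<partial>M))"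
    by (subst Bochner_Integration.integral_sum) (auto intro!: integrable_mult_right int)
  also have "\<dots> = fact n * (\<Sum>k=0..n. fps_exp a $ k * moment_series M X $ (n - k))"
    by (auto simp: sum_distrib_left moment_series_def binomial_fact atMost_atLeast0 intro!: sum.cong)
  also have "\<dots> = fact n * (fps_exp a * moment_series M X) $ n"
    by (simp add: fps_mult_nth)
  also have "fps_exp a * moment_series M X = (fps_exp a oo fps_X) * (fps_exp 1 oo ?C)"
    using moment_series_eq[OF X] by simp
  \<comment> \<open>The functional equation of the exponential for formal series: both sides solve
    the same linear differential equation with the same constant coefficient.\<close>
  also have "\<dots> = fps_exp 1 oo (fps_const a * fps_X + ?C)"
  proof -
    let ?A = "fps_const a * fps_X :: real fps"
    have "fps_deriv (fps_exp 1 oo (?A + ?C)) = (fps_exp 1 oo (?A + ?C)) * fps_deriv (?A + ?C)"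
      by (subst fps_compose_deriv) auto
    moreover have "fps_deriv (fps_exp a * (fps_exp 1 oo ?C)) = fps_exp a * (fps_exp 1 oo ?C) * fps_deriv (?A + ?C)"
      by (simp add: fps_compose_deriv algebra_simps)
    ultimately have "fps_exp 1 oo (?A + ?C) = fps_exp a * (fps_exp 1 oo ?C)"
      by (rule fps_deriv_eq_mult_unique) auto
    then show ?thesis by simp
  qed
  also have "fps_const a * fps_X + ?C = exp_gen_series (\<lambda>k. (if k = 1 then a else 0) + c k)"
    by (auto simp: fps_eq_iff exp_gen_series_def le_Suc_eq)
  finally show ?thesis
    using complete_bell_eq[OF \<open>n \<ge> 1\<close>] by simp
qed

section \<open>Independence and Poisson counts\<close>

text \<open>Grouping of an independent family along disjoint index sets. It is applied twice: with
  \<open>a\<close> the ancestor and \<open>b i u\<close> the label \<open>u @ [i]\<close>, and with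
  \<open>a\<close> the immigrant process and \<open>b i u\<close> the label \<open>u\<close> in the
  i-th cluster. The three conclusions say that \<open>X a\<close> is independent of all branches
  together, that the branches are independent of each other, and that each branch is again an
  independent family.\<close>

lemma (in prob_space) indep_vars_branches:
  fixes X :: "'i \<Rightarrow> 'a \<Rightarrow> 'b" and b :: "nat \<Rightarrow> 'j \<Rightarrow> 'i"
  assumes X: "indep_vars (\<lambda>_. N) X UNIV"
    and b: "inj (case_prod b)" and a: "\<And>i j. b i j \<noteq> a"
  shows "distr M (N \<Otimes>\<^sub>M (\<Pi>\<^sub>M i\<in>UNIV. \<Pi>\<^sub>M j\<in>UNIV. N)) (\<lambda>\<omega>. (X a \<omega>, \<lambda>i j. X (b i j) \<omega>)) =
      distr M N (X a) \<Otimes>\<^sub>M distr M (\<Pi>\<^sub>M i\<in>UNIV. \<Pi>\<^sub>M j\<in>UNIV. N) (\<lambda>\<omega> i j. X (b i j) \<omega>)"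
    and "indep_vars (\<lambda>_. \<Pi>\<^sub>M j\<in>UNIV. N) (\<lambda>i \<omega> j. X (b i j) \<omega>) UNIV"
    and "indep_vars (\<lambda>_. N) (\<lambda>j. X (b i j)) UNIV"
proof -
  have rv[measurable]: "random_variable N (X i)" for i
    using X by (auto simp: indep_vars_def)
  let ?B = "range (case_prod b)"
  let ?A = "PiM {a} (\<lambda>_. N)" and ?P = "PiM ?B (\<lambda>_. N)" and ?G = "\<Pi>\<^sub>M i\<in>(UNIV :: nat set). \<Pi>\<^sub>M j\<in>(UNIV :: 'j set). N"
  let ?XA = "\<lambda>\<omega>. restrict (\<lambda>i. X i \<omega>) {a}" and ?XB = "\<lambda>\<omega>. restrict (\<lambda>i. X i \<omega>) ?B"
  let ?f = "\<lambda>f. f a" and ?g = "\<lambda>f i j. f (b i j)"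
  have "indep_var ?A ?XA ?P ?XB"
    using a by (intro indep_var_restrict[OF X]) auto
  then have eq: "distr M (?A \<Otimes>\<^sub>M ?P) (\<lambda>\<omega>. (?XA \<omega>, ?XB \<omega>)) = distr M ?A ?XA \<Otimes>\<^sub>M distr M ?P ?XB"
    and [measurable]: "?XA \<in> measurable M ?A" "?XB \<in> measurable M ?P"
    unfolding indep_var_distribution_eq by auto
  have f[measurable]: "?f \<in> measurable ?A N"
    by (rule measurable_component_singleton) simp
  have g[measurable]: "?g \<in> measurable ?P ?G"
    by (intro measurable_PiM_single' measurable_component_singleton) (auto simp: space_PiM PiE_iff)
  interpret G: prob_space "distr (distr M ?P ?XB) ?G ?g"
    by (intro prob_space.prob_space_distr prob_space_distr) auto
  have h: "(\<lambda>(x, y). (?f x, ?g y)) \<in> measurable (?A \<Otimes>\<^sub>M ?P) (N \<Otimes>\<^sub>M ?G)"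
    by measurable
  have B: "b i j \<in> ?B" for i j by auto
  have "distr M N (X a) \<Otimes>\<^sub>M distr M ?G (\<lambda>\<omega> i j. X (b i j) \<omega>) =
      distr (distr M ?A ?XA) N ?f \<Otimes>\<^sub>M distr (distr M ?P ?XB) ?G ?g"
    unfolding distr_distr[OF f \<open>?XA \<in> measurable M ?A\<close>] distr_distr[OF g \<open>?XB \<in> measurable M ?P\<close>]
    by (simp only: comp_def restrict_apply B singleton_iff if_True refl)
  also have "\<dots> = distr (distr M ?A ?XA \<Otimes>\<^sub>M distr M ?P ?XB) (N \<Otimes>\<^sub>M ?G) (\<lambda>(x, y). (?f x, ?g y))"
    by (rule pair_measure_distr) (auto intro: G.sigma_finite_measure_axioms f g)
  also have "\<dots> = distr M (N \<Otimes>\<^sub>M ?G) (\<lambda>\<omega>. (X a \<omega>, \<lambda>i j. X (b i j) \<omega>))"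
    unfolding eq[symmetric]
    by (subst distr_distr[OF h])
       (simp_all only: comp_def restrict_apply B singleton_iff if_True refl prod.case
          measurable_Pair \<open>?XA \<in> measurable M ?A\<close> \<open>?XB \<in> measurable M ?P\<close>)
  finally show "distr M (N \<Otimes>\<^sub>M ?G) (\<lambda>\<omega>. (X a \<omega>, \<lambda>i j. X (b i j) \<omega>)) =
      distr M N (X a) \<Otimes>\<^sub>M distr M ?G (\<lambda>\<omega> i j. X (b i j) \<omega>)" ..

  let ?C = "\<lambda>i. range (b i)"
  have "disjoint_family ?C"
    using b by (auto simp: disjoint_family_on_def inj_on_def)
  then have "indep_vars (\<lambda>i. PiM (?C i) (\<lambda>_. N)) (\<lambda>i \<omega>. restrict (\<lambda>k. X k \<omega>) (?C i)) UNIV"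
    by (intro indep_vars_restrict[OF X]) auto
  moreover have "(\<lambda>f j. f (b i j)) \<in> measurable (PiM (?C i) (\<lambda>_. N)) (\<Pi>\<^sub>M j\<in>UNIV. N)" for i
    by (intro measurable_PiM_single' measurable_component_singleton) (auto simp: space_PiM PiE_iff)
  ultimately have "indep_vars (\<lambda>_. \<Pi>\<^sub>M j\<in>UNIV. N)
      (\<lambda>i \<omega>. (\<lambda>f j. f (b i j)) (restrict (\<lambda>k. X k \<omega>) (?C i))) UNIV"
    by (rule indep_vars_compose2)
  then show "indep_vars (\<lambda>_. \<Pi>\<^sub>M j\<in>UNIV. N) (\<lambda>i \<omega> j. X (b i j) \<omega>) UNIV"
    by (simp add: restrict_def)

  have "inj (b i)"
    using b by (auto simp: inj_on_def)
  then have "disjoint_family (\<lambda>j. {b i j})"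
    by (auto simp: disjoint_family_on_def inj_on_def)
  then have "indep_vars (\<lambda>j. PiM {b i j} (\<lambda>_. N)) (\<lambda>j \<omega>. restrict (\<lambda>k. X k \<omega>) {b i j}) UNIV"
    by (intro indep_vars_restrict[OF X]) auto
  moreover have "(\<lambda>f. f (b i j)) \<in> measurable (PiM {b i j} (\<lambda>_. N)) N" for j
    by (rule measurable_component_singleton) simp
  ultimately have "indep_vars (\<lambda>_. N) (\<lambda>j \<omega>. (\<lambda>f. f (b i j)) (restrict (\<lambda>k. X k \<omega>) {b i j})) UNIV"
    by (rule indep_vars_compose2)
  then show "indep_vars (\<lambda>_. N) (\<lambda>j. X (b i j)) UNIV"
    by simp
qed

section \<open>Measurability of enumerations and Poisson counts\<close>

lemma measurable_enum_space_fst [measurable]: "fst \<in> measurable enum_space (count_space UNIV)"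
  and measurable_enum_space_snd: "snd \<in> measurable enum_space (\<Pi>\<^sub>M i\<in>UNIV. borel)"
  by (simp_all add: enum_space_def)

lemma space_enum_space [simp]: "space enum_space = UNIV"
  by (simp add: enum_space_def space_pair_measure space_PiM PiE_def)

lemma measurable_enum_space_point [measurable]: "(\<lambda>c. snd c i) \<in> borel_measurable enum_space"
  by (rule measurable_compose[OF measurable_enum_space_snd measurable_component_singleton]) simp

lemma measurable_indices [measurable]: "Measurable.pred enum_space (\<lambda>c. i \<in> indices c)"
  by (simp add: indices_def)

lemma nn_integral_points:
  "h \<in> borel_measurable borel \<Longrightarrow> (\<integral>\<^sup>+x. h x \<partial>points I p) = (\<integral>\<^sup>+i. h (p i) \<partial>count_space I)"
  by (simp add: points_def nn_integral_distr)

lemma integral_points: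
  fixes h :: "'a::topological_space \<Rightarrow> 'b::{banach, second_countable_topology}"
  shows "h \<in> borel_measurable borel \<Longrightarrow> (\<integral>x. h x \<partial>points I p) = (\<integral>i. h (p i) \<partial>count_space I)"
  by (simp add: points_def integral_distr)

lemma emeasure_enum_points:
  assumes "B \<in> sets borel"
  shows "emeasure (enum_points c) B = emeasure (count_space UNIV) {i \<in> indices c. snd c i \<in> B}"
proof -
  have "emeasure (enum_points c) B = emeasure (count_space (indices c)) (snd c -` B \<inter> indices c)"
    using assms by (simp add: enum_points_def points_def emeasure_distr)
  also have "\<dots> = emeasure (count_space UNIV) {i \<in> indices c. snd c i \<in> B}"
    by (simp add: emeasure_count_space Int_def conj_commute)
  finally show ?thesis .
qed

text \<open>Indices are collected rather than points, so multiplicities are kept.\<close>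

definition hits :: "'a enumeration \<Rightarrow> 'a set \<Rightarrow> nat set" where
  "hits c B = {i \<in> indices c. snd c i \<in> B}"

definition poisson_weight :: "real \<Rightarrow> nat \<Rightarrow> real" where
  "poisson_weight r k = r ^ k / fact k * exp (- r)"

text \<open>\<open>poisson_distributed\<close> prescribes only the probabilities of the finite
  values of an extended count. Almost sure finiteness follows because these probabilities already
  sum to 1.\<close>

lemma (in prob_space) poisson_process_hits:
  assumes \<eta>: "poisson_process M \<mu> \<eta>" and B: "B \<in> sets borel" "emeasure \<mu> B < \<infinity>"
  shows poisson_process_finite_hits: "AE \<omega> in M. finite (hits (\<eta> \<omega>) B)"
    and poisson_process_distr_card: "distr M (count_space UNIV) (\<lambda>\<omega>. card (hits (\<eta> \<omega>) B)) = density (count_space UNIV) (\<lambda>k. ennreal (poisson_weight (measure \<mu> B) k))"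
    and poisson_process_measurable_card: "(\<lambda>\<omega>. card (hits (\<eta> \<omega>) B)) \<in> measurable M (count_space UNIV)"
proof -
  let ?N = "\<lambda>\<omega>. emeasure (enum_points (\<eta> \<omega>)) B" and ?r = "measure \<mu> B"
  let ?c = "\<lambda>\<omega>. card (hits (\<eta> \<omega>) B)"
  have N: "?N \<omega> = emeasure (count_space UNIV) (hits (\<eta> \<omega>) B)" for \<omega>
    unfolding hits_def by (rule emeasure_enum_points[OF B(1)])
  have "poisson_distributed M ?N (emeasure \<mu> B)"
    using \<eta> B(1) unfolding poisson_process_def by blast
  then have N_meas[measurable]: "?N \<in> borel_measurable M"
    and N_law: "prob {\<omega> \<in> space M. ?N \<omega> = of_nat k} = poisson_weight ?r k" for k
  proof -
    have "enn2real (emeasure \<mu> B) = ?r" "emeasure \<mu> B \<noteq> \<infinity>"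
      using B(2) by (auto simp: measure_def)
    then show "?N \<in> borel_measurable M" "prob {\<omega> \<in> space M. ?N \<omega> = of_nat k} = poisson_weight ?r k" for k
      using \<open>poisson_distributed M ?N (emeasure \<mu> B)\<close>
      unfolding poisson_distributed_def poisson_weight_def by simp_all
  qed
  have Nk: "?N \<omega> = of_nat k \<longleftrightarrow> finite (hits (\<eta> \<omega>) B) \<and> ?c \<omega> = k" for \<omega> k
    unfolding N by (auto simp: emeasure_count_space)
  \<comment> \<open>Measurability of the cardinality is inherited from the count; the value 0 at
    infinity matches the convention that an infinite set has cardinality 0.\<close>
  have card_eq: "?c \<omega> = (if ?N \<omega> = \<infinity> then 0 else nat \<lfloor>enn2real (?N \<omega>)\<rfloor>)" for \<omega>
    by (simp add: N emeasure_count_space)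
  show c_meas[measurable]: "?c \<in> measurable M (count_space UNIV)"
    unfolding card_eq by measurable
  have "(\<lambda>k. prob {\<omega> \<in> space M. ?N \<omega> = of_nat k}) sums prob (\<Union>k. {\<omega> \<in> space M. ?N \<omega> = of_nat k})"
    by (intro finite_measure_UNION) (auto simp: disjoint_family_on_def)
  moreover have "(\<lambda>k. prob {\<omega> \<in> space M. ?N \<omega> = of_nat k}) sums (exp ?r * exp (- ?r))"
    unfolding N_law poisson_weight_def using exp_converges[of ?r] by (intro sums_mult2) (simp add: divide_inverse mult.commute)
  ultimately have "prob (\<Union>k. {\<omega> \<in> space M. ?N \<omega> = of_nat k}) = exp ?r * exp (- ?r)"
    by (rule sums_unique2)
  then have "prob (\<Union>k. {\<omega> \<in> space M. ?N \<omega> = of_nat k}) = 1"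
    by (simp add: exp_minus_inverse)
  then have "AE \<omega> in M. \<omega> \<in> (\<Union>k. {\<omega> \<in> space M. ?N \<omega> = of_nat k})"
    by (subst (asm) prob_eq_1) auto
  then show fin: "AE \<omega> in M. finite (hits (\<eta> \<omega>) B)"
    by eventually_elim (use Nk in auto)
  show "distr M (count_space UNIV) ?c = density (count_space UNIV) (\<lambda>k. ennreal (poisson_weight ?r k))"
  proof (rule measure_eqI_countable[where A=UNIV])
    fix k :: nat
    have "emeasure (distr M (count_space UNIV) ?c) {k} = emeasure M {\<omega> \<in> space M. ?c \<omega> = k}"
      by (subst emeasure_distr) (auto intro!: arg_cong[where f="emeasure M"])
    also have "\<dots> = emeasure M {\<omega> \<in> space M. ?N \<omega> = of_nat k}"
    proof (rule emeasure_eq_AE)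
      show "AE \<omega> in M. \<omega> \<in> {\<omega> \<in> space M. ?c \<omega> = k} \<longleftrightarrow> \<omega> \<in> {\<omega> \<in> space M. ?N \<omega> = of_nat k}"
        using fin by eventually_elim (simp add: Nk)
    qed measurable
    also have "\<dots> = emeasure (density (count_space UNIV) (\<lambda>k. ennreal (poisson_weight ?r k))) {k}"
      by (simp add: emeasure_eq_measure N_law emeasure_density nn_integral_count_space_indicator)
    finally show "emeasure (distr M (count_space UNIV) ?c) {k} = emeasure (density (count_space UNIV) (\<lambda>k. ennreal (poisson_weight ?r k))) {k}" .
  qed auto
qed

text \<open>The probability generating function, for every complex \<open>v\<close> and not only in
  the unit disc: later \<open>v\<close> stands for bounds such as exp(|a| b), which exceed
  1.\<close>

lemma integral_poisson_weight:
  fixes v :: complex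
  assumes "0 \<le> r"
  defines "D \<equiv> density (count_space UNIV) (\<lambda>k. ennreal (poisson_weight r k))"
  shows integrable_poisson_weight_power: "integrable D (\<lambda>k. v ^ k)"
    and integral_poisson_weight_power: "(\<integral>k. v ^ k \<partial>D) = exp (of_real r * (v - 1))"
proof -
  have nonneg: "0 \<le> poisson_weight r k" for k
    using assms by (simp add: poisson_weight_def)
  have nrm: "norm (poisson_weight r k *\<^sub>R v ^ k) = (r * norm v) ^ k /\<^sub>R fact k * exp (- r)" for k
    using assms by (simp add: poisson_weight_def norm_power norm_mult power_mult_distrib field_simps)
  have "summable (\<lambda>k. norm (poisson_weight r k *\<^sub>R v ^ k))"
    unfolding nrm using exp_converges[of "r * norm v"] by (intro summable_mult2) (auto simp: sums_iff)
  then have int: "integrable (count_space UNIV) (\<lambda>k. poisson_weight r k *\<^sub>R v ^ k)"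
    by (simp add: integrable_count_space_nat_iff)
  then show "integrable D (\<lambda>k. v ^ k)"
    unfolding D_def using nonneg by (subst integrable_density) auto
  have "(\<integral>k. v ^ k \<partial>D) = (\<integral>k. poisson_weight r k *\<^sub>R v ^ k \<partial>count_space UNIV)"
    unfolding D_def using nonneg by (subst integral_density) auto
  also have "\<dots> = (\<Sum>k. poisson_weight r k *\<^sub>R v ^ k)"
    by (rule integral_count_space_nat[OF int])
  also have "\<dots> = exp (of_real r * v) * exp (- of_real r)"
  proof (rule sums_unique[symmetric])
    have "(\<lambda>k. (of_real r * v) ^ k /\<^sub>R fact k * exp (- of_real r)) sums (exp (of_real r * v) * exp (- of_real r))"
      by (intro sums_mult2 exp_converges)
    also have "(\<lambda>k. (of_real r * v) ^ k /\<^sub>R fact k * exp (- of_real r)) = (\<lambda>k. poisson_weight r k *\<^sub>R v ^ k)"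
      by (auto simp: fun_eq_iff poisson_weight_def power_mult_distrib scaleR_conv_of_real exp_of_real[symmetric] field_simps)
    finally show "(\<lambda>k. poisson_weight r k *\<^sub>R v ^ k) sums (exp (of_real r * v) * exp (- of_real r))" .
  qed
  also have "\<dots> = exp (of_real r * (v - 1))"
    by (simp add: exp_add[symmetric] algebra_simps)
  finally show "(\<integral>k. v ^ k \<partial>D) = exp (of_real r * (v - 1))" .
qed

lemma (in prob_space) poisson_process_integral_power:
  fixes v :: complex
  assumes "poisson_process M \<mu> \<eta>" "B \<in> sets borel" "emeasure \<mu> B < \<infinity>"
  shows poisson_process_integrable_power: "integrable M (\<lambda>\<omega>. v ^ card (hits (\<eta> \<omega>) B))"
    and poisson_process_integral_power': "(\<integral>\<omega>. v ^ card (hits (\<eta> \<omega>) B) \<partial>M) = exp (of_real (measure \<mu> B) * (v - 1))"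
proof -
  note [measurable] = poisson_process_measurable_card[OF assms]
  have "integrable (distr M (count_space UNIV) (\<lambda>\<omega>. card (hits (\<eta> \<omega>) B))) (\<lambda>k. v ^ k)"
    unfolding poisson_process_distr_card[OF assms] by (rule integrable_poisson_weight_power) simp
  then show "integrable M (\<lambda>\<omega>. v ^ card (hits (\<eta> \<omega>) B))"
    by (subst (asm) integrable_distr_eq) auto
  have "(\<integral>\<omega>. v ^ card (hits (\<eta> \<omega>) B) \<partial>M) =
      (\<integral>k. v ^ k \<partial>distr M (count_space UNIV) (\<lambda>\<omega>. card (hits (\<eta> \<omega>) B)))"
    by (subst integral_distr) auto
  then show "(\<integral>\<omega>. v ^ card (hits (\<eta> \<omega>) B) \<partial>M) = exp (of_real (measure \<mu> B) * (v - 1))"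
    unfolding poisson_process_distr_card[OF assms] by (simp add: integral_poisson_weight_power)
qed

section \<open>The functional of a marked Poisson process\<close>

text \<open>Factors are grouped by their value. The value 1 is dropped, because its level set may
  leave \<open>B\<close> and be hit infinitely often.\<close>

lemma prod_hits_simple:
  fixes s :: "'a::topological_space \<Rightarrow> complex"
  assumes fin: "finite (hits c B)" and V: "finite (range s)" and s: "\<And>x. x \<notin> B \<Longrightarrow> s x = 1"
  shows "(\<Prod>i\<in>hits c B. s (snd c i)) = (\<Prod>v\<in>range s - {1}. v ^ card (hits c (s -` {v})))"
proof -
  have "(\<Prod>i\<in>hits c B. s (snd c i)) =
      (\<Prod>v\<in>range s. \<Prod>i\<in>{i \<in> hits c B. s (snd c i) = v}. s (snd c i))"
    by (rule prod.group[symmetric, OF fin V]) auto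
  also have "\<dots> = (\<Prod>v\<in>range s. v ^ card {i \<in> hits c B. s (snd c i) = v})"
    by (intro prod.cong refl) simp
  also have "\<dots> = (\<Prod>v\<in>range s - {1}. v ^ card {i \<in> hits c B. s (snd c i) = v})"
    using V by (intro prod.mono_neutral_right) auto
  also have "\<dots> = (\<Prod>v\<in>range s - {1}. v ^ card (hits c (s -` {v})))"
  proof (intro prod.cong refl arg_cong2[where f="(^)"] arg_cong[where f=card])
    fix v assume "v \<in> range s - {1}"
    then have "x \<in> B" if "s x = v" for x
      using s[of x] that by auto
    then show "{i \<in> hits c B. s (snd c i) = v} = hits c (s -` {v})"
      by (auto simp: hits_def)
  qed
  finally show ?thesis .
qed

text \<open>The counts on the disjoint level sets of \<open>s\<close> are independent Poisson
  variables, so the expectation factors into generating functions evaluated at the values of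
  \<open>s\<close>.\<close>

lemma (in prob_space) poisson_process_functional_simple:
  fixes s :: "'b::second_countable_topology \<Rightarrow> complex"
  assumes \<eta>: "poisson_process M \<mu> \<eta>" and sets: "sets \<mu> = sets borel"
    and B: "B \<in> sets borel" "emeasure \<mu> B < \<infinity>"
    and s[measurable]: "s \<in> borel_measurable borel" and V: "finite (range s)" and s1: "\<And>x. x \<notin> B \<Longrightarrow> s x = 1"
  shows "(\<integral>\<omega>. (\<Prod>i\<in>hits (\<eta> \<omega>) B. s (snd (\<eta> \<omega>) i)) \<partial>M) = exp (\<integral>x. s x - 1 \<partial>\<mu>)"
proof -
  note [measurable_cong] = sets
  let ?V = "range s - {1}"
  define A where "A v = s -` {v}" for v
  have A[measurable]: "A v \<in> sets borel" for v
    using measurable_sets[OF s, of "{v}"] by (simp add: A_def)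
  have AB: "A v \<subseteq> B" if "v \<in> ?V" for v
    using s1 that by (auto simp: A_def)
  have A_fin: "emeasure \<mu> (A v) < \<infinity>" if "v \<in> ?V" for v
    using emeasure_mono[OF AB[OF that], of \<mu>] B sets by (simp add: order.strict_trans1)
  have finV: "finite ?V" using V by simp
  \<comment> \<open>The values are numbered because \<open>poisson_process\<close> states
    independence for families indexed by an initial segment of the naturals.\<close>
  obtain f and m :: nat where f: "bij_betw f {..<m} ?V"
    using ex_bij_betw_nat_finite[OF finV] by (auto simp: atLeast0LessThan)
  let ?P = "\<lambda>v \<omega>. v ^ card (hits (\<eta> \<omega>) (A v))"
  \<comment> \<open>Rewrites each power as a measurable function of the extended count, so that
    independence of the counts passes to the powers.\<close>
  let ?g = "\<lambda>v e. v ^ (if e = \<infinity> then 0 else nat \<lfloor>enn2real e\<rfloor>) :: complex"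
  let ?N = "\<lambda>v \<omega>. emeasure (enum_points (\<eta> \<omega>)) (A v)"
  have N: "?N v \<omega> = emeasure (count_space UNIV) (hits (\<eta> \<omega>) (A v))" for v \<omega>
    unfolding hits_def by (rule emeasure_enum_points) simp
  have gN: "?g v (?N v \<omega>) = ?P v \<omega>" for v \<omega>
    by (simp add: N emeasure_count_space)
  have "indep_vars (\<lambda>_. borel) (\<lambda>i \<omega>. ?N (f i) \<omega>) {..<m}"
  proof -
    have "(\<lambda>i. A (f i)) ` {..<m} \<subseteq> sets borel" by auto
    moreover have "disjoint_family_on (\<lambda>i. A (f i)) {..<m}"
      using f by (auto simp: disjoint_family_on_def A_def bij_betw_def inj_on_def)
    ultimately show ?thesis
      using \<eta> unfolding poisson_process_def by blast
  qed
  then have "indep_vars (\<lambda>_. borel) (\<lambda>i \<omega>. ?g (f i) (?N (f i) \<omega>)) {..<m}"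
    by (rule indep_vars_compose2) measurable
  then have ind: "indep_vars (\<lambda>_. borel) (\<lambda>i \<omega>. ?P (f i) \<omega>) {..<m}"
    unfolding gN .
  have fV: "f i \<in> ?V" if "i < m" for i
    using f that by (auto simp: bij_betw_def)
  have int: "integrable M (?P (f i))" if "i < m" for i
    by (rule poisson_process_integrable_power[OF \<eta> A A_fin[OF fV[OF that]]])
  have "(\<integral>\<omega>. (\<Prod>i\<in>hits (\<eta> \<omega>) B. s (snd (\<eta> \<omega>) i)) \<partial>M) = (\<integral>\<omega>. (\<Prod>i<m. ?P (f i) \<omega>) \<partial>M)"
  proof (rule integral_cong_AE)
    show "AE \<omega> in M. (\<Prod>i\<in>hits (\<eta> \<omega>) B. s (snd (\<eta> \<omega>) i)) = (\<Prod>i<m. ?P (f i) \<omega>)"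
      using poisson_process_finite_hits[OF \<eta> B]
    proof eventually_elim
      case (elim \<omega>)
      have "(\<Prod>i\<in>hits (\<eta> \<omega>) B. s (snd (\<eta> \<omega>) i)) = (\<Prod>v\<in>?V. ?P v \<omega>)"
        unfolding A_def by (rule prod_hits_simple[OF elim V]) (rule s1)
      then show ?case
        using prod.reindex_bij_betw[OF f, of "\<lambda>v. ?P v \<omega>"] by simp
    qed
    show meas: "(\<lambda>\<omega>. \<Prod>i<m. ?P (f i) \<omega>) \<in> borel_measurable M"
      using int by (intro borel_measurable_prod borel_measurable_integrable) auto
    have [measurable]: "\<eta> \<in> measurable M enum_space"
      using \<eta> by (simp add: poisson_process_def)
    have fm: "Measurable.pred M (\<lambda>\<omega>. finite (hits (\<eta> \<omega>) B))"
      unfolding hits_def finite_nat_set_iff_bounded using B by simp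
    \<comment> \<open>On the null event of infinitely many hits the product is 1 by convention;
      measurability has to account for that event as well.\<close>
    show "(\<lambda>\<omega>. \<Prod>i\<in>hits (\<eta> \<omega>) B. s (snd (\<eta> \<omega>) i)) \<in> borel_measurable M"
    proof (subst measurable_cong)
      show "(\<Prod>i\<in>hits (\<eta> \<omega>) B. s (snd (\<eta> \<omega>) i)) =
          (if finite (hits (\<eta> \<omega>) B) then \<Prod>i<m. ?P (f i) \<omega> else 1)" for \<omega>
        using prod_hits_simple[OF _ V s1, of "\<eta> \<omega>" B]
        by (auto simp: A_def prod.reindex_bij_betw[OF f, of "\<lambda>v. v ^ card (hits (\<eta> \<omega>) (s -` {v}))"])
    qed (use meas fm in measurable)
  qed
  also have "\<dots> = (\<Prod>i<m. \<integral>\<omega>. ?P (f i) \<omega> \<partial>M)"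
    using int by (intro indep_vars_lebesgue_integral ind) auto
  also have "\<dots> = (\<Prod>i<m. exp (of_real (measure \<mu> (A (f i))) * (f i - 1)))"
    by (intro prod.cong refl poisson_process_integral_power'[OF \<eta> A A_fin] fV) simp
  also have "\<dots> = (\<Prod>v\<in>?V. exp (of_real (measure \<mu> (A v)) * (v - 1)))"
    by (rule prod.reindex_bij_betw[OF f])
  also have "\<dots> = exp (\<Sum>v\<in>?V. of_real (measure \<mu> (A v)) * (v - 1))"
    by (simp add: exp_sum[OF finV])
  also have "(\<Sum>v\<in>?V. of_real (measure \<mu> (A v)) * (v - 1)) = (\<integral>x. (\<Sum>v\<in>?V. indicator (A v) x *\<^sub>R (v - 1)) \<partial>\<mu>)"
    using A_fin by (subst Bochner_Integration.integral_sum) (auto simp: scaleR_conv_of_real)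
  also have "\<dots> = (\<integral>x. s x - 1 \<partial>\<mu>)"
  proof (rule Bochner_Integration.integral_cong[OF refl])
    fix x
    have "(\<Sum>v\<in>?V. indicator (A v) x *\<^sub>R (v - 1)) = (\<Sum>v\<in>range s. if v = s x then v - 1 else 0)"
      using V by (intro sum.mono_neutral_cong_left) (auto simp: A_def indicator_def)
    then show "(\<Sum>v\<in>?V. indicator (A v) x *\<^sub>R (v - 1)) = s x - 1"
      using V by simp
  qed
  finally show ?thesis .
qed

text \<open>A product over a random finite set is the limit of products over fixed ranges in which
  the missing indices contribute the factor 1.\<close>

lemma measurable_prod_hits:
  fixes F :: "nat \<Rightarrow> 'c \<Rightarrow> complex"
  assumes [measurable]: "\<And>i. F i \<in> borel_measurable N" "e \<in> measurable N enum_space" "B \<in> sets borel"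
  shows "(\<lambda>x. \<Prod>i\<in>hits (e x :: 'b::second_countable_topology enumeration) B. F i x) \<in> borel_measurable N"
proof -
  let ?p = "\<lambda>n x. \<Prod>i<n. if i \<in> hits (e x) B then F i x else 1"
  have fm[measurable]: "Measurable.pred N (\<lambda>x. finite (hits (e x) B))"
    unfolding hits_def finite_nat_set_iff_bounded by simp
  have [measurable]: "Measurable.pred N (\<lambda>x. i \<in> hits (e x) B)" for i
    unfolding hits_def by simp
  have "(\<Prod>i\<in>hits (e x) B. F i x) = (if finite (hits (e x) B) then lim (\<lambda>n. ?p n x) else 1)" for x
  proof (cases "finite (hits (e x) B)")
    case True
    then obtain m where m: "\<And>i. i \<in> hits (e x) B \<Longrightarrow> i < m"
      by (auto simp: finite_nat_set_iff_bounded)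
    have "(\<lambda>n. ?p n x) \<longlonglongrightarrow> (\<Prod>i\<in>hits (e x) B. F i x)"
    proof (rule tendsto_eventually, rule eventually_sequentiallyI[of m])
      fix n assume "m \<le> n"
      then show "?p n x = (\<Prod>i\<in>hits (e x) B. F i x)"
        using m by (intro prod.mono_neutral_cong_right) (auto intro: less_le_trans)
    qed
    then show ?thesis
      using True by (simp add: limI)
  qed simp
  then show ?thesis
    by simp
qed

text \<open>Extension from simple functions by dominated convergence on both sides. On the
  probability side the bound is a power of a constant with the number of hits as exponent,
  integrable by the generating function.\<close>

lemma (in prob_space) poisson_process_functional:
  fixes \<psi> :: "'b::second_countable_topology \<Rightarrow> complex"
  assumes \<eta>: "poisson_process M \<mu> \<eta>" and sets: "sets \<mu> = sets borel"
    and B[measurable]: "B \<in> sets borel" and B_fin: "emeasure \<mu> B < \<infinity>"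
    and \<psi>[measurable]: "\<psi> \<in> borel_measurable borel" and C: "\<And>x. norm (\<psi> x) \<le> C"
    and \<psi>1: "\<And>x. x \<notin> B \<Longrightarrow> \<psi> x = 1"
  shows "(\<integral>\<omega>. (\<Prod>i\<in>hits (\<eta> \<omega>) B. \<psi> (snd (\<eta> \<omega>) i)) \<partial>M) = exp (\<integral>x. \<psi> x - 1 \<partial>\<mu>)"
proof -
  note [measurable_cong] = sets
  have [measurable]: "\<eta> \<in> measurable M enum_space"
    using \<eta> by (simp add: poisson_process_def)
  have C0: "0 \<le> C" using C[of undefined] norm_ge_zero order_trans by blast
  \<comment> \<open>Approximation centred at 1 instead of 0: it keeps \<open>s k\<close> equal to 1
    outside \<open>B\<close>, and so keeps all products over \<open>B\<close> and all integrals of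
    \<open>s k - 1\<close> under control.\<close>
  obtain s where s: "\<And>k. simple_function borel (s k)" "\<And>x. (\<lambda>k. s k x) \<longlonglongrightarrow> \<psi> x"
    and s_dist: "\<And>k x. dist (s k x) 1 \<le> 2 * dist (\<psi> x) 1"
    using borel_measurable_implies_sequence_metric[OF \<psi>, of 1] by auto
  have [measurable]: "s k \<in> borel_measurable borel" for k
    by (rule borel_measurable_simple_function[OF s(1)])
  have s1: "s k x = 1" if "x \<notin> B" for k x
    using s_dist[of k x] \<psi>1[OF that] by simp
  \<comment> \<open>From |s| <= 1 + |s - 1| <= 1 + 2 (C + 1).\<close>
  define D where "D = 3 + 2 * C"
  have \<psi>_dist: "dist (\<psi> x) 1 \<le> C + 1" for x
    using norm_triangle_ineq4[of "\<psi> x" 1] C[of x] by (simp add: dist_norm)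
  have s_dist': "norm (s k x - 1) \<le> 2 * (C + 1) * indicator B x" for k x
    using s_dist[of k x] \<psi>_dist[of x] s1[of x k] by (auto simp: dist_norm indicator_def)
  have D: "norm (s k x) \<le> D" for k x
    using s_dist'[of k x] norm_triangle_ineq2[of "s k x" 1] C0
    by (cases "x \<in> B") (auto simp: D_def)
  let ?F = "\<lambda>\<psi> \<omega>. \<Prod>i\<in>hits (\<eta> \<omega>) B. \<psi> (snd (\<eta> \<omega>) i) :: complex"
  have F_meas: "?F g \<in> borel_measurable M" if [measurable]: "g \<in> borel_measurable borel" for g
    by (intro measurable_prod_hits) measurable
  have "(\<lambda>k. \<integral>\<omega>. ?F (s k) \<omega> \<partial>M) \<longlonglongrightarrow> (\<integral>\<omega>. ?F \<psi> \<omega> \<partial>M)"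
  proof (rule integral_dominated_convergence)
    show "?F \<psi> \<in> borel_measurable M" "?F (s k) \<in> borel_measurable M" for k
      by (intro F_meas; simp)+
    have "integrable M (\<lambda>\<omega>. norm ((of_real D :: complex) ^ card (hits (\<eta> \<omega>) B)))"
      by (intro integrable_norm poisson_process_integrable_power[OF \<eta> B B_fin])
    then show "integrable M (\<lambda>\<omega>. \<bar>D\<bar> ^ card (hits (\<eta> \<omega>) B))"
      by (simp add: norm_power)
    show "AE \<omega> in M. (\<lambda>k. ?F (s k) \<omega>) \<longlonglongrightarrow> ?F \<psi> \<omega>"
      by (intro AE_I2 tendsto_prod s(2))
    show "AE \<omega> in M. norm (?F (s k) \<omega>) \<le> \<bar>D\<bar> ^ card (hits (\<eta> \<omega>) B)" for k
    proof (rule AE_I2)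
      fix \<omega>
      have "norm (?F (s k) \<omega>) \<le> (\<Prod>i\<in>hits (\<eta> \<omega>) B. \<bar>D\<bar>)"
        unfolding prod_norm[symmetric] using D by (intro prod_mono) (auto intro: order_trans[OF _ abs_ge_self])
      then show "norm (?F (s k) \<omega>) \<le> \<bar>D\<bar> ^ card (hits (\<eta> \<omega>) B)" by simp
    qed
  qed
  moreover have "(\<lambda>k. \<integral>\<omega>. ?F (s k) \<omega> \<partial>M) \<longlonglongrightarrow> exp (\<integral>x. \<psi> x - 1 \<partial>\<mu>)"
  proof -
    have "(\<lambda>k. \<integral>x. s k x - 1 \<partial>\<mu>) \<longlonglongrightarrow> (\<integral>x. \<psi> x - 1 \<partial>\<mu>)"
    proof (rule integral_dominated_convergence)
      show "integrable \<mu> (\<lambda>x. 2 * (C + 1) * indicator B x)"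
        using B_fin sets by (intro integrable_mult_right integrable_real_indicator) auto
      show "AE x in \<mu>. norm (s k x - 1) \<le> 2 * (C + 1) * indicator B x" for k
        by (intro AE_I2 s_dist')
      show "AE x in \<mu>. (\<lambda>k. s k x - 1) \<longlonglongrightarrow> \<psi> x - 1"
        by (intro AE_I2 tendsto_diff s(2) tendsto_const)
    qed measurable
    then have "(\<lambda>k. exp (\<integral>x. s k x - 1 \<partial>\<mu>)) \<longlonglongrightarrow> exp (\<integral>x. \<psi> x - 1 \<partial>\<mu>)"
      by (rule tendsto_exp)
    moreover have "(\<integral>\<omega>. ?F (s k) \<omega> \<partial>M) = exp (\<integral>x. s k x - 1 \<partial>\<mu>)" for k
      using simple_functionD(1)[OF s(1)[of k]] s1
      by (intro poisson_process_functional_simple[OF \<eta> sets B B_fin]) auto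
    ultimately show ?thesis by simp
  qed
  ultimately show ?thesis
    by (rule LIMSEQ_unique)
qed

text \<open>The marks \<open>R i\<close> are independent of each other and, as a whole, of the
  points, but they are not assumed to be identically distributed. The equality of laws that is
  needed is imposed on functions of the marks, in \<open>functional\<close> and in
  \<open>mark\<close>.\<close>

locale marked_poisson = prob_space M for M :: "'w measure" +
  fixes \<mu> :: "'b::second_countable_topology measure" and \<eta> :: "'w \<Rightarrow> 'b enumeration"
    and G :: "'g measure" and R :: "nat \<Rightarrow> 'w \<Rightarrow> 'g"
  assumes poisson: "poisson_process M \<mu> \<eta>"
    and sets_\<mu> [measurable_cong]: "sets \<mu> = sets borel"
    and indep_marks: "indep_vars (\<lambda>_. G) R UNIV"
    and joint: "distr M (enum_space \<Otimes>\<^sub>M (\<Pi>\<^sub>M i\<in>UNIV. G)) (\<lambda>\<omega>. (\<eta> \<omega>, \<lambda>i. R i \<omega>)) =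
      distr M enum_space \<eta> \<Otimes>\<^sub>M distr M (\<Pi>\<^sub>M i\<in>UNIV. G) (\<lambda>\<omega> i. R i \<omega>)"
begin

lemma measurable_\<eta> [measurable]: "\<eta> \<in> measurable M enum_space"
  using poisson by (simp add: poisson_process_def)

lemma measurable_R [measurable]: "R i \<in> measurable M G"
  using indep_marks by (simp add: indep_vars_def)

lemma measurable_marks [measurable]: "(\<lambda>\<omega> i. R i \<omega>) \<in> measurable M (\<Pi>\<^sub>M i\<in>UNIV. G)"
  by (intro measurable_PiM_single') (auto simp: space_PiM PiE_def intro: measurable_space[OF measurable_R])

text \<open>Fubini for the product law in \<open>joint\<close>: the points are frozen while the
  marks are resampled through \<open>\<omega>'\<close>.\<close>

lemma integral_condition:
  fixes F :: "'b enumeration \<Rightarrow> (nat \<Rightarrow> 'g) \<Rightarrow> complex"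
  assumes F[measurable]: "(\<lambda>(c, r). F c r) \<in> borel_measurable (enum_space \<Otimes>\<^sub>M (\<Pi>\<^sub>M i\<in>UNIV. G))"
    and int: "integrable M (\<lambda>\<omega>. F (\<eta> \<omega>) (\<lambda>i. R i \<omega>))"
  shows "(\<integral>\<omega>. F (\<eta> \<omega>) (\<lambda>i. R i \<omega>) \<partial>M) = (\<integral>\<omega>. (\<integral>\<omega>'. F (\<eta> \<omega>) (\<lambda>i. R i \<omega>') \<partial>M) \<partial>M)"
proof -
  let ?G = "\<Pi>\<^sub>M i\<in>(UNIV :: nat set). G"
  let ?E = "distr M enum_space \<eta>" and ?R = "distr M ?G (\<lambda>\<omega> i. R i \<omega>)"
  interpret E: prob_space ?E by (rule prob_space_distr) simp
  interpret R: prob_space ?R by (rule prob_space_distr) simp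
  interpret pair_sigma_finite ?E ?R ..
  let ?J = "distr M (enum_space \<Otimes>\<^sub>M ?G) (\<lambda>\<omega>. (\<eta> \<omega>, \<lambda>i. R i \<omega>))"
  have intJ: "integrable (?E \<Otimes>\<^sub>M ?R) (\<lambda>(c, r). F c r)"
    unfolding joint[symmetric] using int by (subst integrable_distr_eq) auto
  have "(\<integral>\<omega>. F (\<eta> \<omega>) (\<lambda>i. R i \<omega>) \<partial>M) = (\<integral>p. (\<lambda>(c, r). F c r) p \<partial>?J)"
    by (subst integral_distr) auto
  also have "\<dots> = (\<integral>p. (\<lambda>(c, r). F c r) p \<partial>(?E \<Otimes>\<^sub>M ?R))"
    unfolding joint ..
  also have "\<dots> = (\<integral>c. (\<integral>r. F c r \<partial>?R) \<partial>?E)"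
    using integral_fst'[OF intJ] by simp
  also have "\<dots> = (\<integral>\<omega>. (\<integral>r. F (\<eta> \<omega>) r \<partial>?R) \<partial>M)"
    by (rule integral_distr) (auto intro!: R.borel_measurable_lebesgue_integral)
  also have "\<dots> = (\<integral>\<omega>. (\<integral>\<omega>'. F (\<eta> \<omega>) (\<lambda>i. R i \<omega>') \<partial>M) \<partial>M)"
    by (intro Bochner_Integration.integral_cong refl integral_distr) auto
  finally show ?thesis .
qed

text \<open>Given the points, the independent marks integrate out factor by factor and leave the
  functional of the unmarked process with \<open>\<psi>\<close> in place of \<open>Z\<close>. Since
  \<open>\<psi>\<close> carries no index, only the mean of \<open>Z x\<close> has to be common to
  all marks.\<close>

theorem functional:
  fixes Z :: "'b \<Rightarrow> 'g \<Rightarrow> complex"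
  assumes Z[measurable]: "(\<lambda>(x, g). Z x g) \<in> borel_measurable (borel \<Otimes>\<^sub>M G)"
    and B[measurable]: "B \<in> sets borel" and B_fin: "emeasure \<mu> B < \<infinity>"
    and C: "\<And>x g. norm (Z x g) \<le> C" and Z1: "\<And>x g. x \<notin> B \<Longrightarrow> Z x g = 1"
    and \<psi>: "\<And>i x. (\<integral>\<omega>. Z x (R i \<omega>) \<partial>M) = \<psi> x"
  shows "(\<integral>\<omega>. (\<Prod>i\<in>hits (\<eta> \<omega>) B. Z (snd (\<eta> \<omega>) i) (R i \<omega>)) \<partial>M) = exp (\<integral>x. \<psi> x - 1 \<partial>\<mu>)"
proof -
  have [measurable]: "(\<lambda>\<omega>. Z x (R i \<omega>)) \<in> borel_measurable M" for x i
  proof -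
    have "(\<lambda>\<omega>. (\<lambda>(x, g). Z x g) (x, R i \<omega>)) \<in> borel_measurable M" by measurable
    then show ?thesis by simp
  qed
  have int: "integrable M (\<lambda>\<omega>. Z x (R i \<omega>))" for x i
    by (rule integrable_const_bound[where B=C]) (auto simp: C)
  let ?F = "\<lambda>c r. \<Prod>i\<in>hits c B. Z (snd c i) (r i)"
  have "(\<integral>\<omega>. ?F (\<eta> \<omega>) (\<lambda>i. R i \<omega>) \<partial>M) = (\<integral>\<omega>. (\<integral>\<omega>'. ?F (\<eta> \<omega>) (\<lambda>i. R i \<omega>') \<partial>M) \<partial>M)"
  proof (rule integral_condition)
    have "(\<lambda>p. (\<lambda>(x, g). Z x g) (snd (fst p) i, snd p i)) \<in> borel_measurable (enum_space \<Otimes>\<^sub>M (\<Pi>\<^sub>M i\<in>UNIV. G))" for i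
      by measurable
    then have "(\<lambda>p. \<Prod>i\<in>hits (fst p) B. Z (snd (fst p) i) (snd p i)) \<in> borel_measurable (enum_space \<Otimes>\<^sub>M (\<Pi>\<^sub>M i\<in>UNIV. G))"
      by (intro measurable_prod_hits) auto
    then show F[measurable]: "(\<lambda>(c, r). ?F c r) \<in> borel_measurable (enum_space \<Otimes>\<^sub>M (\<Pi>\<^sub>M i\<in>UNIV. G))"
      by (simp add: case_prod_beta)
    show "integrable M (\<lambda>\<omega>. ?F (\<eta> \<omega>) (\<lambda>i. R i \<omega>))"
    proof (rule Bochner_Integration.integrable_bound)
      show "integrable M (\<lambda>\<omega>. (of_real C :: complex) ^ card (hits (\<eta> \<omega>) B))"
        by (rule poisson_process_integrable_power[OF poisson B B_fin])
      have "(\<lambda>\<omega>. (\<lambda>(c, r). ?F c r) (\<eta> \<omega>, \<lambda>i. R i \<omega>)) \<in> borel_measurable M" by measurable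
      then show "(\<lambda>\<omega>. ?F (\<eta> \<omega>) (\<lambda>i. R i \<omega>)) \<in> borel_measurable M" by simp
      show "AE \<omega> in M. norm (?F (\<eta> \<omega>) (\<lambda>i. R i \<omega>)) \<le> norm ((of_real C :: complex) ^ card (hits (\<eta> \<omega>) B))"
      proof (rule AE_I2)
        fix \<omega>
        have "norm (?F (\<eta> \<omega>) (\<lambda>i. R i \<omega>)) \<le> (\<Prod>i\<in>hits (\<eta> \<omega>) B. \<bar>C\<bar>)"
          unfolding prod_norm[symmetric] using C by (intro prod_mono) (auto intro: order_trans[OF _ abs_ge_self])
        then show "norm (?F (\<eta> \<omega>) (\<lambda>i. R i \<omega>)) \<le> norm ((of_real C :: complex) ^ card (hits (\<eta> \<omega>) B))"
          by (simp add: norm_power)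
      qed
    qed
  qed
  also have "\<dots> = (\<integral>\<omega>. (\<Prod>i\<in>hits (\<eta> \<omega>) B. \<psi> (snd (\<eta> \<omega>) i)) \<partial>M)"
  proof (rule Bochner_Integration.integral_cong[OF refl])
    fix \<omega>
    let ?c = "\<eta> \<omega>"
    show "(\<integral>\<omega>'. ?F ?c (\<lambda>i. R i \<omega>') \<partial>M) = (\<Prod>i\<in>hits ?c B. \<psi> (snd ?c i))"
    proof (cases "finite (hits ?c B)")
      case True
      have "indep_vars (\<lambda>_. borel) (\<lambda>i \<omega>. Z (snd ?c i) (R i \<omega>)) UNIV"
      proof (rule indep_vars_compose2[OF indep_marks])
        fix i
        have "(\<lambda>g. (\<lambda>(x, g). Z x g) (snd ?c i, g)) \<in> borel_measurable G" by measurable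
        then show "Z (snd ?c i) \<in> borel_measurable G" by simp
      qed
      then have "indep_vars (\<lambda>_. borel) (\<lambda>i \<omega>. Z (snd ?c i) (R i \<omega>)) (hits ?c B)"
        by (rule indep_vars_subset) simp
      then show ?thesis
        using True int by (simp add: indep_vars_lebesgue_integral \<psi>)
    \<comment> \<open>With infinitely many hits both products are 1 by convention.\<close>
    qed (simp add: prob_space)
  qed
  also have "\<dots> = exp (\<integral>x. \<psi> x - 1 \<partial>\<mu>)"
  proof (rule poisson_process_functional[OF poisson sets_\<mu> B B_fin])
    have "(\<lambda>x. \<integral>\<omega>. (\<lambda>(x, g). Z x g) (x, R 0 \<omega>) \<partial>M) \<in> borel_measurable borel"
      by measurable
    then show "\<psi> \<in> borel_measurable borel" by (simp add: \<psi>)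
    show "norm (\<psi> x) \<le> C" for x
    proof -
      have "norm (\<integral>\<omega>. Z x (R 0 \<omega>) \<partial>M) \<le> (\<integral>\<omega>. norm (Z x (R 0 \<omega>)) \<partial>M)"
        by (rule integral_norm_bound)
      also have "\<dots> \<le> (\<integral>\<omega>. C \<partial>M)"
        using int[of x 0] by (intro integral_mono integrable_norm) (auto simp: C)
      finally show ?thesis by (simp add: \<psi> prob_space)
    qed
    show "\<psi> x = 1" if "x \<notin> B" for x
      using \<psi>[of x 0] by (simp add: Z1[OF that] prob_space)
  qed
  finally show ?thesis .
qed

end

section \<open>Moments of sums over a marked Poisson process\<close>

lemma borel_measurable_count_space_nn_integral:
  fixes F :: "'i::countable \<Rightarrow> 'c \<Rightarrow> ennreal"
  assumes [measurable]: "\<And>i. F i \<in> borel_measurable N" "\<And>i. Measurable.pred N (\<lambda>x. i \<in> A x)"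
  shows "(\<lambda>x. \<integral>\<^sup>+i. F i x \<partial>count_space (A x)) \<in> borel_measurable N"
proof -
  interpret sigma_finite_measure "count_space (UNIV :: 'i set)"
    by (rule sigma_finite_measure_count_space_countable) simp
  have "(\<lambda>p. F (snd p) (fst p) * indicator (A (fst p)) (snd p)) \<in> borel_measurable (N \<Otimes>\<^sub>M count_space UNIV)"
  proof (rule measurable_compose_countable'[where f="\<lambda>i p. F i (fst p) * indicator (A (fst p)) i" and I=UNIV])
    show "(\<lambda>p. F i (fst p) * indicator (A (fst p)) i) \<in> borel_measurable (N \<Otimes>\<^sub>M count_space UNIV)" for i
      unfolding indicator_def by measurable
  qed auto
  then have "(\<lambda>x. \<integral>\<^sup>+i. F i x * indicator (A x) i \<partial>count_space UNIV) \<in> borel_measurable N"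
    by (intro borel_measurable_nn_integral) (simp add: case_prod_beta)
  then show ?thesis
    by (simp add: nn_integral_count_space_indicator)
qed

lemma borel_measurable_count_space_integral:
  fixes F :: "'i::countable \<Rightarrow> 'c \<Rightarrow> real"
  assumes [measurable]: "\<And>i. F i \<in> borel_measurable N" "\<And>i. Measurable.pred N (\<lambda>x. i \<in> A x)"
  shows "(\<lambda>x. \<integral>i. F i x \<partial>count_space (A x)) \<in> borel_measurable N"
proof -
  interpret sigma_finite_measure "count_space (UNIV :: 'i set)"
    by (rule sigma_finite_measure_count_space_countable) simp
  have "(\<lambda>p. indicator (A (fst p)) (snd p) *\<^sub>R F (snd p) (fst p)) \<in> borel_measurable (N \<Otimes>\<^sub>M count_space UNIV)"
  proof (rule measurable_compose_countable'[where f="\<lambda>i p. indicator (A (fst p)) i *\<^sub>R F i (fst p)" and I=UNIV])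
    show "(\<lambda>p. indicator (A (fst p)) i *\<^sub>R F i (fst p)) \<in> borel_measurable (N \<Otimes>\<^sub>M count_space UNIV)" for i
      unfolding indicator_def by measurable
  qed auto
  then have "(\<lambda>x. \<integral>i. indicator (A x) i *\<^sub>R F i x \<partial>count_space UNIV) \<in> borel_measurable N"
    by (intro borel_measurable_lebesgue_integral) (simp add: case_prod_beta)
  moreover have "(\<integral>i. indicator (A x) i *\<^sub>R F i x \<partial>count_space UNIV) = (\<integral>i. F i x \<partial>count_space (A x))" for x
    using integral_restrict_space[of "A x" "count_space UNIV" "\<lambda>i. F i x"]
    by (simp add: restrict_count_space)
  ultimately show ?thesis
    by (simp only:)
qed

text \<open>Real series are compared as power series in a complex variable.\<close>

definition complex_fps :: "real fps \<Rightarrow> complex fps" where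
  "complex_fps F = Abs_fps (\<lambda>n. of_real (fps_nth F n))"

lemma complex_fps_nth [simp]: "fps_nth (complex_fps F) n = of_real (fps_nth F n)"
  by (simp add: complex_fps_def)

lemma complex_fps_power: "complex_fps (F ^ k) = complex_fps F ^ k"
proof (induction k)
  case (Suc k)
  have "complex_fps (F ^ Suc k) = complex_fps F * complex_fps (F ^ k)"
    by (rule fps_ext) (simp add: fps_mult_nth)
  then show ?case
    by (simp add: Suc.IH)
qed (auto simp: fps_eq_iff)

lemma complex_fps_compose: "complex_fps (F oo H) = complex_fps F oo complex_fps H"
  by (rule fps_ext) (simp add: fps_compose_nth flip: complex_fps_power)

lemma complex_fps_exp: "complex_fps (fps_exp 1) = fps_exp 1"
  by (rule fps_ext) simp

lemma integrable_power_of_exp: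
  fixes X :: "'a \<Rightarrow> real"
  assumes X[measurable]: "X \<in> borel_measurable M" and "integrable M (\<lambda>\<omega>. exp \<bar>X \<omega>\<bar>)"
  shows "integrable M (\<lambda>\<omega>. X \<omega> ^ n)"
proof (rule Bochner_Integration.integrable_bound)
  show "integrable M (\<lambda>\<omega>. fact n * exp \<bar>X \<omega>\<bar>)"
    using assms(2) by simp
  show "AE \<omega> in M. norm (X \<omega> ^ n) \<le> norm (fact n * exp \<bar>X \<omega>\<bar>)"
  proof (rule AE_I2)
    fix \<omega>
    have "(\<Sum>k\<in>{n}. \<bar>X \<omega>\<bar> ^ k /\<^sub>R fact k) \<le> exp \<bar>X \<omega>\<bar>"
      unfolding exp_def using summable_exp_generic[of "\<bar>X \<omega>\<bar>"]
      by (rule sum_le_suminf) auto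
    then show "norm (X \<omega> ^ n) \<le> norm (fact n * exp \<bar>X \<omega>\<bar>)"
      by (simp add: power_abs field_simps)
  qed
qed measurable

lemma integrable_enn2real_power:
  assumes [measurable]: "X \<in> borel_measurable M" and fin: "AE \<omega> in M. X \<omega> < \<infinity>"
    and "(\<integral>\<^sup>+\<omega>. X \<omega> ^ k \<partial>M) < \<infinity>"
  shows "integrable M (\<lambda>\<omega>. enn2real (X \<omega>) ^ k)"
proof (rule integrableI_bounded)
  have "(\<integral>\<^sup>+\<omega>. ennreal (norm (enn2real (X \<omega>) ^ k)) \<partial>M) = (\<integral>\<^sup>+\<omega>. X \<omega> ^ k \<partial>M)"
  proof (rule nn_integral_cong_AE)
    show "AE \<omega> in M. ennreal (norm (enn2real (X \<omega>) ^ k)) = X \<omega> ^ k"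
      using fin by eventually_elim (simp flip: ennreal_power)
  qed
  then show "(\<integral>\<^sup>+\<omega>. ennreal (norm (enn2real (X \<omega>) ^ k)) \<partial>M) < \<infinity>"
    using assms(3) by simp
qed measurable

text \<open>The partial sums of the exponential series are dominated by exp(|w| |X|), so series and
  expectation may be exchanged for every complex \<open>w\<close>.\<close>

lemma sums_exponential_moments:
  fixes X :: "'a \<Rightarrow> real" and w :: complex
  assumes X[measurable]: "X \<in> borel_measurable M" and e: "\<And>a. integrable M (\<lambda>\<omega>. exp (a * \<bar>X \<omega>\<bar>))"
  shows "(\<lambda>n. of_real ((\<integral>\<omega>. X \<omega> ^ n \<partial>M) / fact n) * w ^ n) sums (\<integral>\<omega>. exp (w * of_real (X \<omega>)) \<partial>M)"
proof -
  have int: "integrable M (\<lambda>\<omega>. X \<omega> ^ n)" for n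
    using e[of 1] by (intro integrable_power_of_exp) auto
  let ?t = "\<lambda>k \<omega>. (w * of_real (X \<omega>)) ^ k /\<^sub>R fact k"
  have eq: "(\<integral>\<omega>. (\<Sum>k<n. ?t k \<omega>) \<partial>M) = (\<Sum>k<n. of_real ((\<integral>\<omega>. X \<omega> ^ k \<partial>M) / fact k) * w ^ k)" for n
  proof -
    have t: "?t k \<omega> = (w ^ k / fact k) * complex_of_real (X \<omega> ^ k)" for k \<omega>
      by (simp add: scaleR_conv_of_real power_mult_distrib field_simps)
    have "(\<integral>\<omega>. (\<Sum>k<n. ?t k \<omega>) \<partial>M) = (\<Sum>k<n. (\<integral>\<omega>. (w ^ k / fact k) * complex_of_real (X \<omega> ^ k) \<partial>M))"
      unfolding t by (intro Bochner_Integration.integral_sum integrable_mult_right integrable_of_real int)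
    also have "\<dots> = (\<Sum>k<n. (w ^ k / fact k) * of_real (\<integral>\<omega>. X \<omega> ^ k \<partial>M))"
      by (simp only: integral_mult_right_zero integral_complex_of_real)
    finally show ?thesis
      by (simp add: field_simps)
  qed
  have "(\<lambda>n. \<integral>\<omega>. (\<Sum>k<n. ?t k \<omega>) \<partial>M) \<longlonglongrightarrow> (\<integral>\<omega>. exp (w * of_real (X \<omega>)) \<partial>M)"
  proof (rule integral_dominated_convergence)
    show "integrable M (\<lambda>\<omega>. exp (norm w * \<bar>X \<omega>\<bar>))" by (rule e)
    show "AE \<omega> in M. (\<lambda>n. \<Sum>k<n. ?t k \<omega>) \<longlonglongrightarrow> exp (w * of_real (X \<omega>))"
      using exp_converges by (auto simp: sums_def)
    show "AE \<omega> in M. norm (\<Sum>k<n. ?t k \<omega>) \<le> exp (norm w * \<bar>X \<omega>\<bar>)" for n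
    proof (rule AE_I2)
      fix \<omega>
      have "norm (\<Sum>k<n. ?t k \<omega>) \<le> (\<Sum>k<n. (norm w * \<bar>X \<omega>\<bar>) ^ k /\<^sub>R fact k)"
        by (rule sum_norm_le) (simp add: norm_power norm_mult)
      also have "\<dots> \<le> exp (norm w * \<bar>X \<omega>\<bar>)"
        unfolding exp_def using summable_exp_generic[of "norm w * \<bar>X \<omega>\<bar>"]
        by (rule sum_le_suminf) auto
      finally show "norm (\<Sum>k<n. ?t k \<omega>) \<le> exp (norm w * \<bar>X \<omega>\<bar>)" .
    qed
  qed measurable
  then show ?thesis
    unfolding eq sums_def .
qed

context marked_poisson
begin

definition mark_sum :: "('b \<Rightarrow> 'g \<Rightarrow> real) \<Rightarrow> 'w \<Rightarrow> real" where
  "mark_sum Y \<omega> = (\<integral>i. Y (snd (\<eta> \<omega>) i) (R i \<omega>) \<partial>count_space (indices (\<eta> \<omega>)))"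

definition abs_mark_sum :: "('b \<Rightarrow> 'g \<Rightarrow> real) \<Rightarrow> 'w \<Rightarrow> ennreal" where
  "abs_mark_sum Y \<omega> = (\<integral>\<^sup>+i. ennreal \<bar>Y (snd (\<eta> \<omega>) i) (R i \<omega>)\<bar> \<partial>count_space (indices (\<eta> \<omega>)))"

text \<open>Only the law of the real value \<open>Y x (R i)\<close> at each fixed position must be
  the same for all labels; the laws of the \<open>R i\<close> on \<open>G\<close> may
  differ.\<close>

definition mark :: "('b \<Rightarrow> 'g \<Rightarrow> real) \<Rightarrow> bool" where
  "mark Y \<longleftrightarrow> (\<lambda>(x, g). Y x g) \<in> borel_measurable (borel \<Otimes>\<^sub>M G) \<and>
    (\<forall>i x. distr M borel (\<lambda>\<omega>. Y x (R i \<omega>)) = distr M borel (\<lambda>\<omega>. Y x (R 0 \<omega>)))"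

text \<open>The label 0 is a representative; for a \<open>mark\<close> every other label gives the
  same value.\<close>

definition mark_moment :: "('b \<Rightarrow> 'g \<Rightarrow> real) \<Rightarrow> nat \<Rightarrow> 'b \<Rightarrow> real" where
  "mark_moment Y k x = (\<integral>\<omega>. Y x (R 0 \<omega>) ^ k \<partial>M)"

lemma measurable_mark:
  assumes "mark Y"
  shows "(\<lambda>(x, g). Y x g) \<in> borel_measurable (borel \<Otimes>\<^sub>M G)"
    and "f \<in> borel_measurable N \<Longrightarrow> h \<in> measurable N G \<Longrightarrow> (\<lambda>a. Y (f a) (h a)) \<in> borel_measurable N"
proof -
  show *: "(\<lambda>(x, g). Y x g) \<in> borel_measurable (borel \<Otimes>\<^sub>M G)"
    using assms by (simp add: mark_def)
  assume [measurable]: "f \<in> borel_measurable N" "h \<in> measurable N G"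
  have "(\<lambda>a. (\<lambda>(x, g). Y x g) (f a, h a)) \<in> borel_measurable N"
    using * by measurable
  then show "(\<lambda>a. Y (f a) (h a)) \<in> borel_measurable N" by simp
qed

lemma mark_law:
  "mark Y \<Longrightarrow> distr M borel (\<lambda>\<omega>. Y x (R i \<omega>)) = distr M borel (\<lambda>\<omega>. Y x (R 0 \<omega>))"
  by (simp add: mark_def)

lemma integral_mark:
  fixes h :: "real \<Rightarrow> 'e::{banach, second_countable_topology}"
  assumes Y: "mark Y" and [measurable]: "h \<in> borel_measurable borel"
  shows "(\<integral>\<omega>. h (Y x (R i \<omega>)) \<partial>M) = (\<integral>\<omega>. h (Y x (R 0 \<omega>)) \<partial>M)"
proof -
  note [measurable] = measurable_mark(2)[OF Y]
  have "(\<integral>\<omega>. h (Y x (R i \<omega>)) \<partial>M) = (\<integral>y. h y \<partial>distr M borel (\<lambda>\<omega>. Y x (R i \<omega>)))" for i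
    by (subst integral_distr) auto
  then show ?thesis
    by (simp only: mark_law[OF Y, of x i])
qed

lemma mark_comp:
  assumes Y: "mark Y" and A[measurable]: "A \<in> sets borel" and h[measurable]: "h \<in> borel_measurable borel"
  shows "mark (\<lambda>x g. if x \<in> A then h (Y x g) else c)"
  unfolding mark_def
proof (intro conjI allI)
  note [measurable] = measurable_mark[OF Y]
  show "(\<lambda>(x, g). if x \<in> A then h (Y x g) else c) \<in> borel_measurable (borel \<Otimes>\<^sub>M G)"
    by measurable
  fix i x
  have "distr M borel (\<lambda>\<omega>. h (Y x (R i \<omega>))) = distr (distr M borel (\<lambda>\<omega>. Y x (R i \<omega>))) borel h" for i
    by (subst distr_distr) (auto simp: comp_def)
  then have "distr M borel (\<lambda>\<omega>. h (Y x (R i \<omega>))) = distr M borel (\<lambda>\<omega>. h (Y x (R 0 \<omega>)))"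
    by (simp only: mark_law[OF Y, of x i])
  then show "distr M borel (\<lambda>\<omega>. if x \<in> A then h (Y x (R i \<omega>)) else c) =
      distr M borel (\<lambda>\<omega>. if x \<in> A then h (Y x (R 0 \<omega>)) else c)"
    by (cases "x \<in> A") auto
qed

lemma measurable_mark_sum:
  assumes Y: "mark Y"
  shows "mark_sum Y \<in> borel_measurable M" and "abs_mark_sum Y \<in> borel_measurable M"
proof -
  note [measurable] = measurable_mark(2)[OF Y]
  show "mark_sum Y \<in> borel_measurable M"
    unfolding mark_sum_def by (intro borel_measurable_count_space_integral) measurable
  show "abs_mark_sum Y \<in> borel_measurable M"
    unfolding abs_mark_sum_def by (intro borel_measurable_count_space_nn_integral) measurable
qed

lemma mark_sum_finite:
  assumes fin: "finite (hits (\<eta> \<omega>) B)" and Y: "\<And>x g. x \<notin> B \<Longrightarrow> Y x g = 0"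
  shows "mark_sum Y \<omega> = (\<Sum>i\<in>hits (\<eta> \<omega>) B. Y (snd (\<eta> \<omega>) i) (R i \<omega>))"
proof -
  have "{i \<in> indices (\<eta> \<omega>). Y (snd (\<eta> \<omega>) i) (R i \<omega>) \<noteq> 0} \<subseteq> hits (\<eta> \<omega>) B"
    using Y by (auto simp: hits_def)
  then show ?thesis
    unfolding mark_sum_def using fin
    by (subst lebesgue_integral_count_space_finite_support)
       (auto intro: finite_subset intro!: sum.mono_neutral_cong_left simp: hits_def)
qed

lemma measurable_mark_moment [measurable]:
  assumes Y: "mark Y"
  shows "mark_moment Y k \<in> borel_measurable borel"
proof -
  note [measurable] = measurable_mark(2)[OF Y]
  show ?thesis
    unfolding mark_moment_def by measurable
qed

lemma bounded_mark_moment: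
  assumes Y: "mark Y" and B[measurable]: "B \<in> sets borel" and B_fin: "emeasure \<mu> B < \<infinity>"
    and b: "\<And>x g. \<bar>Y x g\<bar> \<le> b" and Y0: "\<And>x g. x \<notin> B \<Longrightarrow> Y x g = 0" and "k \<ge> 1"
  shows "\<bar>mark_moment Y k x\<bar> \<le> b ^ k * indicator B x" and "integrable \<mu> (mark_moment Y k)"
proof -
  note [measurable] = measurable_mark(2)[OF Y] measurable_mark_moment[OF Y]
  have b0: "0 \<le> b" using b[of undefined undefined] by simp
  have Y_int: "integrable M (\<lambda>\<omega>. Y x (R 0 \<omega>) ^ k)" for x
    using b by (intro integrable_const_bound[where B="b ^ k"]) (auto simp: power_abs power_mono)
  show m_le: "\<bar>mark_moment Y k x\<bar> \<le> b ^ k * indicator B x" for x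
  proof (cases "x \<in> B")
    case True
    have "\<bar>mark_moment Y k x\<bar> \<le> (\<integral>\<omega>. \<bar>Y x (R 0 \<omega>) ^ k\<bar> \<partial>M)"
      unfolding mark_moment_def by (rule integral_abs_bound)
    also have "\<dots> \<le> (\<integral>\<omega>. b ^ k \<partial>M)"
      by (rule integral_mono[OF integrable_abs[OF Y_int]]) (use b in \<open>auto simp: power_abs power_mono\<close>)
    finally show ?thesis
      using True by (simp add: prob_space)
  qed (use \<open>k \<ge> 1\<close> in \<open>simp add: mark_moment_def Y0 zero_power Suc_le_eq\<close>)
  show "integrable \<mu> (mark_moment Y k)"
  proof (rule Bochner_Integration.integrable_bound)
    show "integrable \<mu> (\<lambda>x. b ^ k * indicator B x)"
      using B_fin by (intro integrable_mult_right integrable_real_indicator) (auto simp: sets_\<mu>)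
    show "AE x in \<mu>. norm (mark_moment Y k x) \<le> norm (b ^ k * indicator B x)"
      using m_le b0 by (auto simp: abs_mult)
  qed measurable
qed

text \<open>For bounded marks supported in a set of finite intensity, the identity E exp(w S) =
  exp(integral of E exp(w Y_x) - 1) holds between entire functions of \<open>w\<close>. Comparing
  coefficients says that the moments of S are the Bell polynomials of the integrated moments of the
  marks.\<close>

lemma bounded_moments:
  assumes Y: "mark Y" and B[measurable]: "B \<in> sets borel" and B_fin: "emeasure \<mu> B < \<infinity>"
    and b: "\<And>x g. \<bar>Y x g\<bar> \<le> b" and Y0: "\<And>x g. x \<notin> B \<Longrightarrow> Y x g = 0"
  shows bounded_integrable_power: "integrable M (\<lambda>\<omega>. mark_sum Y \<omega> ^ n)"
    and bounded_moment: "n \<ge> 1 \<Longrightarrow>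
      (\<integral>\<omega>. mark_sum Y \<omega> ^ n \<partial>M) = complete_bell n (\<lambda>k. \<integral>x. mark_moment Y k x \<partial>\<mu>)"
proof -
  note [measurable] = measurable_mark[OF Y] measurable_mark(2)[OF Y]
  let ?S = "mark_sum Y" and ?K = "\<lambda>\<omega>. card (hits (\<eta> \<omega>) B)"
  note [measurable] = measurable_mark_sum[OF Y] poisson_process_measurable_card[OF poisson B B_fin]
  note fin = poisson_process_finite_hits[OF poisson B B_fin]
  have b0: "0 \<le> b" using b[of undefined undefined] by simp
  have S_le: "AE \<omega> in M. \<bar>?S \<omega>\<bar> \<le> b * real (?K \<omega>)"
    using fin
  proof eventually_elim
    case (elim \<omega>)
    have "\<bar>?S \<omega>\<bar> \<le> (\<Sum>i\<in>hits (\<eta> \<omega>) B. b)"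
      unfolding mark_sum_finite[of \<omega> B Y, OF elim, OF Y0, simplified] by (intro order_trans[OF sum_abs] sum_mono b)
    then show ?case by (simp add: mult.commute)
  qed
  \<comment> \<open>|S| is at most \<open>b\<close> times a Poisson variable, so all exponential
    moments are bounded by the generating function at exp(|a| b).\<close>
  have exp_S: "integrable M (\<lambda>\<omega>. exp (a * \<bar>?S \<omega>\<bar>))" for a
  proof (rule Bochner_Integration.integrable_bound)
    show "integrable M (\<lambda>\<omega>. (of_real (exp (\<bar>a\<bar> * b)) :: complex) ^ ?K \<omega>)"
      by (rule poisson_process_integrable_power[OF poisson B B_fin])
    show "AE \<omega> in M. norm (exp (a * \<bar>?S \<omega>\<bar>)) \<le> norm ((of_real (exp (\<bar>a\<bar> * b)) :: complex) ^ ?K \<omega>)"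
      using S_le
    proof eventually_elim
      case (elim \<omega>)
      have "a * \<bar>?S \<omega>\<bar> \<le> \<bar>a\<bar> * (b * real (?K \<omega>))"
        using elim by (intro mult_mono) auto
      then show ?case
        by (simp add: norm_power exp_of_nat_mult[symmetric] mult_ac del: of_real_exp)
    qed
  qed measurable
  show "integrable M (\<lambda>\<omega>. ?S \<omega> ^ n)" for n
    using exp_S[of 1] by (intro integrable_power_of_exp) auto

  let ?m = "mark_moment Y" and ?c = "\<lambda>k. \<integral>x. mark_moment Y k x \<partial>\<mu>"
  note [measurable] = measurable_mark_moment[OF Y]
  let ?\<psi> = "\<lambda>w x. \<integral>\<omega>. exp (w * of_real (Y x (R 0 \<omega>))) \<partial>M"
  note m_le = bounded_mark_moment[OF Y B B_fin b Y0]
  \<comment> \<open>Power series of the exponent: its coefficients are the integrated moments of the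
    marks.\<close>
  have g_sums: "(\<lambda>n. of_real (fps_nth (exp_gen_series ?c) n) * w ^ n) sums (\<integral>x. ?\<psi> w x - 1 \<partial>\<mu>)" for w :: complex
  proof -
    \<comment> \<open>The term n = 0 is set to 0 to absorb the -1; the constant 1 need not be
      integrable, because \<open>\<mu>\<close> may have infinite mass.\<close>
    let ?t = "\<lambda>n x. (if n = 0 then 0 else of_real (?m n x / fact n) * w ^ n) :: complex"
    have t_int: "integrable \<mu> (?t n)" for n
      using m_le(2)[of n] by (cases "n = 0") (auto intro!: integrable_mult_left integrable_of_real)
    have t_eq: "(\<integral>x. ?t n x \<partial>\<mu>) = of_real (fps_nth (exp_gen_series ?c) n) * w ^ n" for n
      by (cases "n = 0") (auto simp: exp_gen_series_def)
    have "(\<lambda>N. \<integral>x. (\<Sum>n<N. ?t n x) \<partial>\<mu>) \<longlonglongrightarrow> (\<integral>x. ?\<psi> w x - 1 \<partial>\<mu>)"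
    proof (rule integral_dominated_convergence)
      show "(\<lambda>x. ?\<psi> w x - 1) \<in> borel_measurable \<mu>" by measurable
      show "(\<lambda>x. \<Sum>n<N. ?t n x) \<in> borel_measurable \<mu>" for N
        by (intro borel_measurable_sum borel_measurable_integrable t_int)
      show "integrable \<mu> (\<lambda>x. exp (norm w * b) * indicator B x)"
        using B_fin by (intro integrable_mult_right integrable_real_indicator) (auto simp: sets_\<mu>)
      show "AE x in \<mu>. (\<lambda>N. \<Sum>n<N. ?t n x) \<longlonglongrightarrow> ?\<psi> w x - 1"
      proof (rule AE_I2)
        fix x
        have "(\<lambda>n. of_real (?m n x / fact n) * w ^ n) sums ?\<psi> w x"
          unfolding mark_moment_def
        proof (rule sums_exponential_moments)
          show "integrable M (\<lambda>\<omega>. exp (a * \<bar>Y x (R 0 \<omega>)\<bar>))" for a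
          proof (rule integrable_const_bound[where B="exp (\<bar>a\<bar> * b)"])
            show "AE \<omega> in M. norm (exp (a * \<bar>Y x (R 0 \<omega>)\<bar>)) \<le> exp (\<bar>a\<bar> * b)"
              using b by (auto intro!: mult_mono)
          qed measurable
        qed measurable
        then have "(\<lambda>n. of_real (?m n x / fact n) * w ^ n - (if n = 0 then 1 else 0)) sums (?\<psi> w x - 1)"
          by (intro sums_diff) (auto simp: sums_single[of 0 "\<lambda>_. 1", simplified])
        moreover have "of_real (?m n x / fact n) * w ^ n - (if n = 0 then 1 else 0) = ?t n x" for n
          by (simp add: mark_moment_def prob_space)
        ultimately show "(\<lambda>N. \<Sum>n<N. ?t n x) \<longlonglongrightarrow> ?\<psi> w x - 1"
          unfolding sums_def by simp
      qed
      show "AE x in \<mu>. norm (\<Sum>n<N. ?t n x) \<le> exp (norm w * b) * indicator B x" for N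
      proof (rule AE_I2)
        fix x
        have "norm (\<Sum>n<N. ?t n x) \<le> (\<Sum>n<N. (norm w * b) ^ n /\<^sub>R fact n * indicator B x)"
        proof (rule sum_norm_le)
          fix n
          show "norm (?t n x) \<le> (norm w * b) ^ n /\<^sub>R fact n * indicator B x"
          proof (cases "n = 0")
            case False
            then have "norm (?t n x) = \<bar>?m n x\<bar> * (norm w ^ n / fact n)"
              by (simp add: norm_mult norm_power norm_divide)
            also have "\<dots> \<le> b ^ n * indicator B x * (norm w ^ n / fact n)"
              using m_le(1)[of n x] False by (intro mult_right_mono) auto
            finally show ?thesis
              by (simp add: field_simps)
          qed simp
        qed
        also have "\<dots> = (\<Sum>n<N. (norm w * b) ^ n /\<^sub>R fact n) * indicator B x"
          by (simp add: sum_distrib_right)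
        also have "\<dots> \<le> exp (norm w * b) * indicator B x"
          unfolding exp_def using summable_exp_generic[of "norm w * b"] b0
          by (intro mult_right_mono sum_le_suminf) auto
        finally show "norm (\<Sum>n<N. ?t n x) \<le> exp (norm w * b) * indicator B x" .
      qed
    qed
    moreover have "(\<integral>x. (\<Sum>n<N. ?t n x) \<partial>\<mu>) = (\<Sum>n<N. of_real (fps_nth (exp_gen_series ?c) n) * w ^ n)" for N
      by (subst Bochner_Integration.integral_sum) (auto simp only: t_int t_eq)
    ultimately show ?thesis
      by (simp add: sums_def)
  qed
  \<comment> \<open>The same function, expanded a second time, now through the moments of the
    sum.\<close>
  have S_sums: "(\<lambda>n. of_real ((\<integral>\<omega>. ?S \<omega> ^ n \<partial>M) / fact n) * w ^ n) sums exp (\<integral>x. ?\<psi> w x - 1 \<partial>\<mu>)" for w :: complex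
  proof -
    have "(\<integral>\<omega>. exp (w * of_real (?S \<omega>)) \<partial>M) =
        (\<integral>\<omega>. (\<Prod>i\<in>hits (\<eta> \<omega>) B. exp (w * of_real (Y (snd (\<eta> \<omega>) i) (R i \<omega>)))) \<partial>M)"
    proof (rule integral_cong_AE)
      show "AE \<omega> in M. exp (w * of_real (?S \<omega>)) = (\<Prod>i\<in>hits (\<eta> \<omega>) B. exp (w * of_real (Y (snd (\<eta> \<omega>) i) (R i \<omega>))))"
        using fin
      proof eventually_elim
        case (elim \<omega>)
        show ?case
          unfolding mark_sum_finite[of \<omega> B Y, OF elim, OF Y0, simplified]
          using elim by (simp add: exp_sum[symmetric] sum_distrib_left)
      qed
    qed (auto intro!: measurable_prod_hits)
    also have "\<dots> = exp (\<integral>x. ?\<psi> w x - 1 \<partial>\<mu>)"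
    proof (rule functional[OF _ B B_fin])
      show "norm (exp (w * of_real (Y x g))) \<le> exp (norm w * b)" for x g
      proof -
        have "Re (w * of_real (Y x g)) \<le> norm (w * of_real (Y x g))"
          by (rule complex_Re_le_cmod)
        also have "\<dots> \<le> norm w * b"
          by (simp add: norm_mult mult_left_mono b)
        finally show ?thesis by simp
      qed
      show "(\<integral>\<omega>. exp (w * of_real (Y x (R i \<omega>))) \<partial>M) = ?\<psi> w x" for i x
        by (rule integral_mark[OF Y]) measurable
    qed (auto simp: Y0)
    finally show ?thesis
      using sums_exponential_moments[of ?S M w] exp_S by simp
  qed
  \<comment> \<open>Uniqueness of the expansion of an analytic function at 0 identifies the two
    series.\<close>
  let ?C = "complex_fps (exp_gen_series ?c)" and ?M = "complex_fps (moment_series M ?S)"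
  have "(\<lambda>w. \<integral>x. ?\<psi> w x - 1 \<partial>\<mu>) has_fps_expansion ?C"
    using g_sums by (intro has_fps_expansionI) auto
  then have "(exp \<circ> (\<lambda>w. \<integral>x. ?\<psi> w x - 1 \<partial>\<mu>)) has_fps_expansion (fps_exp 1 oo ?C)"
    by (intro has_fps_expansion_compose has_fps_expansion_exp1) auto
  moreover have "(exp \<circ> (\<lambda>w. \<integral>x. ?\<psi> w x - 1 \<partial>\<mu>)) has_fps_expansion ?M"
    using S_sums by (intro has_fps_expansionI) (auto simp: moment_series_def)
  ultimately have "?M = (fps_exp 1 oo ?C)"
    by (rule fps_expansion_unique_complex[rotated])
  also have "\<dots> = complex_fps (fps_exp 1 oo exp_gen_series ?c)"
    by (simp only: complex_fps_compose complex_fps_exp)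
  finally have eq: "fps_nth ?M k = fps_nth (complex_fps (fps_exp 1 oo exp_gen_series ?c)) k" for k
    by simp
  have "fps_nth (moment_series M ?S) n = fps_nth (fps_exp 1 oo exp_gen_series ?c) n"
    using eq[of n] by (simp only: complex_fps_nth of_real_eq_iff)
  then show "n \<ge> 1 \<Longrightarrow> (\<integral>\<omega>. ?S \<omega> ^ n \<partial>M) = complete_bell n ?c"
    by (simp add: complete_bell_eq moment_series_def field_simps)
qed

end

section \<open>Unbounded marks and infinite intensity, by truncation\<close>

lemma tendsto_power_ennreal:
  fixes f :: "'a \<Rightarrow> ennreal"
  assumes "(f \<longlongrightarrow> a) F"
  shows "((\<lambda>x. f x ^ n) \<longlongrightarrow> a ^ n) F"
proof (induction n)
  case (Suc n)
  show ?case
    unfolding power_Suc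
  proof (rule tendsto_mult_ennreal[OF assms Suc])
    show "\<not> (a = 0 \<and> a ^ n = \<infinity> \<or> a = \<infinity> \<and> a ^ n = 0)"
      by (cases "n = 0") (auto simp: power_eq_0_iff power_0_left)
  qed
qed simp

definition (in marked_poisson) exhaustion :: "(nat \<Rightarrow> 'b set) \<Rightarrow> bool" where
  "exhaustion A \<longleftrightarrow> range A \<subseteq> sets borel \<and> (\<Union>i. A i) = UNIV \<and> (\<forall>i. emeasure \<mu> (A i) < \<infinity>) \<and> incseq A"

text \<open>Position and value are cut off by the same parameter, so that the bounded case applies
  for each \<open>N\<close>. The absolute values increase with \<open>N\<close> along an increasing
  \<open>A\<close>, which permits monotone convergence.\<close>

definition cutoff :: "(nat \<Rightarrow> 'b set) \<Rightarrow> nat \<Rightarrow> ('b \<Rightarrow> 'g \<Rightarrow> real) \<Rightarrow> 'b \<Rightarrow> 'g \<Rightarrow> real" where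
  "cutoff A N Y x g = (if x \<in> A N then max (- real N) (min (real N) (Y x g)) else 0)"

abbreviation abs_mark :: "('b \<Rightarrow> 'g \<Rightarrow> real) \<Rightarrow> 'b \<Rightarrow> 'g \<Rightarrow> real" where
  "abs_mark Y \<equiv> (\<lambda>x g. \<bar>Y x g\<bar>)"

lemma abs_cut_le: "\<bar>cutoff A N Y x g\<bar> \<le> real N" and abs_cut_le_abs: "\<bar>cutoff A N Y x g\<bar> \<le> \<bar>Y x g\<bar>"
  and cut_abs_mark: "cutoff A N (abs_mark Y) x g = \<bar>cutoff A N Y x g\<bar>"
  and cut_outside: "x \<notin> A N \<Longrightarrow> cutoff A N Y x g = 0"
  by (auto simp: cutoff_def)

lemma cut_abs_mono: "incseq A \<Longrightarrow> N \<le> N' \<Longrightarrow> \<bar>cutoff A N Y x g\<bar> \<le> \<bar>cutoff A N' Y x g\<bar>"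
  by (auto simp: cutoff_def incseq_def)

context marked_poisson
begin

lemma cut_tendsto:
  assumes "exhaustion A"
  shows "(\<lambda>N. cutoff A N Y x g) \<longlonglongrightarrow> Y x g"
proof -
  have "x \<in> (\<Union>i. A i)"
    using assms by (simp add: exhaustion_def)
  then obtain m where m: "x \<in> A m"
    by blast
  define k where "k = nat \<lceil>\<bar>Y x g\<bar>\<rceil>"
  have "cutoff A N Y x g = Y x g" if N: "N \<ge> max m k" for N
  proof -
    have "A m \<subseteq> A N"
      using N assms incseqD[of A m N] by (simp add: exhaustion_def)
    then have "x \<in> A N"
      using m by blast
    moreover have "\<bar>Y x g\<bar> \<le> real N"
    proof -
      have "\<bar>Y x g\<bar> \<le> real k"
        unfolding k_def by (rule real_nat_ceiling_ge)
      also have "\<dots> \<le> real N"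
        using N by simp
      finally show ?thesis .
    qed
    ultimately show ?thesis
      by (simp add: cutoff_def)
  qed
  then show ?thesis
    by (intro tendsto_eventually eventually_sequentiallyI[of "max m k"])
qed

lemma mark_cut:
  assumes "exhaustion A" "mark Y"
  shows "mark (cutoff A N Y)"
proof -
  have "mark (\<lambda>x g. if x \<in> A N then max (- real N) (min (real N) (Y x g)) else 0)"
    using assms by (intro mark_comp) (auto simp: exhaustion_def)
  then show ?thesis
    by (simp add: cutoff_def[abs_def])
qed

lemma mark_abs:
  assumes "mark Y" shows "mark (abs_mark Y)"
  using mark_comp[OF assms, of UNIV abs] by simp

lemma cut_moments:
  assumes A: "exhaustion A" and Y: "mark Y"
  shows cut_integrable_power: "integrable M (\<lambda>\<omega>. mark_sum (cutoff A N Y) \<omega> ^ n)"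
    and cut_moment: "n \<ge> 1 \<Longrightarrow>
      (\<integral>\<omega>. mark_sum (cutoff A N Y) \<omega> ^ n \<partial>M) = complete_bell n (\<lambda>k. \<integral>x. mark_moment (cutoff A N Y) k x \<partial>\<mu>)"
proof -
  have B: "A N \<in> sets borel" "emeasure \<mu> (A N) < \<infinity>"
    using A by (auto simp: exhaustion_def)
  show "integrable M (\<lambda>\<omega>. mark_sum (cutoff A N Y) \<omega> ^ n)"
    by (rule bounded_integrable_power[OF mark_cut[OF A Y] B abs_cut_le cut_outside])
  show "n \<ge> 1 \<Longrightarrow>
      (\<integral>\<omega>. mark_sum (cutoff A N Y) \<omega> ^ n \<partial>M) = complete_bell n (\<lambda>k. \<integral>x. mark_moment (cutoff A N Y) k x \<partial>\<mu>)"
    by (rule bounded_moment[OF mark_cut[OF A Y] B abs_cut_le cut_outside])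
qed

lemma abs_mark_sum_eq:
  assumes "abs_mark_sum Y \<omega> < \<infinity>"
  shows "ennreal (mark_sum (abs_mark Y) \<omega>) = abs_mark_sum Y \<omega>"
    and "integrable (count_space (indices (\<eta> \<omega>))) (\<lambda>i. Y (snd (\<eta> \<omega>) i) (R i \<omega>))"
proof -
  show int: "integrable (count_space (indices (\<eta> \<omega>))) (\<lambda>i. Y (snd (\<eta> \<omega>) i) (R i \<omega>))"
    using assms by (intro integrableI_bounded) (auto simp: abs_mark_sum_def)
  then show "ennreal (mark_sum (abs_mark Y) \<omega>) = abs_mark_sum Y \<omega>"
    unfolding abs_mark_sum_def mark_sum_def by (subst nn_integral_eq_integral) auto
qed

lemma abs_mark_sum_cut_finite:
  assumes A: "exhaustion A"
  shows "AE \<omega> in M. abs_mark_sum (cutoff A N Y) \<omega> < \<infinity>"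
proof -
  have B: "A N \<in> sets borel" "emeasure \<mu> (A N) < \<infinity>"
    using A by (auto simp: exhaustion_def)
  show ?thesis
    using poisson_process_finite_hits[OF poisson B]
  proof eventually_elim
    case (elim \<omega>)
    have "abs_mark_sum (cutoff A N Y) \<omega> = (\<Sum>i\<in>hits (\<eta> \<omega>) (A N). ennreal \<bar>cutoff A N Y (snd (\<eta> \<omega>) i) (R i \<omega>)\<bar>)"
      unfolding abs_mark_sum_def using elim
      by (intro nn_integral_count_space') (auto simp: hits_def cut_outside)
    then show ?case by simp
  qed
qed

lemma cut_abs_moment:
  assumes A: "exhaustion A" and Y: "mark Y" and "n \<ge> 1"
  shows "(\<integral>\<^sup>+\<omega>. abs_mark_sum (cutoff A N Y) \<omega> ^ n \<partial>M) =
    ennreal (complete_bell n (\<lambda>k. \<integral>x. mark_moment (cutoff A N (abs_mark Y)) k x \<partial>\<mu>))"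
proof -
  have eq: "cutoff A N (abs_mark Y) = abs_mark (cutoff A N Y)"
    by (simp add: fun_eq_iff cut_abs_mark)
  have "(\<integral>\<^sup>+\<omega>. abs_mark_sum (cutoff A N Y) \<omega> ^ n \<partial>M) =
      (\<integral>\<^sup>+\<omega>. ennreal (mark_sum (cutoff A N (abs_mark Y)) \<omega> ^ n) \<partial>M)"
  proof (rule nn_integral_cong_AE)
    show "AE \<omega> in M. abs_mark_sum (cutoff A N Y) \<omega> ^ n = ennreal (mark_sum (cutoff A N (abs_mark Y)) \<omega> ^ n)"
      using abs_mark_sum_cut_finite[OF A, of N Y]
    proof eventually_elim
      case (elim \<omega>)
      have "0 \<le> mark_sum (abs_mark (cutoff A N Y)) \<omega>"
        by (simp add: mark_sum_def)
      then show ?case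
        unfolding eq abs_mark_sum_eq(1)[OF elim, symmetric] by (simp add: ennreal_power)
    qed
  qed
  also have "\<dots> = ennreal (\<integral>\<omega>. mark_sum (cutoff A N (abs_mark Y)) \<omega> ^ n \<partial>M)"
    by (intro nn_integral_eq_integral cut_integrable_power[OF A mark_abs[OF Y]])
       (simp add: eq mark_sum_def)
  also have "\<dots> = ennreal (complete_bell n (\<lambda>k. \<integral>x. mark_moment (cutoff A N (abs_mark Y)) k x \<partial>\<mu>))"
    by (simp only: cut_moment[OF A mark_abs[OF Y] \<open>n \<ge> 1\<close>])
  finally show ?thesis .
qed

lemma abs_mark_sum_cut_tendsto:
  assumes A: "exhaustion A"
  shows "(\<lambda>N. abs_mark_sum (cutoff A N Y) \<omega>) \<longlonglongrightarrow> abs_mark_sum Y \<omega>"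
    and "mono (\<lambda>N. abs_mark_sum (cutoff A N Y) \<omega>)"
    and "abs_mark_sum (cutoff A N Y) \<omega> \<le> abs_mark_sum Y \<omega>"
proof -
  have inc: "incseq A" using A by (simp add: exhaustion_def)
  show "(\<lambda>N. abs_mark_sum (cutoff A N Y) \<omega>) \<longlonglongrightarrow> abs_mark_sum Y \<omega>"
    unfolding abs_mark_sum_def
  proof (rule nn_integral_LIMSEQ)
    show "mono (\<lambda>N i. ennreal \<bar>cutoff A N Y (snd (\<eta> \<omega>) i) (R i \<omega>)\<bar>)"
      by (auto simp: mono_def le_fun_def intro!: ennreal_leI cut_abs_mono[OF inc])
    show "(\<lambda>N. ennreal \<bar>cutoff A N Y (snd (\<eta> \<omega>) i) (R i \<omega>)\<bar>) \<longlonglongrightarrow> ennreal \<bar>Y (snd (\<eta> \<omega>) i) (R i \<omega>)\<bar>" for i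
      by (intro tendsto_ennrealI tendsto_rabs cut_tendsto[OF A])
  qed auto
  show "mono (\<lambda>N. abs_mark_sum (cutoff A N Y) \<omega>)"
    unfolding abs_mark_sum_def
    by (auto simp: mono_def intro!: nn_integral_mono ennreal_leI cut_abs_mono[OF inc])
  show "abs_mark_sum (cutoff A N Y) \<omega> \<le> abs_mark_sum Y \<omega>"
    unfolding abs_mark_sum_def by (intro nn_integral_mono ennreal_leI abs_cut_le_abs)
qed

lemma mark_moment_cut_tendsto:
  assumes A: "exhaustion A" and Y: "mark Y" and int: "integrable M (\<lambda>\<omega>. Y x (R 0 \<omega>) ^ k)"
  shows "(\<lambda>N. mark_moment (cutoff A N Y) k x) \<longlonglongrightarrow> mark_moment Y k x"
    and "\<bar>mark_moment (cutoff A N Y) k x\<bar> \<le> mark_moment (abs_mark Y) k x"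
proof -
  note [measurable] = measurable_mark(2)[OF Y] measurable_mark(2)[OF mark_cut[OF A Y]]
  have abs: "integrable M (\<lambda>\<omega>. \<bar>Y x (R 0 \<omega>)\<bar> ^ k)"
    using integrable_abs[OF int] by (simp add: power_abs)
  have le: "\<bar>cutoff A N Y x g ^ k\<bar> \<le> \<bar>Y x g\<bar> ^ k" for N g
    unfolding power_abs by (intro power_mono abs_cut_le_abs) simp
  show "(\<lambda>N. mark_moment (cutoff A N Y) k x) \<longlonglongrightarrow> mark_moment Y k x"
    unfolding mark_moment_def
  proof (rule integral_dominated_convergence[OF _ _ abs])
    show "AE \<omega> in M. (\<lambda>N. cutoff A N Y x (R 0 \<omega>) ^ k) \<longlonglongrightarrow> Y x (R 0 \<omega>) ^ k"
      by (intro AE_I2 tendsto_power cut_tendsto[OF A])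
  qed (use le in auto)
  have "\<bar>mark_moment (cutoff A N Y) k x\<bar> \<le> (\<integral>\<omega>. \<bar>cutoff A N Y x (R 0 \<omega>) ^ k\<bar> \<partial>M)"
    unfolding mark_moment_def by (rule integral_abs_bound)
  also have "\<dots> \<le> mark_moment (abs_mark Y) k x"
    unfolding mark_moment_def
  proof (rule integral_mono[OF _ abs])
    show "integrable M (\<lambda>\<omega>. \<bar>cutoff A N Y x (R 0 \<omega>) ^ k\<bar>)"
      by (rule Bochner_Integration.integrable_bound[OF abs]) (use le in auto)
  qed (rule le)
  finally show "\<bar>mark_moment (cutoff A N Y) k x\<bar> \<le> mark_moment (abs_mark Y) k x" .
qed

lemma mark_moment_abs_nonneg: "0 \<le> mark_moment (abs_mark Y) k x"
  by (simp add: mark_moment_def)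

text \<open>From the sum back to the marks. The n-th moment of the truncated absolute sum is a Bell
  polynomial with nonnegative arguments and thus bounds its last argument, the integral of the
  truncated mark moment; monotone convergence removes the truncation.\<close>

lemma moments_imp_integrable_mark_moment:
  assumes A: "exhaustion A" and Y: "mark Y" and "n \<ge> 1"
    and int: "\<And>x. integrable M (\<lambda>\<omega>. Y x (R 0 \<omega>) ^ n)"
    and fin: "(\<integral>\<^sup>+\<omega>. abs_mark_sum Y \<omega> ^ n \<partial>M) < \<infinity>"
  shows "integrable \<mu> (mark_moment (abs_mark Y) n)"
proof -
  let ?Z = "abs_mark Y"
  note Z = mark_abs[OF Y]
  have intZ: "integrable M (\<lambda>\<omega>. ?Z x (R 0 \<omega>) ^ n)" for x
    using integrable_abs[OF int[of x]] by (simp add: power_abs)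
  have cZ: "cutoff A N ?Z = abs_mark (cutoff A N Y)" for N
    by (simp add: fun_eq_iff cut_abs_mark)
  have inc: "incseq A" using A by (simp add: exhaustion_def)
  have nonneg: "0 \<le> mark_moment (cutoff A N ?Z) k x" for N k x
    unfolding cZ by (rule mark_moment_abs_nonneg)
  have le: "(\<integral>\<^sup>+x. ennreal (mark_moment (cutoff A N ?Z) n x) \<partial>\<mu>) \<le> (\<integral>\<^sup>+\<omega>. abs_mark_sum Y \<omega> ^ n \<partial>M)" for N
  proof -
    have B: "A N \<in> sets borel" "emeasure \<mu> (A N) < \<infinity>"
      using A by (auto simp: exhaustion_def)
    have "integrable \<mu> (mark_moment (cutoff A N ?Z) n)"
      by (rule bounded_mark_moment(2)[OF mark_cut[OF A Z] B abs_cut_le cut_outside \<open>n \<ge> 1\<close>])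
    then have "(\<integral>\<^sup>+x. ennreal (mark_moment (cutoff A N ?Z) n x) \<partial>\<mu>) = ennreal (\<integral>x. mark_moment (cutoff A N ?Z) n x \<partial>\<mu>)"
      using nonneg by (intro nn_integral_eq_integral) auto
    also have "\<dots> \<le> ennreal (complete_bell n (\<lambda>k. \<integral>x. mark_moment (cutoff A N ?Z) k x \<partial>\<mu>))"
      using nonneg \<open>n \<ge> 1\<close> by (intro ennreal_leI complete_bell_ge) auto
    also have "\<dots> = (\<integral>\<^sup>+\<omega>. abs_mark_sum (cutoff A N Y) \<omega> ^ n \<partial>M)"
      by (rule cut_abs_moment[OF A Y \<open>n \<ge> 1\<close>, symmetric])
    also have "\<dots> \<le> (\<integral>\<^sup>+\<omega>. abs_mark_sum Y \<omega> ^ n \<partial>M)"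
      by (intro nn_integral_mono power_mono abs_mark_sum_cut_tendsto(3)[OF A]) auto
    finally show ?thesis .
  qed
  have "(\<lambda>N. \<integral>\<^sup>+x. ennreal (mark_moment (cutoff A N ?Z) n x) \<partial>\<mu>) \<longlonglongrightarrow> (\<integral>\<^sup>+x. ennreal (mark_moment ?Z n x) \<partial>\<mu>)"
  proof (rule nn_integral_LIMSEQ)
    note [measurable] = measurable_mark(2)[OF mark_cut[OF A Z]] measurable_mark(2)[OF mark_cut[OF A Y]]
    show "mono (\<lambda>N x. ennreal (mark_moment (cutoff A N ?Z) n x))"
    proof (intro monoI le_funI ennreal_leI)
      fix N N' :: nat and x assume "N \<le> N'"
      show "mark_moment (cutoff A N ?Z) n x \<le> mark_moment (cutoff A N' ?Z) n x"
        unfolding mark_moment_def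
      proof (rule integral_mono)
        have int_cut: "integrable M (\<lambda>\<omega>. cutoff A m ?Z x (R 0 \<omega>) ^ n)" for m
          by (rule Bochner_Integration.integrable_bound[OF intZ])
             (auto simp: cut_abs_mark intro!: power_mono abs_cut_le_abs)
        show "integrable M (\<lambda>\<omega>. cutoff A N ?Z x (R 0 \<omega>) ^ n)" "integrable M (\<lambda>\<omega>. cutoff A N' ?Z x (R 0 \<omega>) ^ n)"
          by (rule int_cut)+
        show "cutoff A N ?Z x (R 0 \<omega>) ^ n \<le> cutoff A N' ?Z x (R 0 \<omega>) ^ n" for \<omega>
          unfolding cZ by (intro power_mono cut_abs_mono[OF inc \<open>N \<le> N'\<close>]) simp
      qed
    qed
    show "(\<lambda>x. ennreal (mark_moment (cutoff A N ?Z) n x)) \<in> borel_measurable \<mu>" for N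
      using measurable_mark_moment[OF mark_cut[OF A Z]] by measurable
    show "(\<lambda>N. ennreal (mark_moment (cutoff A N ?Z) n x)) \<longlonglongrightarrow> ennreal (mark_moment ?Z n x)" for x
      by (intro tendsto_ennrealI mark_moment_cut_tendsto(1)[OF A Z intZ])
  qed
  then have "(\<integral>\<^sup>+x. ennreal (mark_moment ?Z n x) \<partial>\<mu>) \<le> (\<integral>\<^sup>+\<omega>. abs_mark_sum Y \<omega> ^ n \<partial>M)"
    by (rule LIMSEQ_le_const2) (use le in auto)
  then show ?thesis
    using fin measurable_mark_moment[OF Z, of n] mark_moment_abs_nonneg[of Y n]
    by (intro integrableI_bounded) (auto simp: abs_of_nonneg order.strict_trans1)
qed

text \<open>From the marks to the sum. Monotone convergence first bounds all moments of the absolute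
  sum by Bell polynomials; these then dominate the signed sums, and the moment formula passes to the
  limit.\<close>

lemma moments_of_mark_sum:
  assumes A: "exhaustion A" and Y: "mark Y"
    and int: "\<And>x k. integrable M (\<lambda>\<omega>. Y x (R 0 \<omega>) ^ k)"
    and int\<mu>: "\<And>k. k \<ge> 1 \<Longrightarrow> integrable \<mu> (mark_moment (abs_mark Y) k)"
  shows moments_abs_mark_sum_finite: "(\<integral>\<^sup>+\<omega>. abs_mark_sum Y \<omega> ^ n \<partial>M) < \<infinity>"
    and mark_sum_integrable_power: "integrable M (\<lambda>\<omega>. mark_sum Y \<omega> ^ n)"
    and mark_sum_moment: "n \<ge> 1 \<Longrightarrow>
      (\<integral>\<omega>. mark_sum Y \<omega> ^ n \<partial>M) = complete_bell n (\<lambda>k. \<integral>x. mark_moment Y k x \<partial>\<mu>)"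
proof -
  let ?Z = "abs_mark Y"
  note Z = mark_abs[OF Y]
  have intZ: "integrable M (\<lambda>\<omega>. ?Z x (R 0 \<omega>) ^ k)" for x k
    using integrable_abs[OF int[of x k]] by (simp add: power_abs)
  have cZ: "cutoff A N ?Z = abs_mark (cutoff A N Y)" for N
    by (simp add: fun_eq_iff cut_abs_mark)
  have inc: "incseq A" using A by (simp add: exhaustion_def)
  have [measurable]: "mark_moment (cutoff A N Y) k \<in> borel_measurable \<mu>" "mark_moment (cutoff A N ?Z) k \<in> borel_measurable \<mu>"
      "mark_moment Y k \<in> borel_measurable \<mu>" for N k
    using measurable_mark_moment[OF mark_cut[OF A Y]] measurable_mark_moment[OF mark_cut[OF A Z]]
      measurable_mark_moment[OF Y] by measurable
  note [measurable] = measurable_mark_sum(1)[OF mark_cut[OF A Y]] measurable_mark_sum(1)[OF Y]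
     measurable_mark_sum(2)[OF mark_cut[OF A Y]] measurable_mark_sum(2)[OF Y]
  let ?K = "\<lambda>n. complete_bell n (\<lambda>k. \<integral>x. mark_moment ?Z k x \<partial>\<mu>)"
  \<comment> \<open>Bounded uniformly in the truncation, since Bell polynomials are monotone on
    nonnegative arguments.\<close>
  have fin: "(\<integral>\<^sup>+\<omega>. abs_mark_sum Y \<omega> ^ n \<partial>M) < \<infinity>" for n
  proof (cases "n = 0")
    case False
    have "(\<lambda>N. \<integral>\<^sup>+\<omega>. abs_mark_sum (cutoff A N Y) \<omega> ^ n \<partial>M) \<longlonglongrightarrow> (\<integral>\<^sup>+\<omega>. abs_mark_sum Y \<omega> ^ n \<partial>M)"
    proof (rule nn_integral_LIMSEQ)
      show "mono (\<lambda>N \<omega>. abs_mark_sum (cutoff A N Y) \<omega> ^ n)"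
        by (intro monoI le_funI power_mono monoD[OF abs_mark_sum_cut_tendsto(2)[OF A]]) auto
    qed (auto intro!: tendsto_power_ennreal abs_mark_sum_cut_tendsto(1)[OF A])
    moreover have "(\<integral>\<^sup>+\<omega>. abs_mark_sum (cutoff A N Y) \<omega> ^ n \<partial>M) \<le> ennreal (?K n)" for N
    proof -
      have "complete_bell n (\<lambda>k. \<integral>x. mark_moment (cutoff A N ?Z) k x \<partial>\<mu>) \<le> ?K n"
      proof (rule complete_bell_mono)
        fix k :: nat assume "k \<ge> 1"
        show "0 \<le> (\<integral>x. mark_moment (cutoff A N ?Z) k x \<partial>\<mu>)"
          unfolding cZ by (simp add: mark_moment_abs_nonneg)
        have le: "\<bar>mark_moment (cutoff A N ?Z) k x\<bar> \<le> mark_moment ?Z k x" for x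
          using mark_moment_cut_tendsto(2)[OF A Z intZ[of x k], of N] by simp
        show "(\<integral>x. mark_moment (cutoff A N ?Z) k x \<partial>\<mu>) \<le> (\<integral>x. mark_moment ?Z k x \<partial>\<mu>)"
        proof (rule integral_mono[OF _ int\<mu>[OF \<open>k \<ge> 1\<close>]])
          show "integrable \<mu> (mark_moment (cutoff A N ?Z) k)"
          proof (rule Bochner_Integration.integrable_bound[OF int\<mu>[OF \<open>k \<ge> 1\<close>]])
            show "AE x in \<mu>. norm (mark_moment (cutoff A N ?Z) k x) \<le> norm (mark_moment ?Z k x)"
              unfolding real_norm_def by (intro AE_I2 order_trans[OF le abs_ge_self])
          qed measurable
          show "mark_moment (cutoff A N ?Z) k x \<le> mark_moment ?Z k x" for x
            using le[of x] by simp
        qed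
      qed
      then show ?thesis
        using False by (simp add: cut_abs_moment[OF A Y] ennreal_leI)
    qed
    ultimately have "(\<integral>\<^sup>+\<omega>. abs_mark_sum Y \<omega> ^ n \<partial>M) \<le> ennreal (?K n)"
      by (intro LIMSEQ_le_const2) auto
    then show ?thesis
      by (simp add: order.strict_trans1)
  qed (simp add: emeasure_space_1)
  then show "(\<integral>\<^sup>+\<omega>. abs_mark_sum Y \<omega> ^ n \<partial>M) < \<infinity>" .
  have abs_fin: "AE \<omega> in M. abs_mark_sum Y \<omega> < \<infinity>"
  proof -
    have "AE \<omega> in M. abs_mark_sum Y \<omega> \<noteq> \<infinity>"
      by (rule nn_integral_PInf_AE) (use fin[of 1] in simp_all)
    then show ?thesis
      by eventually_elim (simp add: less_top)
  qed
  let ?D = "\<lambda>\<omega>. enn2real (abs_mark_sum Y \<omega>)"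
  \<comment> \<open>Stated for any \<open>Y'\<close> below \<open>Y\<close> in absolute value, in
    order to cover \<open>Y\<close> and all its truncations with one dominating variable.\<close>
  have S_le: "\<bar>mark_sum Y' \<omega>\<bar> \<le> ?D \<omega>"
    if "abs_mark_sum Y \<omega> < \<infinity>" "\<And>x g. \<bar>Y' x g\<bar> \<le> \<bar>Y x g\<bar>" for \<omega> Y'
  proof -
    have "\<bar>mark_sum Y' \<omega>\<bar> \<le> (\<integral>i. \<bar>Y' (snd (\<eta> \<omega>) i) (R i \<omega>)\<bar> \<partial>count_space (indices (\<eta> \<omega>)))"
      unfolding mark_sum_def by (rule integral_abs_bound)
    also have "\<dots> \<le> mark_sum ?Z \<omega>"
      unfolding mark_sum_def
    proof (rule integral_mono)
      show Z: "integrable (count_space (indices (\<eta> \<omega>))) (\<lambda>i. \<bar>Y (snd (\<eta> \<omega>) i) (R i \<omega>)\<bar>)"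
        by (intro integrable_abs abs_mark_sum_eq(2) that)
      then show "integrable (count_space (indices (\<eta> \<omega>))) (\<lambda>i. \<bar>Y' (snd (\<eta> \<omega>) i) (R i \<omega>)\<bar>)"
        by (rule Bochner_Integration.integrable_bound) (use that(2) in auto)
    qed (rule that(2))
    also have "\<dots> = ?D \<omega>"
      unfolding abs_mark_sum_eq(1)[OF that(1), symmetric] by (simp add: mark_sum_def)
    finally show ?thesis .
  qed
  have D_int: "integrable M (\<lambda>\<omega>. ?D \<omega> ^ n)" for n
    using abs_fin fin by (intro integrable_enn2real_power) auto
  have pow_le: "AE \<omega> in M. norm (mark_sum Y' \<omega> ^ n) \<le> ?D \<omega> ^ n"
    if "\<And>x g. \<bar>Y' x g\<bar> \<le> \<bar>Y x g\<bar>" for Y' n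
    using abs_fin
  proof eventually_elim
    case (elim \<omega>)
    show ?case
      unfolding real_norm_def power_abs by (intro power_mono S_le elim that) simp
  qed
  show "integrable M (\<lambda>\<omega>. mark_sum Y \<omega> ^ n)"
    by (rule Bochner_Integration.integrable_bound[OF D_int[of n]]) (use pow_le[of Y n] in auto)
  assume "n \<ge> 1"
  have "(\<lambda>N. \<integral>\<omega>. mark_sum (cutoff A N Y) \<omega> ^ n \<partial>M) \<longlonglongrightarrow> (\<integral>\<omega>. mark_sum Y \<omega> ^ n \<partial>M)"
  proof (rule integral_dominated_convergence[OF _ _ D_int[of n]])
    show "AE \<omega> in M. (\<lambda>N. mark_sum (cutoff A N Y) \<omega> ^ n) \<longlonglongrightarrow> mark_sum Y \<omega> ^ n"
      using abs_fin
    proof eventually_elim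
      case (elim \<omega>)
      have "(\<lambda>N. mark_sum (cutoff A N Y) \<omega>) \<longlonglongrightarrow> mark_sum Y \<omega>"
        unfolding mark_sum_def
      proof (rule integral_dominated_convergence)
        show "integrable (count_space (indices (\<eta> \<omega>))) (\<lambda>i. \<bar>Y (snd (\<eta> \<omega>) i) (R i \<omega>)\<bar>)"
          by (intro integrable_abs abs_mark_sum_eq(2) elim)
      qed (auto intro: cut_tendsto[OF A] abs_cut_le_abs)
      then show ?case by (rule tendsto_power)
    qed
    show "AE \<omega> in M. norm (mark_sum (cutoff A N Y) \<omega> ^ n) \<le> ?D \<omega> ^ n" for N
      by (rule pow_le) (rule abs_cut_le_abs)
  qed measurable
  moreover have "(\<lambda>N. \<integral>\<omega>. mark_sum (cutoff A N Y) \<omega> ^ n \<partial>M) \<longlonglongrightarrow> complete_bell n (\<lambda>k. \<integral>x. mark_moment Y k x \<partial>\<mu>)"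
    unfolding cut_moment[OF A Y \<open>n \<ge> 1\<close>]
  proof (rule tendsto_complete_bell)
    fix k :: nat assume "k \<ge> 1"
    show "(\<lambda>N. \<integral>x. mark_moment (cutoff A N Y) k x \<partial>\<mu>) \<longlonglongrightarrow> (\<integral>x. mark_moment Y k x \<partial>\<mu>)"
      by (rule integral_dominated_convergence[OF _ _ int\<mu>[OF \<open>k \<ge> 1\<close>]])
         (auto intro: mark_moment_cut_tendsto[OF A Y int])
  qed
  ultimately show "(\<integral>\<omega>. mark_sum Y \<omega> ^ n \<partial>M) = complete_bell n (\<lambda>k. \<integral>x. mark_moment Y k x \<partial>\<mu>)"
    by (rule LIMSEQ_unique)
qed

end

section \<open>Cluster sums over finitely many generations\<close>

lemma nn_integral_count_space_Sigma:
  fixes F :: "'i \<Rightarrow> 'j \<Rightarrow> ennreal"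
  shows "(\<integral>\<^sup>+p. F (fst p) (snd p) \<partial>count_space (Sigma I J)) = (\<integral>\<^sup>+i. \<integral>\<^sup>+j. F i j \<partial>count_space (J i) \<partial>count_space I)"
proof -
  have "(\<integral>\<^sup>+p. F (fst p) (snd p) \<partial>count_space (Sigma I J)) =
      (\<integral>\<^sup>+p. F (fst p) (snd p) * indicator (Sigma I J) p \<partial>count_space UNIV)"
    by (rule nn_integral_count_space_indicator) simp
  also have "\<dots> = (\<integral>\<^sup>+i. \<integral>\<^sup>+j. F i j * indicator (Sigma I J) (i, j) \<partial>count_space UNIV \<partial>count_space UNIV)"
    by (simp add: nn_integral_fst_count_space[symmetric])
  also have "\<dots> = (\<integral>\<^sup>+i. (\<integral>\<^sup>+j. F i j * indicator (J i) j \<partial>count_space UNIV) * indicator I i \<partial>count_space UNIV)"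
    by (intro nn_integral_cong) (auto simp: indicator_def)
  also have "\<dots> = (\<integral>\<^sup>+i. \<integral>\<^sup>+j. F i j \<partial>count_space (J i) \<partial>count_space I)"
    by (simp add: nn_integral_count_space_indicator)
  finally show ?thesis .
qed

lemma integral_count_space_eq_UNIV:
  fixes F :: "'i \<Rightarrow> real"
  shows "(\<integral>i. F i \<partial>count_space I) = (\<integral>i. indicator I i * F i \<partial>count_space UNIV)"
    and "integrable (count_space I) F \<longleftrightarrow> integrable (count_space UNIV) (\<lambda>i. indicator I i * F i)"
  using integral_restrict_space[of I "count_space UNIV" F] integrable_restrict_space[of I "count_space UNIV" F]
  by (simp_all add: restrict_count_space)

lemma integral_count_space_Sigma:
  fixes F :: "'i::countable \<Rightarrow> 'j::countable \<Rightarrow> real"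
  assumes "integrable (count_space (Sigma I J)) (\<lambda>p. F (fst p) (snd p))"
  shows "(\<integral>p. F (fst p) (snd p) \<partial>count_space (Sigma I J)) = (\<integral>i. \<integral>j. F i j \<partial>count_space (J i) \<partial>count_space I)"
proof -
  interpret I: sigma_finite_measure "count_space (UNIV :: 'i set)"
    by (rule sigma_finite_measure_count_space_countable) simp
  interpret J: sigma_finite_measure "count_space (UNIV :: 'j set)"
    by (rule sigma_finite_measure_count_space_countable) simp
  interpret pair_sigma_finite "count_space (UNIV :: 'i set)" "count_space (UNIV :: 'j set)" ..
  have eq: "count_space UNIV \<Otimes>\<^sub>M count_space UNIV = count_space (UNIV :: ('i \<times> 'j) set)"
    by (simp add: pair_measure_countable)
  let ?F = "\<lambda>p. indicator (Sigma I J) p * F (fst p) (snd p)"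
  have int: "integrable (count_space UNIV \<Otimes>\<^sub>M count_space UNIV) ?F"
    using assms unfolding eq integral_count_space_eq_UNIV(2)[where I="Sigma I J"] .
  have "(\<integral>p. F (fst p) (snd p) \<partial>count_space (Sigma I J)) = (\<integral>p. ?F p \<partial>(count_space UNIV \<Otimes>\<^sub>M count_space UNIV))"
    unfolding eq by (rule integral_count_space_eq_UNIV)
  also have "\<dots> = (\<integral>i. \<integral>j. ?F (i, j) \<partial>count_space UNIV \<partial>count_space UNIV)"
    by (rule integral_fst'[OF int, symmetric])
  also have "\<dots> = (\<integral>i. indicator I i * (\<integral>j. indicator (J i) j * F i j \<partial>count_space UNIV) \<partial>count_space UNIV)"
    by (intro Bochner_Integration.integral_cong) (auto simp: indicator_def)
  also have "\<dots> = (\<integral>i. \<integral>j. F i j \<partial>count_space (J i) \<partial>count_space I)"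
    by (simp only: integral_count_space_eq_UNIV(1)[symmetric])
  finally show ?thesis .
qed

section \<open>Cutting a genealogy at its ancestor\<close>

text \<open>Labels grow at the front, so the last entry of a label names the child of the ancestor
  through which the individual descends.\<close>

definition subtree :: "'a genealogy \<Rightarrow> nat \<Rightarrow> 'a genealogy" where
  "subtree c i = (\<lambda>u. c (u @ [i]))"

text \<open>The individuals of generation less than \<open>L\<close>; for \<open>L = \<infinity>\<close> this is the whole cluster.\<close>

definition individuals :: "enat \<Rightarrow> 'a genealogy \<Rightarrow> nat list set" where
  "individuals L c = {u. alive c u \<and> enat (length u) < L}"

definition tree_nn :: "enat \<Rightarrow> ('a::{topological_space,monoid_add} \<Rightarrow> ennreal) \<Rightarrow> 'a \<Rightarrow> 'a genealogy \<Rightarrow> ennreal" where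
  "tree_nn L g z c = (\<integral>\<^sup>+u. g (z + position c u) \<partial>count_space (individuals L c))"

text \<open>Bochner integrals give the value 0 when the sum is not absolutely convergent; statements
  about \<open>tree_sum\<close> that split or pass to limits therefore assume that the corresponding
  \<open>tree_nn\<close> is finite.\<close>

definition tree_sum :: "enat \<Rightarrow> ('a::{topological_space,monoid_add} \<Rightarrow> real) \<Rightarrow> 'a \<Rightarrow> 'a genealogy \<Rightarrow> real" where
  "tree_sum L f z c = (\<integral>u. f (z + position c u) \<partial>count_space (individuals L c))"

lemma alive_append: "alive c (u @ [i]) \<longleftrightarrow> i \<in> indices (c []) \<and> alive (subtree c i) u"
  by (induction u) (auto simp: subtree_def)

lemma position_append:
  "position c (u @ [i]) = snd (c []) i + position (subtree c i) u"
  by (induction u) (auto simp: subtree_def add.assoc)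

text \<open>Every individual except the ancestor belongs to the subtree of exactly one child, where
  its generation is lower by one. Because \<open>eSuc \<infinity> = \<infinity>\<close>, the whole
  cluster is covered too.\<close>

lemma bij_betw_individuals:
  "bij_betw (\<lambda>(i, u). u @ [i]) (SIGMA i:indices (c []). individuals L (subtree c i)) (individuals (eSuc L) c - {[]})"
  unfolding bij_betw_def
proof
  show "inj_on (\<lambda>(i, u). u @ [i]) (SIGMA i:indices (c []). individuals L (subtree c i))"
    by (auto simp: inj_on_def)
  have *: "u @ [i] \<in> individuals (eSuc L) c \<longleftrightarrow> i \<in> indices (c []) \<and> u \<in> individuals L (subtree c i)" for u i
  proof -
    have "enat (Suc l) < eSuc L \<longleftrightarrow> enat l < L" for l
      by (cases L) (auto simp: eSuc_enat)
    then show ?thesis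
      by (auto simp: individuals_def alive_append)
  qed
  show "(\<lambda>(i, u). u @ [i]) ` (SIGMA i:indices (c []). individuals L (subtree c i)) = individuals (eSuc L) c - {[]}"
  proof (intro equalityI subsetI)
    fix v assume v: "v \<in> individuals (eSuc L) c - {[]}"
    then obtain u i where "v = u @ [i]"
      by (cases v rule: rev_cases) auto
    then show "v \<in> (\<lambda>(i, u). u @ [i]) ` (SIGMA i:indices (c []). individuals L (subtree c i))"
      using v * by force
  qed (auto simp: *)
qed

lemma root_individual: "[] \<in> individuals (eSuc L) c"
  by (simp add: individuals_def zero_enat_def[symmetric])

lemma nn_integral_count_space_remove:
  assumes "a \<in> A"
  shows "(\<integral>\<^sup>+x. h x \<partial>count_space A) = h a + (\<integral>\<^sup>+x. h x \<partial>count_space (A - {a}))"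
proof -
  have "(\<integral>\<^sup>+x. h x \<partial>count_space A) = (\<integral>\<^sup>+x. h x * indicator {a} x + h x * indicator (A - {a}) x \<partial>count_space UNIV)"
    using assms by (subst nn_integral_count_space_indicator) (auto intro!: nn_integral_cong simp: indicator_def)
  also have "\<dots> = h a + (\<integral>\<^sup>+x. h x \<partial>count_space (A - {a}))"
    by (subst nn_integral_add) (simp_all add: nn_integral_count_space_indicator nn_integral_indicator_finite)
  finally show ?thesis .
qed

lemma integral_count_space_remove:
  fixes h :: "'i \<Rightarrow> real"
  assumes "a \<in> A" and "integrable (count_space (A - {a})) h"
  shows "(\<integral>x. h x \<partial>count_space A) = h a + (\<integral>x. h x \<partial>count_space (A - {a}))"
proof -
  have "(\<integral>x. h x \<partial>count_space A) = (\<integral>x. indicator {a} x * h x + indicator (A - {a}) x * h x \<partial>count_space UNIV)"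
    unfolding integral_count_space_eq_UNIV(1)[where I=A] using assms
    by (intro Bochner_Integration.integral_cong) (auto simp: indicator_def)
  also have "\<dots> = (\<integral>x. indicator {a} x * h x \<partial>count_space UNIV) + (\<integral>x. indicator (A - {a}) x * h x \<partial>count_space UNIV)"
  proof (rule Bochner_Integration.integral_add)
    show "integrable (count_space UNIV) (\<lambda>x. indicator {a} x * h x)"
      unfolding integral_count_space_eq_UNIV(2)[symmetric] by (rule integrable_count_space) simp
    show "integrable (count_space UNIV) (\<lambda>x. indicator (A - {a}) x * h x)"
      using assms(2) unfolding integral_count_space_eq_UNIV(2)[where I="A - {a}"] .
  qed
  also have "(\<integral>x. indicator {a} x * h x \<partial>count_space UNIV) = h a"
    unfolding integral_count_space_eq_UNIV(1)[symmetric] by (simp add: lebesgue_integral_count_space_finite)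
  finally show ?thesis
    unfolding integral_count_space_eq_UNIV(1)[where I="A - {a}"] .
qed

lemma tree_nn_eSuc:
  fixes z :: "'a::{topological_space,monoid_add}"
  shows "tree_nn (eSuc L) g z c = g z +
    (\<integral>\<^sup>+i. tree_nn L g (z + snd (c []) i) (subtree c i) \<partial>count_space (indices (c [])))"
proof -
  let ?S = "SIGMA i:indices (c []). individuals L (subtree c i)"
  let ?h = "\<lambda>u. g (z + position c u)"
  have "tree_nn (eSuc L) g z c = g z + (\<integral>\<^sup>+u. ?h u \<partial>count_space (individuals (eSuc L) c - {[]}))"
    unfolding tree_nn_def by (subst nn_integral_count_space_remove[OF root_individual]) simp
  also have "(\<integral>\<^sup>+u. ?h u \<partial>count_space (individuals (eSuc L) c - {[]})) =
      (\<integral>\<^sup>+p. ?h ((\<lambda>(i, u). u @ [i]) p) \<partial>count_space ?S)"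
    by (rule nn_integral_bij_count_space[OF bij_betw_individuals, symmetric])
  also have "\<dots> = (\<integral>\<^sup>+p. g (z + snd (c []) (fst p) + position (subtree c (fst p)) (snd p)) \<partial>count_space ?S)"
    by (simp add: case_prod_beta position_append add.assoc)
  also have "\<dots> = (\<integral>\<^sup>+i. tree_nn L g (z + snd (c []) i) (subtree c i) \<partial>count_space (indices (c [])))"
    unfolding tree_nn_def
    by (rule nn_integral_count_space_Sigma[where F="\<lambda>i u. g (z + snd (c []) i + position (subtree c i) u)"])
  finally show ?thesis .
qed

lemma tree_sum_integrable:
  assumes "tree_nn L (\<lambda>x. ennreal \<bar>f x\<bar>) z c < \<infinity>"
  shows "integrable (count_space (individuals L c)) (\<lambda>u. f (z + position c u))"
  using assms by (intro integrableI_bounded) (simp_all add: tree_nn_def)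

text \<open>Finiteness of the absolute sum justifies splitting off the ancestor and applying Fubini
  to the pairs of a child and an individual in its subtree.\<close>

lemma tree_sum_eSuc:
  fixes z :: "'a::{topological_space,monoid_add}"
  assumes "tree_nn (eSuc L) (\<lambda>x. ennreal \<bar>f x\<bar>) z c < \<infinity>"
  shows "tree_sum (eSuc L) f z c = f z +
    (\<integral>i. tree_sum L f (z + snd (c []) i) (subtree c i) \<partial>count_space (indices (c [])))"
proof -
  let ?S = "SIGMA i:indices (c []). individuals L (subtree c i)"
  let ?h = "\<lambda>u. f (z + position c u)"
  let ?F = "\<lambda>i u. f (z + snd (c []) i + position (subtree c i) u)"
  have "integrable (count_space (individuals (eSuc L) c)) ?h"
    by (rule tree_sum_integrable[OF assms])
  then have "integrable (count_space UNIV) (\<lambda>u. indicator (individuals (eSuc L) c) u * ?h u)"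
    unfolding integral_count_space_eq_UNIV(2)[where I="individuals (eSuc L) c"] .
  then have "integrable (count_space UNIV) (\<lambda>u. indicator (individuals (eSuc L) c - {[]}) u * ?h u)"
    by (rule Bochner_Integration.integrable_bound) (auto simp: indicator_def)
  then have int: "integrable (count_space (individuals (eSuc L) c - {[]})) ?h"
    unfolding integral_count_space_eq_UNIV(2)[where I="individuals (eSuc L) c - {[]}"] .
  have F: "?h ((\<lambda>(i, u). u @ [i]) p) = ?F (fst p) (snd p)" for p
    by (simp add: case_prod_beta position_append add.assoc)
  have intS: "integrable (count_space ?S) (\<lambda>p. ?F (fst p) (snd p))"
    using integrable_bij_count_space[OF bij_betw_individuals[of c L], of ?h] int
    unfolding F by simp
  have "tree_sum (eSuc L) f z c = f z + (\<integral>u. ?h u \<partial>count_space (individuals (eSuc L) c - {[]}))"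
    unfolding tree_sum_def by (subst integral_count_space_remove[OF root_individual int]) simp
  also have "(\<integral>u. ?h u \<partial>count_space (individuals (eSuc L) c - {[]})) = (\<integral>p. ?F (fst p) (snd p) \<partial>count_space ?S)"
    using integral_bij_count_space[OF bij_betw_individuals[of c L], of ?h] unfolding F by simp
  also have "\<dots> = (\<integral>i. tree_sum L f (z + snd (c []) i) (subtree c i) \<partial>count_space (indices (c [])))"
    unfolding tree_sum_def by (rule integral_count_space_Sigma[OF intS])
  finally show ?thesis .
qed

lemma tree_sum_0 [simp]: "tree_sum 0 f z c = 0" and tree_nn_0 [simp]: "tree_nn 0 g z c = 0"
  by (simp_all add: tree_sum_def tree_nn_def individuals_def lebesgue_integral_count_space_finite nn_integral_count_space_finite zero_enat_def[symmetric])

lemma finite_individuals: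
  assumes "\<And>u. finite (indices (c u))"
  shows "finite (individuals (enat N) c)"
  using assms
proof (induction N arbitrary: c)
  case 0
  show ?case by (simp add: individuals_def zero_enat_def[symmetric])
next
  case (Suc N)
  have "finite (SIGMA i:indices (c []). individuals (enat N) (subtree c i))"
    using Suc by (intro finite_SigmaI Suc.IH) (auto simp: subtree_def)
  then have "finite (individuals (eSuc (enat N)) c - {[]})"
    using bij_betw_finite[OF bij_betw_individuals[of c "enat N"]] by simp
  then show ?case by (simp add: eSuc_enat)
qed

lemma tree_nn_abs_finite:
  assumes "\<And>u. finite (indices (c u))"
  shows "tree_nn (enat N) (\<lambda>x. ennreal \<bar>f x\<bar>) z c < \<infinity>"
  unfolding tree_nn_def using finite_individuals[OF assms, of N]
  by (simp add: nn_integral_count_space_finite)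

lemma tree_nn_mono:
  assumes "L \<le> L'"
  shows "tree_nn L g z c \<le> tree_nn L' g z c"
proof -
  have "individuals L c \<subseteq> individuals L' c"
    using assms by (auto simp: individuals_def)
  then show ?thesis
    unfolding tree_nn_def by (simp add: nn_integral_count_space_indicator)
      (auto intro!: nn_integral_mono simp: indicator_def)
qed

lemma individuals_tendsto: "(\<lambda>N. indicator (individuals (enat N) c) u :: real) \<longlonglongrightarrow> indicator (individuals \<infinity> c) u"
proof (rule tendsto_eventually, rule eventually_sequentiallyI)
  fix N assume "Suc (length u) \<le> N"
  then show "indicator (individuals (enat N) c) u = (indicator (individuals \<infinity> c) u :: real)"
    by (auto simp: individuals_def indicator_def)
qed

lemma tree_nn_tendsto: "(\<lambda>N. tree_nn (enat N) g z c) \<longlonglongrightarrow> tree_nn \<infinity> g z c"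
proof -
  have "(\<lambda>N. \<integral>\<^sup>+u. g (z + position c u) * ennreal (indicator (individuals (enat N) c) u) \<partial>count_space UNIV)
      \<longlonglongrightarrow> (\<integral>\<^sup>+u. g (z + position c u) * ennreal (indicator (individuals \<infinity> c) u) \<partial>count_space UNIV)"
  proof (rule nn_integral_LIMSEQ)
    show "mono (\<lambda>N u. g (z + position c u) * ennreal (indicator (individuals (enat N) c) u))"
      by (auto simp: mono_def le_fun_def individuals_def indicator_def)
    show "(\<lambda>N. g (z + position c u) * ennreal (indicator (individuals (enat N) c) u))
      \<longlonglongrightarrow> g (z + position c u) * ennreal (indicator (individuals \<infinity> c) u)" for u
    proof (rule tendsto_eventually, rule eventually_sequentiallyI)
      fix N assume "Suc (length u) \<le> N"
      then show "g (z + position c u) * ennreal (indicator (individuals (enat N) c) u) =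
        g (z + position c u) * ennreal (indicator (individuals \<infinity> c) u)"
        by (auto simp: individuals_def indicator_def)
    qed
  qed simp
  then show ?thesis
    unfolding tree_nn_def by (simp add: nn_integral_count_space_indicator ennreal_indicator)
qed

lemma tree_sum_tendsto:
  assumes "tree_nn \<infinity> (\<lambda>x. ennreal \<bar>f x\<bar>) z c < \<infinity>"
  shows "(\<lambda>N. tree_sum (enat N) f z c) \<longlonglongrightarrow> tree_sum \<infinity> f z c"
  unfolding tree_sum_def integral_count_space_eq_UNIV(1)[where I="individuals _ c"]
proof (rule integral_dominated_convergence)
  show "integrable (count_space UNIV) (\<lambda>u. \<bar>indicator (individuals \<infinity> c) u * f (z + position c u)\<bar>)"
    using tree_sum_integrable[OF assms] unfolding integral_count_space_eq_UNIV(2)[where I="individuals \<infinity> c"]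
    by (intro integrable_abs)
  show "AE u in count_space UNIV. norm (indicator (individuals (enat N) c) u * f (z + position c u))
      \<le> \<bar>indicator (individuals \<infinity> c) u * f (z + position c u)\<bar>" for N
    by (auto simp: indicator_def individuals_def)
  show "AE u in count_space UNIV. (\<lambda>N. indicator (individuals (enat N) c) u * f (z + position c u))
      \<longlonglongrightarrow> indicator (individuals \<infinity> c) u * f (z + position c u)"
    by (intro AE_I2 tendsto_mult individuals_tendsto tendsto_const)
qed auto

lemma abs_tree_sum_le:
  assumes "tree_nn L (\<lambda>x. ennreal \<bar>f x\<bar>) z c < \<infinity>"
  shows "ennreal \<bar>tree_sum L f z c\<bar> \<le> tree_nn L (\<lambda>x. ennreal \<bar>f x\<bar>) z c"
    and "ennreal (tree_sum L (\<lambda>x. \<bar>f x\<bar>) z c) = tree_nn L (\<lambda>x. ennreal \<bar>f x\<bar>) z c"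
proof -
  have int: "integrable (count_space (individuals L c)) (\<lambda>u. \<bar>f (z + position c u)\<bar>)"
    by (intro integrable_abs tree_sum_integrable assms)
  then show eq: "ennreal (tree_sum L (\<lambda>x. \<bar>f x\<bar>) z c) = tree_nn L (\<lambda>x. ennreal \<bar>f x\<bar>) z c"
    unfolding tree_sum_def tree_nn_def by (intro nn_integral_eq_integral[symmetric]) auto
  have "\<bar>tree_sum L f z c\<bar> \<le> tree_sum L (\<lambda>x. \<bar>f x\<bar>) z c"
    unfolding tree_sum_def by (rule integral_abs_bound)
  then show "ennreal \<bar>tree_sum L f z c\<bar> \<le> tree_nn L (\<lambda>x. ennreal \<bar>f x\<bar>) z c"
    unfolding eq[symmetric] by (rule ennreal_leI)
qed

section \<open>Measurability of sums over genealogies\<close>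

definition genealogy_space :: "'a::topological_space genealogy measure" where
  "genealogy_space = (\<Pi>\<^sub>M u\<in>UNIV. enum_space)"

lemma measurable_genealogy [measurable]: "(\<lambda>c. c u) \<in> measurable genealogy_space enum_space"
  unfolding genealogy_space_def by (rule measurable_component_singleton) simp

lemma measurable_alive [measurable]: "Measurable.pred genealogy_space (\<lambda>c. alive c u)"
proof (induction u)
  case (Cons i u)
  have [measurable]: "Measurable.pred genealogy_space (\<lambda>c. i \<in> indices (c u))"
    using measurable_compose[OF measurable_genealogy measurable_indices] .
  show ?case using Cons by simp
qed simp

lemma measurable_position [measurable]:
  "(\<lambda>c. position c u :: 'a::euclidean_space) \<in> borel_measurable genealogy_space"
proof (induction u)
  case (Cons i u)
  have [measurable]: "(\<lambda>c. snd (c u) i :: 'a) \<in> borel_measurable genealogy_space"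
    using measurable_compose[OF measurable_genealogy measurable_enum_space_point] .
  show ?case using Cons by simp
qed simp

lemma measurable_individuals [measurable]: "Measurable.pred genealogy_space (\<lambda>c. u \<in> individuals L c)"
  unfolding individuals_def by simp

lemma measurable_tree_nn:
  fixes f :: "'a::euclidean_space \<Rightarrow> ennreal"
  assumes [measurable]: "f \<in> borel_measurable borel"
  shows "(\<lambda>(z, c). tree_nn L f z c) \<in> borel_measurable (borel \<Otimes>\<^sub>M genealogy_space)"
proof -
  have [measurable]: "Measurable.pred (borel \<Otimes>\<^sub>M genealogy_space) (\<lambda>p :: 'a \<times> _. u \<in> individuals L (snd p))" for u
    using measurable_compose[OF measurable_snd measurable_individuals] .
  have [measurable]: "(\<lambda>p :: 'a \<times> 'a genealogy. position (snd p) u) \<in> borel_measurable (borel \<Otimes>\<^sub>M genealogy_space)" for u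
    using measurable_compose[OF measurable_snd measurable_position] .
  show ?thesis
    unfolding tree_nn_def case_prod_beta by (intro borel_measurable_count_space_nn_integral) measurable
qed

lemma measurable_tree_sum:
  fixes f :: "'a::euclidean_space \<Rightarrow> real"
  assumes [measurable]: "f \<in> borel_measurable borel"
  shows "(\<lambda>(z, c). tree_sum L f z c) \<in> borel_measurable (borel \<Otimes>\<^sub>M genealogy_space)"
proof -
  have [measurable]: "Measurable.pred (borel \<Otimes>\<^sub>M genealogy_space) (\<lambda>p :: 'a \<times> _. u \<in> individuals L (snd p))" for u
    using measurable_compose[OF measurable_snd measurable_individuals] .
  have [measurable]: "(\<lambda>p :: 'a \<times> 'a genealogy. position (snd p) u) \<in> borel_measurable (borel \<Otimes>\<^sub>M genealogy_space)" for u
    using measurable_compose[OF measurable_snd measurable_position] .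
  show ?thesis
    unfolding tree_sum_def case_prod_beta by (intro borel_measurable_count_space_integral) measurable
qed

section \<open>The law of cluster sums\<close>

context
  fixes M :: "'w measure" and \<gamma> :: "'a::euclidean_space measure" and \<eta> :: "nat list \<Rightarrow> 'w \<Rightarrow> 'a enumeration"
  assumes M: "prob_space M" and \<gamma>: "sets \<gamma> = sets borel" and fam: "branching_family M \<gamma> \<eta>"
begin

interpretation prob_space M by (rule M)

text \<open>The branching property: the offspring of the ancestor form a Poisson process whose marks
  are the genealogies of the children, and each of these is again a branching family with the same
  \<open>\<gamma>\<close>.\<close>

lemma branching_marked_poisson: "marked_poisson M \<gamma> (\<eta> []) genealogy_space (\<lambda>i \<omega> u. \<eta> (u @ [i]) \<omega>)"
  and branching_family_subtree: "branching_family M \<gamma> (\<lambda>u. \<eta> (u @ [i]))"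
proof -
  have pp: "poisson_process M \<gamma> (\<eta> u)" for u
    using fam by (simp add: branching_family_def)
  have ind: "indep_vars (\<lambda>_. enum_space) \<eta> UNIV"
    using fam by (simp add: branching_family_def)
  have b: "inj (case_prod (\<lambda>i u. u @ [i]))"
    by (auto simp: inj_on_def)
  note br = indep_vars_branches[OF ind b, of "[]", simplified]
  show "marked_poisson M \<gamma> (\<eta> []) genealogy_space (\<lambda>i \<omega> u. \<eta> (u @ [i]) \<omega>)"
    using pp br(1,2) \<gamma> by unfold_locales (simp_all add: genealogy_space_def)
  show "branching_family M \<gamma> (\<lambda>u. \<eta> (u @ [i]))"
    using pp br(3) by (simp add: branching_family_def)
qed

lemma measurable_family: "\<eta> u \<in> measurable M enum_space"
  using fam by (simp add: branching_family_def poisson_process_def)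

lemma measurable_family_genealogy: "(\<lambda>\<omega> u. \<eta> u \<omega>) \<in> measurable M genealogy_space"
  unfolding genealogy_space_def
  by (rule measurable_PiM_single') (auto intro: measurable_family)

lemma measurable_family_comp:
  assumes [measurable]: "(\<lambda>(z, c). F z c) \<in> measurable (borel \<Otimes>\<^sub>M genealogy_space) N"
  shows "(\<lambda>(z, \<omega>). F z (\<lambda>u. \<eta> u \<omega>)) \<in> measurable (borel \<Otimes>\<^sub>M M) N"
    and "(\<lambda>\<omega>. F z (\<lambda>u. \<eta> u \<omega>)) \<in> measurable M N"
proof -
  note [measurable] = measurable_family_genealogy
  have "(\<lambda>p. (\<lambda>(z, c). F z c) (fst p, (\<lambda>\<omega> u. \<eta> u \<omega>) (snd p))) \<in> measurable (borel \<Otimes>\<^sub>M M) N"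
    by measurable
  then show "(\<lambda>(z, \<omega>). F z (\<lambda>u. \<eta> u \<omega>)) \<in> measurable (borel \<Otimes>\<^sub>M M) N"
    by (simp add: case_prod_beta)
  have "(\<lambda>\<omega>. (\<lambda>(z, c). F z c) (z, (\<lambda>\<omega> u. \<eta> u \<omega>) \<omega>)) \<in> measurable M N"
    by measurable
  then show "(\<lambda>\<omega>. F z (\<lambda>u. \<eta> u \<omega>)) \<in> measurable M N"
    by simp
qed

lemmas measurable_family_tree_sum = measurable_family_comp[OF measurable_tree_sum]

lemmas measurable_family_tree_nn = measurable_family_comp[OF measurable_tree_nn]

lemma AE_finite_offspring:
  assumes "emeasure \<gamma> UNIV < \<infinity>"
  shows "AE \<omega> in M. \<forall>u. finite (indices (\<eta> u \<omega>))"
proof (subst AE_all_countable, intro allI)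
  fix u
  have "poisson_process M \<gamma> (\<eta> u)"
    using fam by (simp add: branching_family_def)
  then have "AE \<omega> in M. finite (hits (\<eta> u \<omega>) UNIV)"
    by (rule poisson_process_finite_hits) (use assms in simp_all)
  then show "AE \<omega> in M. finite (indices (\<eta> u \<omega>))"
    by (simp add: hits_def)
qed

end

text \<open>The characteristic function of the sum over the first \<open>N\<close> generations.\<close>

primrec tree_char :: "'a::euclidean_space measure \<Rightarrow> ('a \<Rightarrow> real) \<Rightarrow> real \<Rightarrow> nat \<Rightarrow> 'a \<Rightarrow> complex" where
  "tree_char \<gamma> f t 0 z = 1"
| "tree_char \<gamma> f t (Suc N) z = exp (\<i> * of_real (t * f z)) * exp (\<integral>x. tree_char \<gamma> f t N (z + x) - 1 \<partial>\<gamma>)"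

text \<open>The induction ranges over all branching families at once. The families of different
  children may have different laws as enumerations, yet the induction hypothesis gives all of them
  the same \<open>tree_char\<close>, and this is exactly the index-free mean that
  \<open>functional\<close> requires.\<close>

lemma tree_char_eq:
  fixes \<gamma> :: "'a::euclidean_space measure"
  assumes "prob_space M" and \<gamma>: "sets \<gamma> = sets borel" "emeasure \<gamma> UNIV < \<infinity>" and "branching_family M \<gamma> \<eta>"
    and f: "f \<in> borel_measurable borel"
  shows "(\<integral>\<omega>. exp (\<i> * of_real (t * tree_sum (enat N) f z (\<lambda>u. \<eta> u \<omega>))) \<partial>M) = tree_char \<gamma> f t N z"
  using assms(4)
proof (induction N arbitrary: \<eta> z)
  case 0
  interpret prob_space M by fact
  show ?case by (simp add: zero_enat_def[symmetric] prob_space)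
next
  case (Suc N)
  interpret marked_poisson M \<gamma> "\<eta> []" genealogy_space "\<lambda>i \<omega> u. \<eta> (u @ [i]) \<omega>"
    by (rule branching_marked_poisson[OF assms(1) \<gamma>(1) Suc.prems])
  note [measurable] = measurable_tree_sum[OF f]
  let ?Z = "\<lambda>x c. exp (\<i> * of_real (t * tree_sum (enat N) f (z + x) c))"
  let ?e = "exp (\<i> * of_real (t * f z))"
  have "(\<integral>\<omega>. exp (\<i> * of_real (t * tree_sum (enat (Suc N)) f z (\<lambda>u. \<eta> u \<omega>))) \<partial>M) =
      (\<integral>\<omega>. ?e * (\<Prod>i\<in>hits (\<eta> [] \<omega>) UNIV. ?Z (snd (\<eta> [] \<omega>) i) (\<lambda>u. \<eta> (u @ [i]) \<omega>)) \<partial>M)"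
  proof (rule integral_cong_AE)
    show "AE \<omega> in M. exp (\<i> * of_real (t * tree_sum (enat (Suc N)) f z (\<lambda>u. \<eta> u \<omega>))) =
        ?e * (\<Prod>i\<in>hits (\<eta> [] \<omega>) UNIV. ?Z (snd (\<eta> [] \<omega>) i) (\<lambda>u. \<eta> (u @ [i]) \<omega>))"
      using AE_finite_offspring[OF assms(1) \<gamma>(1) Suc.prems \<gamma>(2)]
    proof eventually_elim
      case (elim \<omega>)
      have fin: "tree_nn (eSuc (enat N)) (\<lambda>x. ennreal \<bar>f x\<bar>) z (\<lambda>u. \<eta> u \<omega>) < \<infinity>"
        unfolding eSuc_enat using elim by (intro tree_nn_abs_finite) auto
      have "tree_sum (enat (Suc N)) f z (\<lambda>u. \<eta> u \<omega>) =
          f z + (\<Sum>i\<in>indices (\<eta> [] \<omega>). tree_sum (enat N) f (z + snd (\<eta> [] \<omega>) i) (\<lambda>u. \<eta> (u @ [i]) \<omega>))"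
        using tree_sum_eSuc[OF fin] elim
        by (simp add: eSuc_enat subtree_def lebesgue_integral_count_space_finite)
      then show ?case
        using elim by (simp add: hits_def distrib_left exp_add exp_sum sum_distrib_left)
    qed
    note m[measurable] = measurable_family_tree_sum(2)[OF assms(1) \<gamma>(1) Suc.prems f]
    show "(\<lambda>\<omega>. exp (\<i> * of_real (t * tree_sum (enat (Suc N)) f z (\<lambda>u. \<eta> u \<omega>)))) \<in> borel_measurable M"
      by measurable
    have [measurable]: "(\<lambda>\<omega>. tree_sum (enat N) f (z + snd (\<eta> [] \<omega>) i) (\<lambda>u. \<eta> (u @ [i]) \<omega>)) \<in> borel_measurable M" for i
    proof -
      have "(\<lambda>\<omega>. (\<lambda>(z, c). tree_sum (enat N) f z c) (z + snd (\<eta> [] \<omega>) i, \<lambda>u. \<eta> (u @ [i]) \<omega>)) \<in> borel_measurable M"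
        using measurable_R[of i] by measurable
      then show ?thesis by simp
    qed
    show "(\<lambda>\<omega>. ?e * (\<Prod>i\<in>hits (\<eta> [] \<omega>) UNIV. ?Z (snd (\<eta> [] \<omega>) i) (\<lambda>u. \<eta> (u @ [i]) \<omega>))) \<in> borel_measurable M"
      by (intro borel_measurable_times measurable_prod_hits) measurable
  qed
  also have "\<dots> = ?e * (\<integral>\<omega>. (\<Prod>i\<in>hits (\<eta> [] \<omega>) UNIV. ?Z (snd (\<eta> [] \<omega>) i) (\<lambda>u. \<eta> (u @ [i]) \<omega>)) \<partial>M)"
    by simp
  also have "(\<integral>\<omega>. (\<Prod>i\<in>hits (\<eta> [] \<omega>) UNIV. ?Z (snd (\<eta> [] \<omega>) i) (\<lambda>u. \<eta> (u @ [i]) \<omega>)) \<partial>M) =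
      exp (\<integral>x. tree_char \<gamma> f t N (z + x) - 1 \<partial>\<gamma>)"
  proof (rule functional[where C=1])
    have "(\<lambda>p. exp (\<i> * of_real (t * (\<lambda>(z, c). tree_sum (enat N) f z c) (z + fst p, snd p)))) \<in>
        borel_measurable (borel \<Otimes>\<^sub>M genealogy_space)"
      by measurable
    then show "(\<lambda>(x, c). ?Z x c) \<in> borel_measurable (borel \<Otimes>\<^sub>M genealogy_space)"
      by (simp add: case_prod_beta)
    show "(\<integral>\<omega>. ?Z x (\<lambda>u. \<eta> (u @ [i]) \<omega>) \<partial>M) = tree_char \<gamma> f t N (z + x)" for i x
      by (rule Suc.IH[OF branching_family_subtree[OF assms(1) \<gamma>(1) Suc.prems]])
  qed (use \<gamma>(2) in \<open>simp_all add: norm_exp_i_times\<close>)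
  finally show ?case by simp
qed

text \<open>The characteristic function of the whole cluster sum is a limit of quantities that do
  not involve the family, which makes its law independent of the chosen family.\<close>

lemma tree_char_tendsto:
  fixes \<gamma> :: "'a::euclidean_space measure"
  assumes M: "prob_space M" and \<gamma>: "sets \<gamma> = sets borel" "emeasure \<gamma> UNIV < \<infinity>" and fam: "branching_family M \<gamma> \<eta>"
    and f: "f \<in> borel_measurable borel"
    and fin: "AE \<omega> in M. tree_nn \<infinity> (\<lambda>x. ennreal \<bar>f x\<bar>) z (\<lambda>u. \<eta> u \<omega>) < \<infinity>"
  shows "(\<lambda>N. tree_char \<gamma> f t N z) \<longlonglongrightarrow> (\<integral>\<omega>. exp (\<i> * of_real (t * tree_sum \<infinity> f z (\<lambda>u. \<eta> u \<omega>))) \<partial>M)"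
  unfolding tree_char_eq[OF M \<gamma> fam f, symmetric]
proof (rule integral_dominated_convergence[where w="\<lambda>_. 1"])
  interpret prob_space M by (rule M)
  note [measurable] = measurable_family_tree_sum(2)[OF M \<gamma>(1) fam f]
  show "(\<lambda>\<omega>. exp (\<i> * of_real (t * tree_sum \<infinity> f z (\<lambda>u. \<eta> u \<omega>)))) \<in> borel_measurable M"
    "(\<lambda>\<omega>. exp (\<i> * of_real (t * tree_sum (enat N) f z (\<lambda>u. \<eta> u \<omega>)))) \<in> borel_measurable M" for N
    by measurable
  show "AE \<omega> in M. (\<lambda>N. exp (\<i> * of_real (t * tree_sum (enat N) f z (\<lambda>u. \<eta> u \<omega>)))) \<longlonglongrightarrow>
      exp (\<i> * of_real (t * tree_sum \<infinity> f z (\<lambda>u. \<eta> u \<omega>)))"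
    using fin by eventually_elim (intro tendsto_intros tree_sum_tendsto)
  show "integrable M (\<lambda>_. 1)" by simp
qed (auto simp: norm_exp_i_times simp del: of_real_mult)

section \<open>Equality in law of cluster sums built from different families\<close>

lemma distr_eqI_char:
  fixes X :: "'w \<Rightarrow> real" and X' :: "'v \<Rightarrow> real"
  assumes M: "prob_space M" "X \<in> borel_measurable M" and M': "prob_space M'" "X' \<in> borel_measurable M'"
    and eq: "\<And>t. (\<integral>\<omega>. exp (\<i> * of_real (t * X \<omega>)) \<partial>M) = (\<integral>\<omega>. exp (\<i> * of_real (t * X' \<omega>)) \<partial>M')"
  shows "distr M borel X = distr M' borel X'"
proof (rule Levy_uniqueness)
  show "real_distribution (distr M borel X)" "real_distribution (distr M' borel X')"
    using assms by (auto intro: prob_space.real_distribution_distr)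
  show "char (distr M borel X) = char (distr M' borel X')"
    using M(2) M'(2) eq by (auto simp: fun_eq_iff char_def integral_distr)
qed

lemma integral_cong_distr:
  fixes h :: "'c::topological_space \<Rightarrow> 'e::{banach, second_countable_topology}"
  assumes "distr M borel X = distr M' borel X'" and "X \<in> borel_measurable M" "X' \<in> borel_measurable M'"
    and "h \<in> borel_measurable borel"
  shows "(\<integral>\<omega>. h (X \<omega>) \<partial>M) = (\<integral>\<omega>. h (X' \<omega>) \<partial>M')"
    and "integrable M (\<lambda>\<omega>. h (X \<omega>)) \<longleftrightarrow> integrable M' (\<lambda>\<omega>. h (X' \<omega>))"
  using assms by (auto simp: integral_distr[symmetric] integrable_distr_eq[symmetric])

lemma nn_integral_cong_distr:
  assumes "distr M borel X = distr M' borel X'" and "X \<in> borel_measurable M" "X' \<in> borel_measurable M'"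
    and "h \<in> borel_measurable borel"
  shows "(\<integral>\<^sup>+\<omega>. h (X \<omega>) \<partial>M) = (\<integral>\<^sup>+\<omega>. h (X' \<omega>) \<partial>M')"
  using assms by (auto simp: nn_integral_distr[symmetric])

lemma nn_integral_tree_nn_tendsto:
  fixes \<gamma> :: "'a::euclidean_space measure"
  assumes M: "prob_space M" "branching_family M \<gamma> \<eta>" and \<gamma>: "sets \<gamma> = sets borel"
    and g: "g \<in> borel_measurable borel"
  shows "(\<lambda>N. \<integral>\<^sup>+\<omega>. tree_nn (enat N) g z (\<lambda>u. \<eta> u \<omega>) ^ n \<partial>M) \<longlonglongrightarrow> (\<integral>\<^sup>+\<omega>. tree_nn \<infinity> g z (\<lambda>u. \<eta> u \<omega>) ^ n \<partial>M)"
proof (rule nn_integral_LIMSEQ)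
  show "(\<lambda>\<omega>. tree_nn (enat N) g z (\<lambda>u. \<eta> u \<omega>) ^ n) \<in> borel_measurable M" for N
    by (intro borel_measurable_power_ennreal measurable_family_tree_nn(2)[OF M(1) \<gamma> M(2) g])
  show "mono (\<lambda>N \<omega>. tree_nn (enat N) g z (\<lambda>u. \<eta> u \<omega>) ^ n)"
    by (intro monoI le_funI power_mono tree_nn_mono) auto
  show "(\<lambda>N. tree_nn (enat N) g z (\<lambda>u. \<eta> u \<omega>) ^ n) \<longlonglongrightarrow> tree_nn \<infinity> g z (\<lambda>u. \<eta> u \<omega>) ^ n" for \<omega>
    by (intro tendsto_power_ennreal tree_nn_tendsto)
qed

lemma nn_integral_tree_nn_eq_tree_sum:
  fixes \<gamma> :: "'a::euclidean_space measure"
  assumes M: "prob_space M" "branching_family M \<gamma> \<eta>" and \<gamma>: "sets \<gamma> = sets borel" "emeasure \<gamma> UNIV < \<infinity>"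
  shows "(\<integral>\<^sup>+\<omega>. tree_nn (enat N) (\<lambda>x. ennreal \<bar>f x\<bar>) z (\<lambda>u. \<eta> u \<omega>) ^ n \<partial>M) =
    (\<integral>\<^sup>+\<omega>. ennreal (tree_sum (enat N) (\<lambda>x. \<bar>f x\<bar>) z (\<lambda>u. \<eta> u \<omega>)) ^ n \<partial>M)"
proof (rule nn_integral_cong_AE)
  show "AE \<omega> in M. tree_nn (enat N) (\<lambda>x. ennreal \<bar>f x\<bar>) z (\<lambda>u. \<eta> u \<omega>) ^ n =
      ennreal (tree_sum (enat N) (\<lambda>x. \<bar>f x\<bar>) z (\<lambda>u. \<eta> u \<omega>)) ^ n"
    using AE_finite_offspring[OF M(1) \<gamma>(1) M(2) \<gamma>(2)]
  proof eventually_elim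
    case (elim \<omega>)
    then show ?case
      using tree_nn_abs_finite[of "\<lambda>u. \<eta> u \<omega>" N f z] by (simp add: abs_tree_sum_le(2))
  qed
qed

context
  fixes M :: "'w measure" and M' :: "'v measure" and \<gamma> :: "'a::euclidean_space measure"
    and \<eta> :: "nat list \<Rightarrow> 'w \<Rightarrow> 'a enumeration" and \<eta>' :: "nat list \<Rightarrow> 'v \<Rightarrow> 'a enumeration"
  assumes M: "prob_space M" "branching_family M \<gamma> \<eta>"
    and M': "prob_space M'" "branching_family M' \<gamma> \<eta>'"
    and \<gamma>: "sets \<gamma> = sets borel" "emeasure \<gamma> UNIV < \<infinity>"
begin

lemma distr_tree_sum_finite:
  assumes f: "f \<in> borel_measurable borel"
  shows "distr M borel (\<lambda>\<omega>. tree_sum (enat N) f z (\<lambda>u. \<eta> u \<omega>)) = distr M' borel (\<lambda>\<omega>. tree_sum (enat N) f z (\<lambda>u. \<eta>' u \<omega>))"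
  by (rule distr_eqI_char[OF M(1) measurable_family_tree_sum(2)[OF M(1) \<gamma>(1) M(2) f]
        M'(1) measurable_family_tree_sum(2)[OF M'(1) \<gamma>(1) M'(2) f]])
    (simp only: tree_char_eq[OF M(1) \<gamma> M(2) f] tree_char_eq[OF M'(1) \<gamma> M'(2) f])

text \<open>No finiteness of the whole cluster sum is available at this stage. Finitely many
  generations contain almost surely finitely many individuals, so their absolute sums are real and
  have equal laws; monotone convergence does the rest.\<close>

lemma nn_integral_tree_nn_cong:
  assumes f[measurable]: "f \<in> borel_measurable borel"
  shows "(\<integral>\<^sup>+\<omega>. tree_nn \<infinity> (\<lambda>x. ennreal \<bar>f x\<bar>) z (\<lambda>u. \<eta> u \<omega>) ^ n \<partial>M) =
    (\<integral>\<^sup>+\<omega>. tree_nn \<infinity> (\<lambda>x. ennreal \<bar>f x\<bar>) z (\<lambda>u. \<eta>' u \<omega>) ^ n \<partial>M')"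
proof -
  have abs: "(\<lambda>x. \<bar>f x\<bar>) \<in> borel_measurable borel" "(\<lambda>x. ennreal \<bar>f x\<bar>) \<in> borel_measurable borel"
    by measurable
  have eq: "(\<integral>\<^sup>+\<omega>. tree_nn (enat N) (\<lambda>x. ennreal \<bar>f x\<bar>) z (\<lambda>u. \<eta> u \<omega>) ^ n \<partial>M) =
      (\<integral>\<^sup>+\<omega>. tree_nn (enat N) (\<lambda>x. ennreal \<bar>f x\<bar>) z (\<lambda>u. \<eta>' u \<omega>) ^ n \<partial>M')" for N
    unfolding nn_integral_tree_nn_eq_tree_sum[OF M \<gamma>] nn_integral_tree_nn_eq_tree_sum[OF M' \<gamma>]
    by (rule nn_integral_cong_distr[OF distr_tree_sum_finite[OF abs(1)]
          measurable_family_tree_sum(2)[OF M(1) \<gamma>(1) M(2) abs(1)] measurable_family_tree_sum(2)[OF M'(1) \<gamma>(1) M'(2) abs(1)]]) measurable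
  show ?thesis
    using nn_integral_tree_nn_tendsto[OF M \<gamma>(1) abs(2), of z n] nn_integral_tree_nn_tendsto[OF M' \<gamma>(1) abs(2), of z n]
    unfolding eq by (rule LIMSEQ_unique)
qed

lemma distr_tree_sum_infinite:
  assumes f: "f \<in> borel_measurable borel"
    and fin: "AE \<omega> in M. tree_nn \<infinity> (\<lambda>x. ennreal \<bar>f x\<bar>) z (\<lambda>u. \<eta> u \<omega>) < \<infinity>"
    and fin': "AE \<omega> in M'. tree_nn \<infinity> (\<lambda>x. ennreal \<bar>f x\<bar>) z (\<lambda>u. \<eta>' u \<omega>) < \<infinity>"
  shows "distr M borel (\<lambda>\<omega>. tree_sum \<infinity> f z (\<lambda>u. \<eta> u \<omega>)) = distr M' borel (\<lambda>\<omega>. tree_sum \<infinity> f z (\<lambda>u. \<eta>' u \<omega>))"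
  by (rule distr_eqI_char[OF M(1) measurable_family_tree_sum(2)[OF M(1) \<gamma>(1) M(2) f]
        M'(1) measurable_family_tree_sum(2)[OF M'(1) \<gamma>(1) M'(2) f]])
    (rule LIMSEQ_unique[OF tree_char_tendsto[OF M(1) \<gamma> M(2) f fin] tree_char_tendsto[OF M'(1) \<gamma> M'(2) f fin']])

end

section \<open>Moment recursion for clusters\<close>

lemma abs_tree_sum_le': "ennreal \<bar>tree_sum L f z c\<bar> \<le> tree_nn L (\<lambda>x. ennreal \<bar>f x\<bar>) z c"
  using abs_tree_sum_le(1)[of L f z c] by (cases "tree_nn L (\<lambda>x. ennreal \<bar>f x\<bar>) z c < \<infinity>") (auto simp: not_less top_unique)

text \<open>The moment condition is imposed on one reference family; every other branching family
  with the same \<open>\<gamma>\<close> inherits it by equality in law.\<close>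

locale finite_moment_cluster =
  fixes P :: "'p measure" and \<gamma> :: "'a::euclidean_space measure"
    and \<eta> :: "nat list \<Rightarrow> 'p \<Rightarrow> 'a enumeration" and f :: "'a \<Rightarrow> real"
  assumes prob: "prob_space P" and family: "branching_family P \<gamma> \<eta>"
    and sets_\<gamma>: "sets \<gamma> = sets borel" and \<gamma>_finite: "emeasure \<gamma> UNIV < \<infinity>"
    and f_measurable: "f \<in> borel_measurable borel"
    and abs_moments: "\<And>m z. (\<integral>\<^sup>+\<omega>. tree_nn \<infinity> (\<lambda>x. ennreal \<bar>f x\<bar>) z (\<lambda>u. \<eta> u \<omega>) ^ m \<partial>P) < \<infinity>"
begin

abbreviation total :: "enat \<Rightarrow> 'a \<Rightarrow> 'a genealogy \<Rightarrow> real" where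
  "total L \<equiv> tree_sum L f"

abbreviation abs_total :: "enat \<Rightarrow> 'a \<Rightarrow> 'a genealogy \<Rightarrow> ennreal" where
  "abs_total L \<equiv> tree_nn L (\<lambda>x. ennreal \<bar>f x\<bar>)"

definition moment :: "enat \<Rightarrow> nat \<Rightarrow> 'a \<Rightarrow> real" where
  "moment L k z = (\<integral>\<omega>. total L z (\<lambda>u. \<eta> u \<omega>) ^ k \<partial>P)"

definition abs_moment :: "nat \<Rightarrow> 'a \<Rightarrow> ennreal" where
  "abs_moment k z = (\<integral>\<^sup>+\<omega>. abs_total \<infinity> z (\<lambda>u. \<eta> u \<omega>) ^ k \<partial>P)"

lemma abs_moment_finite: "abs_moment k z < \<infinity>"
  using abs_moments by (simp add: abs_moment_def)

lemma abs_f_measurable: "(\<lambda>x. ennreal \<bar>f x\<bar>) \<in> borel_measurable borel"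
  using f_measurable by measurable

lemma measurable_moment [measurable]: "moment L k \<in> borel_measurable borel"
  and measurable_abs_moment [measurable]: "abs_moment k \<in> borel_measurable borel"
proof -
  interpret prob_space P by (rule prob)
  note [measurable] = measurable_family_tree_sum(1)[OF prob sets_\<gamma> family f_measurable]
    measurable_family_tree_nn(1)[OF prob sets_\<gamma> family abs_f_measurable]
  have "(\<lambda>(z, \<omega>). (\<lambda>(z, \<omega>). total L z (\<lambda>u. \<eta> u \<omega>)) (z, \<omega>) ^ k) \<in> borel_measurable (borel \<Otimes>\<^sub>M P)"
    by measurable
  then show "moment L k \<in> borel_measurable borel"
    unfolding moment_def[abs_def] by (intro borel_measurable_lebesgue_integral) simp
  have "(\<lambda>(z, \<omega>). (\<lambda>(z, \<omega>). abs_total \<infinity> z (\<lambda>u. \<eta> u \<omega>)) (z, \<omega>) ^ k) \<in> borel_measurable (borel \<Otimes>\<^sub>M P)"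
    by measurable
  then show "abs_moment k \<in> borel_measurable borel"
    unfolding abs_moment_def[abs_def] by (intro borel_measurable_nn_integral) simp
qed

lemma abs_total_le: "ennreal (\<bar>total L z c\<bar> ^ k) \<le> abs_total \<infinity> z c ^ k"
proof -
  have "ennreal \<bar>total L z c\<bar> \<le> abs_total \<infinity> z c"
    by (rule order_trans[OF abs_tree_sum_le' tree_nn_mono]) simp
  then show ?thesis
    by (simp add: power_mono flip: ennreal_power)
qed

context
  fixes M :: "'w measure" and \<theta> :: "nat list \<Rightarrow> 'w \<Rightarrow> 'a enumeration"
  assumes M: "prob_space M" and fam: "branching_family M \<gamma> \<theta>"
begin

lemma abs_moment_family: "(\<integral>\<^sup>+\<omega>. abs_total \<infinity> z (\<lambda>u. \<theta> u \<omega>) ^ k \<partial>M) = abs_moment k z"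
  unfolding abs_moment_def
  by (rule nn_integral_tree_nn_cong[OF M fam prob family sets_\<gamma> \<gamma>_finite f_measurable])

lemma abs_total_finite: "AE \<omega> in M. abs_total \<infinity> z (\<lambda>u. \<theta> u \<omega>) < \<infinity>"
proof -
  have "AE \<omega> in M. abs_total \<infinity> z (\<lambda>u. \<theta> u \<omega>) \<noteq> \<infinity>"
    using abs_moment_family[of z 1] abs_moment_finite[of 1 z]
    by (intro nn_integral_PInf_AE measurable_family_tree_nn(2)[OF M sets_\<gamma> fam abs_f_measurable]) auto
  then show ?thesis
    by eventually_elim (simp add: less_top)
qed

lemma nn_integral_abs_total_le: "(\<integral>\<^sup>+\<omega>. ennreal (\<bar>total L z (\<lambda>u. \<theta> u \<omega>)\<bar> ^ k) \<partial>M) \<le> abs_moment k z"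
  unfolding abs_moment_family[symmetric] by (intro nn_integral_mono abs_total_le)

lemma integrable_total_power: "integrable M (\<lambda>\<omega>. total L z (\<lambda>u. \<theta> u \<omega>) ^ k)"
proof (rule integrableI_bounded)
  show "(\<lambda>\<omega>. total L z (\<lambda>u. \<theta> u \<omega>) ^ k) \<in> borel_measurable M"
    by (intro borel_measurable_power measurable_family_tree_sum(2)[OF M sets_\<gamma> fam f_measurable])
  show "(\<integral>\<^sup>+\<omega>. ennreal (norm (total L z (\<lambda>u. \<theta> u \<omega>) ^ k)) \<partial>M) < \<infinity>"
    using nn_integral_abs_total_le[of L z k] abs_moment_finite[of k z]
    by (simp add: power_abs order.strict_trans1)
qed

end

lemma distr_total:
  assumes "prob_space M" "branching_family M \<gamma> \<theta>"
  shows "distr M borel (\<lambda>\<omega>. total L z (\<lambda>u. \<theta> u \<omega>)) = distr P borel (\<lambda>\<omega>. total L z (\<lambda>u. \<eta> u \<omega>))"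
proof (cases L)
  case (enat N)
  show ?thesis
    unfolding enat by (rule distr_tree_sum_finite[OF assms prob family sets_\<gamma> \<gamma>_finite f_measurable])
next
  case infinity
  show ?thesis
    unfolding infinity
    by (rule distr_tree_sum_infinite[OF assms prob family sets_\<gamma> \<gamma>_finite f_measurable
          abs_total_finite[OF assms] abs_total_finite[OF prob family]])
qed

lemma moment_family:
  assumes "prob_space M" "branching_family M \<gamma> \<theta>"
  shows "(\<integral>\<omega>. total L z (\<lambda>u. \<theta> u \<omega>) ^ k \<partial>M) = moment L k z"
  unfolding moment_def
  by (rule integral_cong_distr(1)[OF distr_total[OF assms]
        measurable_family_tree_sum(2)[OF assms(1) sets_\<gamma> assms(2) f_measurable]
        measurable_family_tree_sum(2)[OF prob sets_\<gamma> family f_measurable], where h="\<lambda>y. y ^ k"]) measurable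

lemma abs_moment_le: "ennreal \<bar>moment L k z\<bar> \<le> abs_moment k z"
proof -
  have "\<bar>moment L k z\<bar> \<le> (\<integral>\<omega>. \<bar>total L z (\<lambda>u. \<eta> u \<omega>) ^ k\<bar> \<partial>P)"
    unfolding moment_def by (rule integral_abs_bound)
  then have "ennreal \<bar>moment L k z\<bar> \<le> ennreal (\<integral>\<omega>. \<bar>total L z (\<lambda>u. \<eta> u \<omega>) ^ k\<bar> \<partial>P)"
    by (rule ennreal_leI)
  also have "\<dots> = (\<integral>\<^sup>+\<omega>. ennreal (\<bar>total L z (\<lambda>u. \<eta> u \<omega>)\<bar> ^ k) \<partial>P)"
    using integrable_abs[OF integrable_total_power[OF prob family, of L z k]]
    by (subst nn_integral_eq_integral[symmetric]) (auto simp: power_abs)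
  also have "\<dots> \<le> abs_moment k z"
    by (rule nn_integral_abs_total_le[OF prob family])
  finally show ?thesis .
qed

context
  fixes M :: "'w measure" and \<mu> :: "'a measure" and \<zeta> :: "'w \<Rightarrow> 'a enumeration"
    and \<theta> :: "nat \<Rightarrow> nat list \<Rightarrow> 'w \<Rightarrow> 'a enumeration" and w :: 'a
  assumes marked: "marked_poisson M \<mu> \<zeta> genealogy_space (\<lambda>i \<omega> u. \<theta> i u \<omega>)"
    and fam: "\<And>i. branching_family M \<gamma> (\<theta> i)"
begin

interpretation marked_poisson M \<mu> \<zeta> genealogy_space "\<lambda>i \<omega> u. \<theta> i u \<omega>"
  by (rule marked)

text \<open>The point where clusters attached to different labels are identified in law. The offset
  \<open>w\<close> is the position of the ancestor when the points are displacements of children,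
  and 0 when they are immigrants.\<close>

lemma mark_total: "mark (\<lambda>x c. total L (w + x) c)"
  unfolding mark_def
proof (intro conjI allI)
  note [measurable] = measurable_tree_sum[OF f_measurable]
  have "(\<lambda>p. (\<lambda>(z, c). total L z c) (w + fst p, snd p)) \<in> borel_measurable (borel \<Otimes>\<^sub>M genealogy_space)"
    by measurable
  then show "(\<lambda>(x, c). total L (w + x) c) \<in> borel_measurable (borel \<Otimes>\<^sub>M genealogy_space)"
    by (simp add: case_prod_beta)
  show "distr M borel (\<lambda>\<omega>. total L (w + x) (\<lambda>u. \<theta> i u \<omega>)) = distr M borel (\<lambda>\<omega>. total L (w + x) (\<lambda>u. \<theta> 0 u \<omega>))" for i x
    unfolding distr_total[OF prob_space_axioms fam] ..
qed

lemma mark_moment_total: "mark_moment (\<lambda>x c. total L (w + x) c) k x = moment L k (w + x)"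
  unfolding mark_moment_def by (rule moment_family[OF prob_space_axioms fam])

lemma mark_moment_abs_total_le:
  "ennreal (mark_moment (abs_mark (\<lambda>x c. total L (w + x) c)) k x) \<le> abs_moment k (w + x)"
proof -
  have "ennreal (mark_moment (abs_mark (\<lambda>x c. total L (w + x) c)) k x) =
      (\<integral>\<^sup>+\<omega>. ennreal (\<bar>total L (w + x) (\<lambda>u. \<theta> 0 u \<omega>)\<bar> ^ k) \<partial>M)"
    unfolding mark_moment_def
    using integrable_abs[OF integrable_total_power[OF prob_space_axioms fam[of 0], of L "w + x" k]]
    by (subst nn_integral_eq_integral[symmetric]) (auto simp: power_abs)
  also have "\<dots> \<le> abs_moment k (w + x)"
    by (rule nn_integral_abs_total_le[OF prob_space_axioms fam])
  finally show ?thesis .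
qed

end

text \<open>The sum is f(z) plus a marked Poisson sum over the children, each marked with the sum
  over its own \<open>L\<close> generations.\<close>

theorem moment_recursion:
  shows integrable_moment_shift: "k \<ge> 1 \<Longrightarrow> integrable \<gamma> (\<lambda>x. moment L k (z + x))"
    and moment_eSuc: "n \<ge> 1 \<Longrightarrow> moment (eSuc L) n z =
      complete_bell n (\<lambda>k. (if k = 1 then f z else 0) + (\<integral>x. moment L k (z + x) \<partial>\<gamma>))"
proof -
  interpret marked_poisson P \<gamma> "\<eta> []" genealogy_space "\<lambda>i \<omega> u. \<eta> (u @ [i]) \<omega>"
    by (rule branching_marked_poisson[OF prob sets_\<gamma> family])
  note sub = branching_family_subtree[OF prob sets_\<gamma> family]
  let ?Y = "\<lambda>x c. total L (z + x) c"
  have Y: "mark ?Y"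
    by (rule mark_total[OF marked_poisson_axioms sub])
  \<comment> \<open>The intensity is finite here, so no exhaustion in space is needed and only the
    values of the marks get truncated.\<close>
  have A: "exhaustion (\<lambda>_. UNIV)"
    using \<gamma>_finite by (simp add: exhaustion_def incseq_def)
  have int: "integrable P (\<lambda>\<omega>. ?Y x (\<lambda>u. \<eta> (u @ [0]) \<omega>) ^ k)" for x k
    by (rule integrable_total_power[OF prob sub])
  \<comment> \<open>The absolute sum over the marks is part of the absolute sum over the whole
    cluster, whose moments are finite by hypothesis.\<close>
  have S_le: "abs_mark_sum ?Y \<omega> \<le> abs_total \<infinity> z (\<lambda>u. \<eta> u \<omega>)" for \<omega>
  proof -
    have "abs_mark_sum ?Y \<omega> \<le> (\<integral>\<^sup>+i. abs_total L (z + snd (\<eta> [] \<omega>) i) (\<lambda>u. \<eta> (u @ [i]) \<omega>) \<partial>count_space (indices (\<eta> [] \<omega>)))"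
      unfolding abs_mark_sum_def by (intro nn_integral_mono abs_tree_sum_le')
    also have "\<dots> \<le> abs_total (eSuc L) z (\<lambda>u. \<eta> u \<omega>)"
      unfolding tree_nn_eSuc by (simp add: subtree_def)
    also have "\<dots> \<le> abs_total \<infinity> z (\<lambda>u. \<eta> u \<omega>)"
      by (rule tree_nn_mono) simp
    finally show ?thesis .
  qed
  have fin: "(\<integral>\<^sup>+\<omega>. abs_mark_sum ?Y \<omega> ^ k \<partial>P) < \<infinity>" for k
  proof -
    have "(\<integral>\<^sup>+\<omega>. abs_mark_sum ?Y \<omega> ^ k \<partial>P) \<le> abs_moment k z"
      unfolding abs_moment_def by (intro nn_integral_mono power_mono S_le) simp
    then show ?thesis
      using abs_moment_finite by (rule order.strict_trans1)
  qed
  \<comment> \<open>Integrability over \<open>\<gamma>\<close> is a conclusion drawn from the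
    moments of the cluster.\<close>
  have intm: "integrable \<gamma> (mark_moment (abs_mark ?Y) k)" if "k \<ge> 1" for k
    by (rule moments_imp_integrable_mark_moment[OF A Y that int fin])
  have mm: "mark_moment ?Y k x = moment L k (z + x)" for k x
    by (rule mark_moment_total[OF marked_poisson_axioms sub])
  show "integrable \<gamma> (\<lambda>x. moment L k (z + x))" if "k \<ge> 1" for k
  proof (rule Bochner_Integration.integrable_bound[OF intm[OF that]])
    show "(\<lambda>x. moment L k (z + x)) \<in> borel_measurable \<gamma>"
      using measurable_mark_moment[OF Y, of k] by (simp add: mm cong: measurable_cong_sets sets_\<gamma>)
    show "AE x in \<gamma>. norm (moment L k (z + x)) \<le> norm (mark_moment (abs_mark ?Y) k x)"
    proof (rule AE_I2)
      fix x
      have "\<bar>mark_moment ?Y k x\<bar> \<le> mark_moment (abs_mark ?Y) k x"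
        unfolding mark_moment_def by (rule order_trans[OF integral_abs_bound]) (simp add: power_abs)
      then show "norm (moment L k (z + x)) \<le> norm (mark_moment (abs_mark ?Y) k x)"
        by (simp add: mm)
    qed
  qed
  note S = mark_sum_integrable_power[OF A Y int intm] mark_sum_moment[OF A Y int intm]
  assume "n \<ge> 1"
  have "moment (eSuc L) n z = (\<integral>\<omega>. (f z + mark_sum ?Y \<omega>) ^ n \<partial>P)"
    unfolding moment_def
  proof (rule integral_cong_AE)
    show "(\<lambda>\<omega>. total (eSuc L) z (\<lambda>u. \<eta> u \<omega>) ^ n) \<in> borel_measurable P"
      by (intro borel_measurable_power measurable_family_tree_sum(2)[OF prob sets_\<gamma> family f_measurable])
    show "(\<lambda>\<omega>. (f z + mark_sum ?Y \<omega>) ^ n) \<in> borel_measurable P"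
      using measurable_mark_sum(1)[OF Y] by measurable
    show "AE \<omega> in P. total (eSuc L) z (\<lambda>u. \<eta> u \<omega>) ^ n = (f z + mark_sum ?Y \<omega>) ^ n"
      using abs_total_finite[OF prob family, of z]
    proof eventually_elim
      case (elim \<omega>)
      have "abs_total (eSuc L) z (\<lambda>u. \<eta> u \<omega>) < \<infinity>"
        using tree_nn_mono[of "eSuc L" \<infinity>] elim by (rule order.strict_trans1) simp
      then have "total (eSuc L) z (\<lambda>u. \<eta> u \<omega>) = f z + mark_sum ?Y \<omega>"
        unfolding mark_sum_def by (simp add: tree_sum_eSuc subtree_def)
      then show ?case by simp
    qed
  qed
  also have "\<dots> = complete_bell n (\<lambda>k. (if k = 1 then f z else 0) + (\<integral>x. mark_moment ?Y k x \<partial>\<gamma>))"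
    by (rule moments_add_const[OF S \<open>n \<ge> 1\<close>])
  finally show "moment (eSuc L) n z =
      complete_bell n (\<lambda>k. (if k = 1 then f z else 0) + (\<integral>x. moment L k (z + x) \<partial>\<gamma>))"
    by (simp only: mm)
qed

end

section \<open>The operator \<open>(I\<^sub>d - \<Gamma>)\<^sup>-\<^sup>1\<close>\<close>

text \<open>\<open>conv_nn \<gamma> g z m\<close> is \<open>(\<Gamma>\<^sup>m g)(z)\<close> for nonnegative \<open>g\<close>.\<close>

definition conv_nn :: "'a::euclidean_space measure \<Rightarrow> ('a \<Rightarrow> ennreal) \<Rightarrow> 'a \<Rightarrow> nat \<Rightarrow> ennreal" where
  "conv_nn \<gamma> g z m = (\<integral>\<^sup>+x. g (z + (\<Sum>i<m. x i)) \<partial>(\<Pi>\<^sub>M i\<in>{..<m}. \<gamma>))"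

locale finite_kernel =
  fixes \<gamma> :: "'a::euclidean_space measure"
  assumes sets_\<gamma> [measurable_cong]: "sets \<gamma> = sets borel" and \<gamma>_finite: "emeasure \<gamma> UNIV < \<infinity>"
begin

lemma finite_measure_\<gamma>: "finite_measure \<gamma>"
  using \<gamma>_finite sets_eq_imp_space_eq[OF sets_\<gamma>] by (intro finite_measureI) auto

sublocale finite_measure \<gamma>
  by (rule finite_measure_\<gamma>)

sublocale product_sigma_finite "\<lambda>_ :: nat. \<gamma>"
  by standard

abbreviation conv :: "('a \<Rightarrow> real) \<Rightarrow> 'a \<Rightarrow> nat \<Rightarrow> real" where
  "conv \<equiv> convolution_power_integral \<gamma>"

lemma measurable_shift_sum [measurable]:
  "(\<lambda>x. z + (\<Sum>i<m. x i)) \<in> borel_measurable (\<Pi>\<^sub>M i\<in>{..<m}. \<gamma>)"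
proof -
  have "(\<lambda>x. x i) \<in> borel_measurable (\<Pi>\<^sub>M i\<in>{..<m}. \<gamma>)" if "i < m" for i
    using measurable_component_singleton[of i "{..<m}" "\<lambda>_. \<gamma>"] that by (simp cong: measurable_cong_sets add: sets_\<gamma>)
  then show ?thesis by (intro borel_measurable_add borel_measurable_const borel_measurable_sum) simp
qed

lemma sum_fun_upd: "(\<Sum>i<Suc m. (x(m := y)) i) = (\<Sum>i<m. x i) + (y :: 'a)" for x :: "nat \<Rightarrow> 'a"
  by simp

lemma conv_nn_0: "conv_nn \<gamma> g z 0 = g z"
  by (simp add: conv_nn_def PiM_empty nn_integral_count_space_finite)

lemma conv_0: "conv g z 0 = g z"
  by (simp add: convolution_power_integral_def PiM_empty lebesgue_integral_count_space_finite)

lemma measurable_Suc_sum: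
  "g \<in> borel_measurable borel \<Longrightarrow> (\<lambda>x. g (z + (\<Sum>i<Suc m. x i))) \<in> borel_measurable (\<Pi>\<^sub>M i\<in>insert m {..<m}. \<gamma>)"
  using measurable_compose[OF measurable_shift_sum[of z "Suc m"], of g borel] by (simp add: lessThan_Suc)

text \<open>The new coordinate is integrated innermost or outermost, that is, Gamma is applied to
  \<open>g\<close> or to the result. The first form serves the telescoping sum, the second the
  iteration over generations.\<close>

lemma conv_nn_Suc:
  assumes g: "g \<in> borel_measurable borel"
  shows "conv_nn \<gamma> g z (Suc m) = conv_nn \<gamma> (\<lambda>y. \<integral>\<^sup>+x. g (y + x) \<partial>\<gamma>) z m"
    and "conv_nn \<gamma> g z (Suc m) = (\<integral>\<^sup>+x. conv_nn \<gamma> g (z + x) m \<partial>\<gamma>)"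
proof -
  have "conv_nn \<gamma> g z (Suc m) = (\<integral>\<^sup>+x. (\<integral>\<^sup>+y. g (z + (\<Sum>i<Suc m. (x(m := y)) i)) \<partial>\<gamma>) \<partial>(\<Pi>\<^sub>M i\<in>{..<m}. \<gamma>))"
    unfolding conv_nn_def lessThan_Suc[of m]
    by (subst product_nn_integral_insert) (use measurable_Suc_sum[OF g] in \<open>auto simp: lessThan_Suc\<close>)
  then show "conv_nn \<gamma> g z (Suc m) = conv_nn \<gamma> (\<lambda>y. \<integral>\<^sup>+x. g (y + x) \<partial>\<gamma>) z m"
    by (simp only: sum_fun_upd conv_nn_def add.assoc)
  have "conv_nn \<gamma> g z (Suc m) = (\<integral>\<^sup>+y. (\<integral>\<^sup>+x. g (z + (\<Sum>i<Suc m. (x(m := y)) i)) \<partial>(\<Pi>\<^sub>M i\<in>{..<m}. \<gamma>)) \<partial>\<gamma>)"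
    unfolding conv_nn_def lessThan_Suc[of m]
    by (subst product_nn_integral_insert_rev) (use measurable_Suc_sum[OF g] in \<open>auto simp: lessThan_Suc\<close>)
  then show "conv_nn \<gamma> g z (Suc m) = (\<integral>\<^sup>+x. conv_nn \<gamma> g (z + x) m \<partial>\<gamma>)"
    by (simp only: sum_fun_upd conv_nn_def) (simp add: ac_simps)
qed

lemma measurable_conv_nn:
  assumes [measurable]: "g \<in> borel_measurable borel"
  shows "(\<lambda>z. conv_nn \<gamma> g z m) \<in> borel_measurable borel"
proof (induction m)
  case 0
  show ?case by (simp add: conv_nn_0)
next
  case (Suc m)
  note [measurable] = Suc
  show ?case unfolding conv_nn_Suc(2)[OF assms] by measurable
qed

lemma conv_nn_add:
  assumes [measurable]: "g \<in> borel_measurable borel" "h \<in> borel_measurable borel"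
  shows "conv_nn \<gamma> (\<lambda>y. g y + h y) z m = conv_nn \<gamma> g z m + conv_nn \<gamma> h z m"
  unfolding conv_nn_def by (rule nn_integral_add) measurable

lemma conv_dominated:
  assumes [measurable]: "g \<in> borel_measurable borel" and le: "\<And>y. ennreal \<bar>g y\<bar> \<le> H y"
    and fin: "conv_nn \<gamma> H z m < \<infinity>"
  shows conv_integrable: "integrable (\<Pi>\<^sub>M i\<in>{..<m}. \<gamma>) (\<lambda>x. g (z + (\<Sum>i<m. x i)))"
    and conv_bound: "\<bar>conv g z m\<bar> \<le> enn2real (conv_nn \<gamma> H z m)"
proof -
  let ?g = "\<lambda>x. g (z + (\<Sum>i<m. x i))"
  have le': "(\<integral>\<^sup>+x. ennreal \<bar>?g x\<bar> \<partial>(\<Pi>\<^sub>M i\<in>{..<m}. \<gamma>)) \<le> conv_nn \<gamma> H z m"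
    unfolding conv_nn_def by (intro nn_integral_mono le)
  show int: "integrable (\<Pi>\<^sub>M i\<in>{..<m}. \<gamma>) ?g"
  proof (rule integrableI_bounded)
    show "(\<integral>\<^sup>+x. ennreal (norm (?g x)) \<partial>(\<Pi>\<^sub>M i\<in>{..<m}. \<gamma>)) < \<infinity>"
      using le' fin by (simp add: order.strict_trans1)
  qed measurable
  have "ennreal \<bar>conv g z m\<bar> \<le> ennreal (\<integral>x. \<bar>?g x\<bar> \<partial>(\<Pi>\<^sub>M i\<in>{..<m}. \<gamma>))"
    unfolding convolution_power_integral_def by (intro ennreal_leI integral_abs_bound)
  also have "\<dots> = (\<integral>\<^sup>+x. ennreal \<bar>?g x\<bar> \<partial>(\<Pi>\<^sub>M i\<in>{..<m}. \<gamma>))"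
    using integrable_abs[OF int] by (subst nn_integral_eq_integral) auto
  also note le'
  finally show "\<bar>conv g z m\<bar> \<le> enn2real (conv_nn \<gamma> H z m)"
    using fin by (cases "conv_nn \<gamma> H z m") auto
qed

lemma conv_Suc:
  assumes "integrable (\<Pi>\<^sub>M i\<in>{..<Suc m}. \<gamma>) (\<lambda>x. g (z + (\<Sum>i<Suc m. x i)))"
  shows "conv g z (Suc m) = conv (\<lambda>y. \<integral>x. g (y + x) \<partial>\<gamma>) z m"
proof -
  have "conv g z (Suc m) = (\<integral>x. (\<integral>y. g (z + (\<Sum>i<Suc m. (x(m := y)) i)) \<partial>\<gamma>) \<partial>(\<Pi>\<^sub>M i\<in>{..<m}. \<gamma>))"
    unfolding convolution_power_integral_def lessThan_Suc[of m]
    by (subst product_integral_insert) (use assms in \<open>auto simp: lessThan_Suc\<close>)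
  then show ?thesis
    by (simp only: sum_fun_upd convolution_power_integral_def add.assoc)
qed

text \<open>
  The solutions of \<open>M = H + \<Gamma> M\<close> are not unique; \<open>M\<close> is the minimal one, because it is the limit of
  the iterates \<open>MN\<close>.
\<close>

lemma iterates_le_conv_nn:
  assumes [measurable]: "H \<in> borel_measurable borel" and MN0: "\<And>z. MN 0 z = 0"
    and MN: "\<And>N z. MN (Suc N) z \<le> H z + (\<integral>\<^sup>+x. MN N (z + x) \<partial>\<gamma>)"
  shows "MN N z \<le> (\<Sum>j<N. conv_nn \<gamma> H z j)"
proof (induction N arbitrary: z)
  case (Suc N)
  note [measurable] = measurable_conv_nn
  have "MN (Suc N) z \<le> H z + (\<integral>\<^sup>+x. (\<Sum>j<N. conv_nn \<gamma> H (z + x) j) \<partial>\<gamma>)"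
    by (intro order_trans[OF MN] add_left_mono nn_integral_mono Suc.IH)
  also have "\<dots> = H z + (\<Sum>j<N. conv_nn \<gamma> H z (Suc j))"
    by (subst nn_integral_sum) (simp_all add: conv_nn_Suc(2))
  also have "\<dots> = (\<Sum>j<Suc N. conv_nn \<gamma> H z j)"
    unfolding sum.lessThan_Suc_shift by (simp add: conv_nn_0)
  finally show ?case .
qed (simp add: MN0)

section \<open>Minimal solutions: vanishing remainder and convergence of the resolvent\<close>

context
  fixes M H :: "'a \<Rightarrow> ennreal"
  assumes M[measurable]: "M \<in> borel_measurable borel" and H[measurable]: "H \<in> borel_measurable borel"
    and M_eq: "\<And>z. M z = H z + (\<integral>\<^sup>+x. M (z + x) \<partial>\<gamma>)" and M_finite: "\<And>z. M z < \<infinity>"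
    and minimal: "\<And>z. M z \<le> (\<Sum>j. conv_nn \<gamma> H z j)"
begin

text \<open>M = H + Gamma M inserted into itself N times; written as a sum, since extended reals do
  not allow the subtraction.\<close>

lemma conv_nn_telescope: "(\<Sum>j<N. conv_nn \<gamma> H z j) + conv_nn \<gamma> M z N = M z"
proof (induction N)
  case (Suc N)
  have "conv_nn \<gamma> M z N = conv_nn \<gamma> (\<lambda>y. H y + (\<integral>\<^sup>+x. M (y + x) \<partial>\<gamma>)) z N"
    by (rule arg_cong[where f="\<lambda>g. conv_nn \<gamma> g z N"]) (rule ext, rule M_eq)
  also have "\<dots> = conv_nn \<gamma> H z N + conv_nn \<gamma> M z (Suc N)"
    by (simp add: conv_nn_add conv_nn_Suc(1)[OF M])
  finally show ?case
    using Suc by (simp add: add.assoc)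
qed (simp add: conv_nn_0)

lemma partial_sum_le: "(\<Sum>j<N. conv_nn \<gamma> H z j) \<le> M z"
proof -
  have "(\<Sum>j<N. conv_nn \<gamma> H z j) \<le> (\<Sum>j<N. conv_nn \<gamma> H z j) + conv_nn \<gamma> M z N"
    by (intro add_increasing2) auto
  then show ?thesis
    unfolding conv_nn_telescope .
qed

lemma conv_nn_finite: "conv_nn \<gamma> M z N < \<infinity>" "conv_nn \<gamma> H z N < \<infinity>"
proof -
  show "conv_nn \<gamma> M z N < \<infinity>"
  proof -
    have "conv_nn \<gamma> M z N \<le> (\<Sum>j<N. conv_nn \<gamma> H z j) + conv_nn \<gamma> M z N"
      by (intro add_increasing) auto
    also have "\<dots> < \<infinity>"
      unfolding conv_nn_telescope by (rule M_finite)
    finally show ?thesis .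
  qed
  have "conv_nn \<gamma> H z N \<le> (\<Sum>j<Suc N. conv_nn \<gamma> H z j)"
    by (intro member_le_sum) auto
  also have "\<dots> \<le> M z"
    by (rule partial_sum_le)
  finally show "conv_nn \<gamma> H z N < \<infinity>"
    using M_finite by (rule order.strict_trans1)
qed

text \<open>The telescoped identity bounds the series by \<open>M\<close> from above and
  \<open>minimal\<close> bounds it from below. As \<open>M\<close> is finite, the remainder Gamma^N
  M is then a difference of convergent quantities with equal limits.\<close>

lemma conv_nn_sums: "(\<lambda>j. enn2real (conv_nn \<gamma> H z j)) sums enn2real (M z)"
  and conv_nn_vanishes: "(\<lambda>N. enn2real (conv_nn \<gamma> M z N)) \<longlonglongrightarrow> 0"
proof -
  let ?a = "\<lambda>j. enn2real (conv_nn \<gamma> H z j)"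
  have part: "ennreal (\<Sum>j<N. ?a j) = (\<Sum>j<N. conv_nn \<gamma> H z j)" for N
    using conv_nn_finite(2) by (simp add: sum_ennreal[symmetric] less_top)
  have le: "(\<Sum>j<N. conv_nn \<gamma> H z j) \<le> M z" for N
    by (rule partial_sum_le)
  have "(\<Sum>j. conv_nn \<gamma> H z j) \<le> M z"
    by (intro suminf_le_const le) simp
  then have S: "(\<Sum>j. conv_nn \<gamma> H z j) = M z"
    using minimal[of z] by simp
  have "(\<lambda>N. \<Sum>j<N. conv_nn \<gamma> H z j) \<longlonglongrightarrow> M z"
    unfolding S[symmetric] by (rule summable_LIMSEQ) simp
  then have "(\<lambda>N. enn2real (\<Sum>j<N. conv_nn \<gamma> H z j)) \<longlonglongrightarrow> enn2real (M z)"
    using M_finite[of z] by (intro tendsto_enn2real) auto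
  moreover have "enn2real (\<Sum>j<N. conv_nn \<gamma> H z j) = (\<Sum>j<N. ?a j)" for N
    unfolding part[symmetric] by (intro enn2real_ennreal sum_nonneg) simp
  ultimately have lim: "(\<lambda>N. \<Sum>j<N. ?a j) \<longlonglongrightarrow> enn2real (M z)"
    by simp
  then show "?a sums enn2real (M z)"
    by (simp add: sums_def)
  have "enn2real (conv_nn \<gamma> M z N) = enn2real (M z) - (\<Sum>j<N. ?a j)" for N
  proof -
    have "enn2real (M z) = enn2real (ennreal (\<Sum>j<N. ?a j) + conv_nn \<gamma> M z N)"
      unfolding part conv_nn_telescope ..
    also have "\<dots> = (\<Sum>j<N. ?a j) + enn2real (conv_nn \<gamma> M z N)"
      using conv_nn_finite(1)[of z N] by (subst enn2real_plus) (auto simp: sum_nonneg)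
    finally show ?thesis by simp
  qed
  then show "(\<lambda>N. enn2real (conv_nn \<gamma> M z N)) \<longlonglongrightarrow> 0"
    using tendsto_diff[OF tendsto_const lim, of "enn2real (M z)"] by simp
qed

lemma resolvent_defined_dominated:
  assumes g: "g \<in> borel_measurable borel" and le: "\<And>y. ennreal \<bar>g y\<bar> \<le> H y"
  shows "resolvent_defined \<gamma> g z" and "summable (conv g z)"
proof -
  show sm: "summable (conv g z)"
  proof (rule summable_comparison_test')
    show "summable (\<lambda>j. enn2real (conv_nn \<gamma> H z j))"
      using conv_nn_sums by (rule sums_summable)
    show "norm (conv g z j) \<le> enn2real (conv_nn \<gamma> H z j)" if "j \<ge> 0" for j
      using conv_bound[OF g le conv_nn_finite(2)] by simp
  qed
  then show "resolvent_defined \<gamma> g z"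
    unfolding resolvent_defined_def
    by (auto simp: summable_Suc_iff intro: conv_integrable[OF g le conv_nn_finite(2)])
qed

lemma resolvent_eq_suminf:
  assumes "g \<in> borel_measurable borel" and "\<And>y. ennreal \<bar>g y\<bar> \<le> H y"
  shows "resolvent \<gamma> g z = (\<Sum>j. conv g z j)"
  unfolding resolvent_def
  using suminf_split_head[OF resolvent_defined_dominated(2)[OF assms]] by (simp add: conv_0)

text \<open>The telescoping argument repeated for signed functions: \<open>g\<close> is dominated by
  \<open>H\<close>, which makes the series converge, and \<open>m\<close> by \<open>M\<close>, which
  makes the remainder vanish.\<close>

lemma resolvent_eq:
  assumes g[measurable]: "g \<in> borel_measurable borel" and le: "\<And>y. ennreal \<bar>g y\<bar> \<le> H y"
    and m[measurable]: "m \<in> borel_measurable borel" and m_le: "\<And>y. ennreal \<bar>m y\<bar> \<le> M y"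
    and m_eq: "\<And>y. m y = g y + (\<integral>x. m (y + x) \<partial>\<gamma>)"
  shows "resolvent \<gamma> g z = m z"
proof -
  have step: "conv m z N = conv g z N + conv m z (Suc N)" for N
  proof -
    let ?G = "\<lambda>y. \<integral>x. m (y + x) \<partial>\<gamma>"
    have G: "?G y = m y - g y" for y
      using m_eq[of y] by simp
    have int: "integrable (\<Pi>\<^sub>M i\<in>{..<N}. \<gamma>) (\<lambda>x. g (z + (\<Sum>i<N. x i)))"
      by (rule conv_integrable[OF g le conv_nn_finite(2)])
    have int': "integrable (\<Pi>\<^sub>M i\<in>{..<N}. \<gamma>) (\<lambda>x. m (z + (\<Sum>i<N. x i)))"
      by (rule conv_integrable[OF m m_le conv_nn_finite(1)])
    have "conv m z (Suc N) = conv ?G z N"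
      by (rule conv_Suc[OF conv_integrable[OF m m_le conv_nn_finite(1)]])
    also have "\<dots> = conv m z N - conv g z N"
      unfolding G convolution_power_integral_def
      by (rule Bochner_Integration.integral_diff[OF int' int])
    finally show ?thesis by simp
  qed
  have part: "(\<Sum>j<N. conv g z j) = m z - conv m z N" for N
  proof (induction N)
    case (Suc N)
    then show ?case using step[of N] by simp
  qed (simp add: conv_0)
  have "(\<lambda>N. conv m z N) \<longlonglongrightarrow> 0"
    by (rule Lim_null_comparison[OF _ conv_nn_vanishes[of z]])
       (auto intro!: always_eventually conv_bound[OF m m_le conv_nn_finite(1)])
  then have "(\<lambda>N. \<Sum>j<N. conv g z j) \<longlonglongrightarrow> m z - 0"
    unfolding part by (intro tendsto_diff tendsto_const)
  then have "(conv g z) sums m z"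
    by (simp add: sums_def)
  then show ?thesis
    unfolding resolvent_eq_suminf[OF g le] by (rule sums_unique[symmetric])
qed

lemma resolvent_sum:
  assumes g: "\<And>k. k \<in> K \<Longrightarrow> g k \<in> borel_measurable borel" and le: "\<And>k y. k \<in> K \<Longrightarrow> ennreal \<bar>g k y\<bar> \<le> H y"
    and s: "(\<lambda>y. \<Sum>k\<in>K. g k y) \<in> borel_measurable borel" "\<And>y. ennreal \<bar>\<Sum>k\<in>K. g k y\<bar> \<le> H y"
  shows "resolvent \<gamma> (\<lambda>y. \<Sum>k\<in>K. g k y) z = (\<Sum>k\<in>K. resolvent \<gamma> (g k) z)"
proof -
  have "conv (\<lambda>y. \<Sum>k\<in>K. g k y) z j = (\<Sum>k\<in>K. conv (g k) z j)" for j
    unfolding convolution_power_integral_def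
    by (rule Bochner_Integration.integral_sum) (rule conv_integrable[OF g le conv_nn_finite(2)])
  moreover have "(\<Sum>j. \<Sum>k\<in>K. conv (g k) z j) = (\<Sum>k\<in>K. \<Sum>j. conv (g k) z j)"
    by (rule suminf_sum) (rule resolvent_defined_dominated(2)[OF g le])
  ultimately show ?thesis
    by (simp add: resolvent_eq_suminf g le s cong: sum.cong)
qed

end

end

section \<open>Cumulants of the cluster sum and their resolvent identities\<close>

lemma complete_bell_1: "complete_bell 1 a = a 1"
  using partial_bell_1[of 1 a] by (simp add: complete_bell_def)

lemma abs_cluster_sum_eq:
  fixes f :: "'a::euclidean_space \<Rightarrow> real"
  assumes [measurable]: "f \<in> borel_measurable borel"
  shows "abs_cluster_sum \<eta> f z \<omega> = tree_nn \<infinity> (\<lambda>x. ennreal \<bar>f x\<bar>) z (\<lambda>u. \<eta> u \<omega>)"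
proof -
  have eq: "{u. alive (\<lambda>u. \<eta> u \<omega>) u \<and> u \<noteq> []} = individuals \<infinity> (\<lambda>u. \<eta> u \<omega>) - {[]}"
    by (auto simp: individuals_def)
  have "[] \<in> individuals \<infinity> (\<lambda>u. \<eta> u \<omega>)"
    by (simp add: individuals_def)
  from nn_integral_count_space_remove[OF this, of "\<lambda>u. ennreal \<bar>f (z + position (\<lambda>u. \<eta> u \<omega>) u)\<bar>"]
  show ?thesis
    by (simp add: abs_cluster_sum_def cluster_def descendants_def nn_integral_points tree_nn_def eq)
qed

lemma cluster_sum_eq:
  fixes f :: "'a::euclidean_space \<Rightarrow> real"
  assumes [measurable]: "f \<in> borel_measurable borel"
    and fin: "tree_nn \<infinity> (\<lambda>x. ennreal \<bar>f x\<bar>) z (\<lambda>u. \<eta> u \<omega>) < \<infinity>"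
  shows "cluster_sum \<eta> f z \<omega> = tree_sum \<infinity> f z (\<lambda>u. \<eta> u \<omega>)"
proof -
  let ?c = "\<lambda>u. \<eta> u \<omega>" and ?h = "\<lambda>u. f (z + position (\<lambda>u. \<eta> u \<omega>) u)"
  have eq: "{u. alive ?c u \<and> u \<noteq> []} = individuals \<infinity> ?c - {[]}"
    by (auto simp: individuals_def)
  have root: "[] \<in> individuals \<infinity> ?c"
    by (simp add: individuals_def)
  have "(\<integral>\<^sup>+u. ennreal \<bar>?h u\<bar> \<partial>count_space (individuals \<infinity> ?c - {[]})) < \<infinity>"
    using fin unfolding tree_nn_def nn_integral_count_space_remove[OF root]
    by (simp add: less_top[symmetric])
  then have "integrable (count_space (individuals \<infinity> ?c - {[]})) ?h"
    by (intro integrableI_bounded) simp_all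
  from integral_count_space_remove[OF root this] show ?thesis
    by (simp add: cluster_sum_def cluster_def descendants_def integral_points tree_sum_def eq)
qed

text \<open>Proved directly: agreement with \<open>tree_sum\<close> is known only where the absolute
  sum is finite, hence almost surely, and the measure need not be complete.\<close>

lemma measurable_cluster_sum:
  fixes f :: "'a::euclidean_space \<Rightarrow> real"
  assumes M: "prob_space M" "branching_family M \<gamma> \<eta>" and \<gamma>: "sets \<gamma> = sets borel"
    and f[measurable]: "f \<in> borel_measurable borel"
  shows "cluster_sum \<eta> f z \<in> borel_measurable M"
proof -
  note g[measurable] = measurable_family_genealogy[OF M(1) \<gamma> M(2)]
  have [measurable]: "(\<lambda>\<omega>. position (\<lambda>u. \<eta> u \<omega>) v) \<in> borel_measurable M" for v
    using measurable_compose[OF g measurable_position] .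
  have [measurable]: "Measurable.pred M (\<lambda>\<omega>. alive (\<lambda>u. \<eta> u \<omega>) v)" for v
    using measurable_compose[OF g measurable_alive] .
  have "(\<lambda>\<omega>. \<integral>u. f (z + position (\<lambda>u. \<eta> u \<omega>) u) \<partial>count_space {u. alive (\<lambda>u. \<eta> u \<omega>) u \<and> u \<noteq> []}) \<in> borel_measurable M"
    by (intro borel_measurable_count_space_integral) measurable
  then show ?thesis
    unfolding cluster_sum_def[abs_def] by (simp add: cluster_def descendants_def integral_points)
qed

context finite_moment_cluster
begin

lemma abs_cluster: "finite_moment_cluster P \<gamma> \<eta> (\<lambda>x. \<bar>f x\<bar>)"
proof (rule finite_moment_cluster.intro)
  show "(\<lambda>x. \<bar>f x\<bar>) \<in> borel_measurable borel"
    using f_measurable by measurable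
  show "(\<integral>\<^sup>+\<omega>. tree_nn \<infinity> (\<lambda>x. ennreal \<bar>\<bar>f x\<bar>\<bar>) z (\<lambda>u. \<eta> u \<omega>) ^ m \<partial>P) < \<infinity>" for m z
    unfolding abs_abs by (rule abs_moments)
qed (rule prob family sets_\<gamma> \<gamma>_finite)+

lemma cluster_sum_moment:
  "(\<integral>\<omega>. cluster_sum \<eta> f z \<omega> ^ n \<partial>P) = moment \<infinity> n z"
  unfolding moment_def
proof (rule integral_cong_AE)
  note [measurable] = measurable_cluster_sum[OF prob family sets_\<gamma> f_measurable]
    measurable_family_tree_sum(2)[OF prob sets_\<gamma> family f_measurable]
  show "(\<lambda>\<omega>. cluster_sum \<eta> f z \<omega> ^ n) \<in> borel_measurable P"
    "(\<lambda>\<omega>. total \<infinity> z (\<lambda>u. \<eta> u \<omega>) ^ n) \<in> borel_measurable P"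
    by measurable
  show "AE \<omega> in P. cluster_sum \<eta> f z \<omega> ^ n = total \<infinity> z (\<lambda>u. \<eta> u \<omega>) ^ n"
    using abs_total_finite[OF prob family, of z] by eventually_elim (simp add: cluster_sum_eq f_measurable)
qed

text \<open>These turn out to be cumulants: \<open>kappa L\<close> belongs to the sum over the
  generations below \<open>eSuc L\<close>, one more than the \<open>L\<close> appearing in its
  integrand. For the whole cluster the shift disappears.\<close>

definition kappa :: "enat \<Rightarrow> nat \<Rightarrow> 'a \<Rightarrow> real" where
  "kappa L k z = (if k = 1 then f z else 0) + (\<integral>x. moment L k (z + x) \<partial>\<gamma>)"

lemma moment_eSuc_kappa: "n \<ge> 1 \<Longrightarrow> moment (eSuc L) n z = complete_bell n (\<lambda>k. kappa L k z)"
  unfolding kappa_def by (rule moment_eSuc)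

lemma moment_kappa: "n \<ge> 1 \<Longrightarrow> moment \<infinity> n z = complete_bell n (\<lambda>k. kappa \<infinity> k z)"
  using moment_eSuc_kappa[of n \<infinity> z] by simp

lemma cumulant_cluster_sum:
  assumes "k \<ge> 1"
  shows "cumulant P (cluster_sum \<eta> f z) k = kappa \<infinity> k z"
proof -
  interpret prob_space P by (rule prob)
  show ?thesis
    by (rule cumulant_eq[OF _ assms]) (simp only: cluster_sum_moment moment_kappa)
qed

lemma measurable_kappa [measurable]: "kappa L k \<in> borel_measurable borel"
proof -
  interpret finite_kernel \<gamma> by unfold_locales (rule sets_\<gamma>, rule \<gamma>_finite)
  note [measurable] = f_measurable
  show ?thesis unfolding kappa_def[abs_def] by measurable
qed

lemma moment_tendsto: "(\<lambda>N. moment (enat N) k z) \<longlonglongrightarrow> moment \<infinity> k z"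
  unfolding moment_def
proof (rule integral_dominated_convergence)
  note [measurable] = measurable_family_tree_sum(2)[OF prob sets_\<gamma> family f_measurable]
    measurable_family_tree_nn(2)[OF prob sets_\<gamma> family abs_f_measurable]
  show "(\<lambda>\<omega>. total \<infinity> z (\<lambda>u. \<eta> u \<omega>) ^ k) \<in> borel_measurable P"
    "(\<lambda>\<omega>. total (enat N) z (\<lambda>u. \<eta> u \<omega>) ^ k) \<in> borel_measurable P" for N
    by measurable
  show "AE \<omega> in P. (\<lambda>N. total (enat N) z (\<lambda>u. \<eta> u \<omega>) ^ k) \<longlonglongrightarrow> total \<infinity> z (\<lambda>u. \<eta> u \<omega>) ^ k"
    using abs_total_finite[OF prob family, of z] by eventually_elim (intro tendsto_power tree_sum_tendsto)
  show "integrable P (\<lambda>\<omega>. enn2real (abs_total \<infinity> z (\<lambda>u. \<eta> u \<omega>)) ^ k)"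
    by (rule integrable_enn2real_power[OF _ abs_total_finite[OF prob family] abs_moments]) measurable
  show "AE \<omega> in P. norm (total (enat N) z (\<lambda>u. \<eta> u \<omega>) ^ k) \<le> enn2real (abs_total \<infinity> z (\<lambda>u. \<eta> u \<omega>)) ^ k" for N
    using abs_total_finite[OF prob family, of z]
  proof eventually_elim
    case (elim \<omega>)
    have "ennreal \<bar>total (enat N) z (\<lambda>u. \<eta> u \<omega>)\<bar> \<le> abs_total \<infinity> z (\<lambda>u. \<eta> u \<omega>)"
      using abs_total_le[of "enat N" z "\<lambda>u. \<eta> u \<omega>" 1] by simp
    then have "\<bar>total (enat N) z (\<lambda>u. \<eta> u \<omega>)\<bar> \<le> enn2real (abs_total \<infinity> z (\<lambda>u. \<eta> u \<omega>))"
      using elim by (cases "abs_total \<infinity> z (\<lambda>u. \<eta> u \<omega>)") auto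
    then show ?case
      by (simp add: power_abs power_mono)
  qed
qed

lemma abs_moment_le_moment_abs:
  "\<bar>moment L k z\<bar> \<le> finite_moment_cluster.moment P \<eta> (\<lambda>x. \<bar>f x\<bar>) L k z"
  "L \<le> L' \<Longrightarrow> finite_moment_cluster.moment P \<eta> (\<lambda>x. \<bar>f x\<bar>) L k z \<le> finite_moment_cluster.moment P \<eta> (\<lambda>x. \<bar>f x\<bar>) L' k z"
  "0 \<le> finite_moment_cluster.moment P \<eta> (\<lambda>x. \<bar>f x\<bar>) L k z"
proof -
  interpret A: finite_moment_cluster P \<gamma> \<eta> "\<lambda>x. \<bar>f x\<bar>" by (rule abs_cluster)
  note intA = A.integrable_total_power[OF prob family]
  have nonneg: "0 \<le> A.total L z c" for L z c
    by (simp add: tree_sum_def)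
  have le: "\<bar>total L z c\<bar> \<le> A.total L z c" for L z c
    unfolding tree_sum_def by (rule integral_abs_bound)
  have "\<bar>moment L k z\<bar> \<le> (\<integral>\<omega>. \<bar>total L z (\<lambda>u. \<eta> u \<omega>) ^ k\<bar> \<partial>P)"
    unfolding moment_def by (rule integral_abs_bound)
  also have "\<dots> \<le> A.moment L k z"
    unfolding A.moment_def
    by (intro integral_mono integrable_abs integrable_total_power[OF prob family] intA)
       (simp add: power_abs power_mono le)
  finally show "\<bar>moment L k z\<bar> \<le> A.moment L k z" .
  show "0 \<le> A.moment L k z"
    unfolding A.moment_def by (simp add: nonneg)
  assume "L \<le> L'"
  show "A.moment L k z \<le> A.moment L' k z"
    unfolding A.moment_def
  proof (rule integral_mono_AE[OF intA intA])
    show "AE \<omega> in P. A.total L z (\<lambda>u. \<eta> u \<omega>) ^ k \<le> A.total L' z (\<lambda>u. \<eta> u \<omega>) ^ k"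
      using abs_total_finite[OF prob family, of z]
    proof eventually_elim
      case (elim \<omega>)
      have fin: "abs_total L z (\<lambda>u. \<eta> u \<omega>) < \<infinity>" for L
        using tree_nn_mono[of L \<infinity>] elim by (rule order.strict_trans1) simp
      have "ennreal (A.total L z (\<lambda>u. \<eta> u \<omega>)) \<le> ennreal (A.total L' z (\<lambda>u. \<eta> u \<omega>))"
        unfolding abs_tree_sum_le(2)[OF fin] by (rule tree_nn_mono[OF \<open>L \<le> L'\<close>])
      then show ?case
        using nonneg by (intro power_mono) (simp_all add: ennreal_le_iff)
    qed
  qed
qed

text \<open>The minimality argument is applied to |f|: \<open>M\<close> is its n-th cluster moment
  and \<open>H\<close> the sum over k >= 2 of the partial Bell polynomials of its cumulants. This
  \<open>H\<close> dominates \<open>h\<close> and every \<open>hk\<close>, and \<open>M\<close>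
  dominates the signed moment.\<close>

theorem resolvent_kappa:
  assumes n: "n \<ge> 2"
  defines "h \<equiv> \<lambda>y. complete_bell n (\<lambda>k. kappa \<infinity> k y) - kappa \<infinity> n y"
    and "hk \<equiv> \<lambda>k y. partial_bell n k (\<lambda>j. kappa \<infinity> j y)"
  shows "resolvent_defined \<gamma> h z" and "k \<in> {2..n} \<Longrightarrow> resolvent_defined \<gamma> (hk k) z"
    and "resolvent \<gamma> h z = complete_bell n (\<lambda>k. kappa \<infinity> k z)"
    and "resolvent \<gamma> h z = (\<Sum>k=2..n. resolvent \<gamma> (hk k) z)"
proof -
  interpret A: finite_moment_cluster P \<gamma> \<eta> "\<lambda>x. \<bar>f x\<bar>" by (rule abs_cluster)
  interpret finite_kernel \<gamma> by unfold_locales (rule sets_\<gamma>, rule \<gamma>_finite)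
  have n1: "n \<ge> 1" "n \<noteq> 1" using n by auto
  let ?MN = "\<lambda>N y. ennreal (A.moment (enat N) n y)" and ?M = "\<lambda>y. ennreal (A.moment \<infinity> n y)"
  \<comment> \<open>Written as a sum of partial Bell polynomials rather than as a difference, so
    that nonnegativity and monotonicity in \<open>L\<close> are evident.\<close>
  let ?HL = "\<lambda>L y. \<Sum>k=2..n. partial_bell n k (\<lambda>j. A.kappa L j y)"
  let ?H = "\<lambda>y. ennreal (?HL \<infinity> y)"
  have kA0: "0 \<le> A.kappa L j y" for L j y
    unfolding A.kappa_def by (simp add: abs_moment_le_moment_abs(3))
  have k_le: "\<bar>kappa \<infinity> j y\<bar> \<le> A.kappa \<infinity> j y" if "j \<ge> 1" for j y
  proof -
    have "\<bar>\<integral>x. moment \<infinity> j (y + x) \<partial>\<gamma>\<bar> \<le> (\<integral>x. \<bar>moment \<infinity> j (y + x)\<bar> \<partial>\<gamma>)"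
      by (rule integral_abs_bound)
    also have "\<dots> \<le> (\<integral>x. A.moment \<infinity> j (y + x) \<partial>\<gamma>)"
      by (intro integral_mono integrable_abs integrable_moment_shift A.integrable_moment_shift that abs_moment_le_moment_abs(1))
    finally show ?thesis
      unfolding kappa_def A.kappa_def by auto
  qed
  have kN_le: "A.kappa (enat N) j y \<le> A.kappa \<infinity> j y" if "j \<ge> 1" for N j y
    unfolding A.kappa_def
    by (intro add_left_mono integral_mono A.integrable_moment_shift that abs_moment_le_moment_abs(2)) simp
  have HL_nonneg: "0 \<le> ?HL L y" for L y
    by (intro sum_nonneg partial_bell_nonneg kA0)
  \<comment> \<open>Since n is not 1, the n-th cumulant is exactly the integral of the n-th moments,
    without the term f(y).\<close>
  have split: "A.moment (eSuc L) n y = ?HL L y + (\<integral>x. A.moment L n (y + x) \<partial>\<gamma>)" for L y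
    using complete_bell_minus[OF n, of "\<lambda>j. A.kappa L j y"] n1
    by (simp add: A.moment_eSuc_kappa A.kappa_def[of L n])
  have ennreal_split: "ennreal (A.moment (eSuc L) n y) = ennreal (?HL L y) + (\<integral>\<^sup>+x. ennreal (A.moment L n (y + x)) \<partial>\<gamma>)" for L y
  proof -
    have "(\<integral>\<^sup>+x. ennreal (A.moment L n (y + x)) \<partial>\<gamma>) = ennreal (\<integral>x. A.moment L n (y + x) \<partial>\<gamma>)"
      by (rule nn_integral_eq_integral[OF A.integrable_moment_shift[OF n1(1)]])
         (simp add: abs_moment_le_moment_abs(3))
    moreover have "0 \<le> (\<integral>x. A.moment L n (y + x) \<partial>\<gamma>)"
      by (intro Bochner_Integration.integral_nonneg abs_moment_le_moment_abs(3))
    ultimately show ?thesis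
      by (simp only: split ennreal_plus[OF HL_nonneg])
  qed
  have M_meas: "?M \<in> borel_measurable borel" and H_meas: "?H \<in> borel_measurable borel"
    by (auto intro!: measurable_compose[OF _ measurable_ennreal] borel_measurable_sum borel_measurable_partial_bell)
  \<comment> \<open>At infinite height the recursion becomes the fixed-point equation.\<close>
  have M_eq: "?M y = ?H y + (\<integral>\<^sup>+x. ?M (y + x) \<partial>\<gamma>)" for y
    using ennreal_split[of \<infinity> y] unfolding eSuc_infinity .
  have M_fin: "?M y < \<infinity>" for y by simp
  have "?MN N y \<le> (\<Sum>j<N. conv_nn \<gamma> ?H y j)" for N y
  proof (rule iterates_le_conv_nn[OF H_meas])
    \<comment> \<open>No generation at all gives the sum 0, and 0^n = 0 because n >= 1.\<close>
    show "?MN 0 y = 0" for y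
      using n1 by (simp add: A.moment_def zero_enat_def[symmetric] zero_power)
    fix N y
    have "?MN (Suc N) y = ennreal (?HL (enat N) y) + (\<integral>\<^sup>+x. ?MN N (y + x) \<partial>\<gamma>)"
      using ennreal_split[of "enat N" y] by (simp add: eSuc_enat)
    \<comment> \<open>The inhomogeneity at height \<open>N\<close> is replaced by its larger value
      at infinite height, so that all iterates obey one inequality.\<close>
    also have "\<dots> \<le> ?H y + (\<integral>\<^sup>+x. ?MN N (y + x) \<partial>\<gamma>)"
      by (intro add_right_mono ennreal_leI sum_mono partial_bell_mono kA0 kN_le)
    finally show "?MN (Suc N) y \<le> ?H y + (\<integral>\<^sup>+x. ?MN N (y + x) \<partial>\<gamma>)" .
  qed
  then have MN_le: "?MN N y \<le> (\<Sum>j. conv_nn \<gamma> ?H y j)" for N y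
    by (rule order_trans) (intro sum_le_suminf; simp)
  have minimal: "?M y \<le> (\<Sum>j. conv_nn \<gamma> ?H y j)" for y
    by (rule LIMSEQ_le_const2[OF tendsto_ennrealI[OF A.moment_tendsto]]) (use MN_le in auto)
  note res = M_meas H_meas M_eq M_fin minimal
  have h_sum: "h y = (\<Sum>k=2..n. hk k y)" for y
    unfolding h_def hk_def by (rule complete_bell_minus[OF n])
  have hk_le: "\<bar>hk k y\<bar> \<le> partial_bell n k (\<lambda>j. A.kappa \<infinity> j y)" for k y
    unfolding hk_def by (intro abs_partial_bell_le k_le)
  have hk_H: "ennreal \<bar>hk k y\<bar> \<le> ?H y" if "k \<in> {2..n}" for k y
  proof (rule ennreal_leI)
    have "partial_bell n k (\<lambda>j. A.kappa \<infinity> j y) \<le> ?HL \<infinity> y"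
      using that by (intro member_le_sum partial_bell_nonneg kA0) auto
    with hk_le show "\<bar>hk k y\<bar> \<le> ?HL \<infinity> y"
      by (rule order_trans)
  qed
  have h_H: "ennreal \<bar>h y\<bar> \<le> ?H y" for y
    unfolding h_sum by (intro ennreal_leI order_trans[OF sum_abs] sum_mono hk_le)
  have hk_meas: "hk k \<in> borel_measurable borel" for k
    unfolding hk_def by (intro borel_measurable_partial_bell) simp
  have h_meas: "h \<in> borel_measurable borel"
    unfolding h_sum[abs_def] using hk_meas by measurable
  show "resolvent_defined \<gamma> h z"
    by (rule resolvent_defined_dominated(1)[OF res h_meas h_H])
  show "k \<in> {2..n} \<Longrightarrow> resolvent_defined \<gamma> (hk k) z"
    by (rule resolvent_defined_dominated(1)[OF res hk_meas hk_H])
  have "resolvent \<gamma> h z = moment \<infinity> n z"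
  proof (rule resolvent_eq[OF res h_meas h_H])
    show "ennreal \<bar>moment \<infinity> n y\<bar> \<le> ?M y" for y
      by (intro ennreal_leI abs_moment_le_moment_abs(1))
    show "moment \<infinity> n y = h y + (\<integral>x. moment \<infinity> n (y + x) \<partial>\<gamma>)" for y
      using n1 by (simp add: h_def moment_kappa kappa_def[of \<infinity> n])
  qed simp
  then show "resolvent \<gamma> h z = complete_bell n (\<lambda>k. kappa \<infinity> k z)"
    by (simp only: moment_kappa[OF n1(1)])
  have "resolvent \<gamma> (\<lambda>y. \<Sum>k\<in>{2..n}. hk k y) z = (\<Sum>k\<in>{2..n}. resolvent \<gamma> (hk k) z)"
    by (rule resolvent_sum[OF res hk_meas hk_H]) (use h_meas h_H in \<open>simp_all add: h_sum[abs_def]\<close>)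
  then show "resolvent \<gamma> h z = (\<Sum>k=2..n. resolvent \<gamma> (hk k) z)"
    by (simp add: h_sum[abs_def])
qed

end

section \<open>The Hawkes process\<close>

context finite_moment_cluster
begin

text \<open>Kept apart from \<open>abs_mark_sum\<close>, whose marks are real-valued, because the
  absolute sum over a whole cluster may be infinite.\<close>

definition hawkes_abs_sum ::
  "('q \<Rightarrow> 'a enumeration) \<Rightarrow> (nat \<Rightarrow> nat list \<Rightarrow> 'q \<Rightarrow> 'a enumeration) \<Rightarrow> enat \<Rightarrow> 'q \<Rightarrow> ennreal" where
  "hawkes_abs_sum \<zeta> \<theta> L \<omega> =
    (\<integral>\<^sup>+i. abs_total L (snd (\<zeta> \<omega>) i) (\<lambda>u. \<theta> i u \<omega>) \<partial>count_space (indices (\<zeta> \<omega>)))"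

context
  fixes Q :: "'q measure" and \<nu> :: "'a measure" and \<zeta> :: "'q \<Rightarrow> 'a enumeration"
    and \<theta> :: "nat \<Rightarrow> nat list \<Rightarrow> 'q \<Rightarrow> 'a enumeration" and A :: "nat \<Rightarrow> 'a set"
  assumes Q: "prob_space Q" and hawkes: "hawkes_family Q \<gamma> \<nu> \<zeta> \<theta>" and sets_\<nu>: "sets \<nu> = sets borel"
    and A: "range A \<subseteq> sets borel" "(\<Union>i. A i) = UNIV" "\<And>i. emeasure \<nu> (A i) < \<infinity>" "incseq A"
    and \<nu>_moments: "\<And>k. k \<ge> 1 \<Longrightarrow> (\<integral>\<^sup>+z. abs_moment k z \<partial>\<nu>) < \<infinity>"
begin

lemma hawkes_marked_poisson: "marked_poisson Q \<nu> \<zeta> genealogy_space (\<lambda>i \<omega> u. \<theta> i u \<omega>)"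
  and hawkes_branching_family: "branching_family Q \<gamma> (\<theta> i)"
proof -
  interpret prob_space Q by (rule Q)
  have ind: "indep_vars (\<lambda>_. enum_space) (case_option \<zeta> (\<lambda>(i, u). \<theta> i u)) UNIV"
    and pp: "poisson_process Q \<nu> \<zeta>" "\<And>i u. poisson_process Q \<gamma> (\<theta> i u)"
    using hawkes by (simp_all add: hawkes_family_def)
  have b: "inj (case_prod (\<lambda>i u. Some (i, u)))"
    by (auto simp: inj_on_def)
  note br = indep_vars_branches[OF ind b, of None, simplified]
  show "marked_poisson Q \<nu> \<zeta> genealogy_space (\<lambda>i \<omega> u. \<theta> i u \<omega>)"
    using pp br(1,2) sets_\<nu> by unfold_locales (simp_all add: genealogy_space_def)
  show "branching_family Q \<gamma> (\<theta> i)"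
    using pp br(3) by (simp add: branching_family_def)
qed

interpretation marked_poisson Q \<nu> \<zeta> genealogy_space "\<lambda>i \<omega> u. \<theta> i u \<omega>"
  by (rule hawkes_marked_poisson)

lemma hawkes_exhaustion: "exhaustion A"
  using A by (simp add: exhaustion_def)

lemmas hawkes_mark = mark_total[OF marked_poisson_axioms hawkes_branching_family, where w=0, simplified]
lemmas hawkes_mark_moment = mark_moment_total[OF marked_poisson_axioms hawkes_branching_family, where w=0, simplified]
lemmas hawkes_mark_moment_le = mark_moment_abs_total_le[OF marked_poisson_axioms hawkes_branching_family, where w=0, simplified]

lemma hawkes_integrable_mark_moment:
  assumes "k \<ge> 1"
  shows "integrable \<nu> (mark_moment (abs_mark (total L)) k)"
proof (rule integrableI_bounded)
  show "mark_moment (abs_mark (total L)) k \<in> borel_measurable \<nu>"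
    using measurable_mark_moment[OF mark_abs[OF hawkes_mark[of L]], of k]
    by (simp cong: measurable_cong_sets add: sets_\<nu>)
  have "(\<integral>\<^sup>+x. ennreal (norm (mark_moment (abs_mark (total L)) k x)) \<partial>\<nu>) \<le> (\<integral>\<^sup>+x. abs_moment k x \<partial>\<nu>)"
    by (intro nn_integral_mono) (simp add: mark_moment_abs_nonneg hawkes_mark_moment_le)
  then show "(\<integral>\<^sup>+x. ennreal (norm (mark_moment (abs_mark (total L)) k x)) \<partial>\<nu>) < \<infinity>"
    using \<nu>_moments[OF assms] by (rule order.strict_trans1)
qed

lemmas hawkes_moments = moments_of_mark_sum[OF hawkes_exhaustion hawkes_mark
    integrable_total_power[OF prob_space_axioms hawkes_branching_family] hawkes_integrable_mark_moment]

lemma integrable_moment_\<nu>: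
  assumes "k \<ge> 1"
  shows "integrable \<nu> (moment L k)"
proof (rule integrableI_bounded)
  have "(\<integral>\<^sup>+x. ennreal (norm (moment L k x)) \<partial>\<nu>) \<le> (\<integral>\<^sup>+x. abs_moment k x \<partial>\<nu>)"
    by (intro nn_integral_mono) (simp add: abs_moment_le)
  then show "(\<integral>\<^sup>+x. ennreal (norm (moment L k x)) \<partial>\<nu>) < \<infinity>"
    using \<nu>_moments[OF assms] by (rule order.strict_trans1)
qed (use measurable_moment[of L k] in measurable)

lemma measurable_hawkes_abs_sum: "hawkes_abs_sum \<zeta> \<theta> L \<in> borel_measurable Q"
proof -
  note [measurable] = measurable_tree_nn[OF abs_f_measurable]
  have [measurable]: "(\<lambda>\<omega>. abs_total L (snd (\<zeta> \<omega>) i) (\<lambda>u. \<theta> i u \<omega>)) \<in> borel_measurable Q" for i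
  proof -
    have "(\<lambda>\<omega>. (\<lambda>(z, c). abs_total L z c) (snd (\<zeta> \<omega>) i, \<lambda>u. \<theta> i u \<omega>)) \<in> borel_measurable Q"
      using measurable_R[of i] by measurable
    then show ?thesis by simp
  qed
  show ?thesis
    unfolding hawkes_abs_sum_def[abs_def] by (intro borel_measurable_count_space_nn_integral) measurable
qed

lemma nn_integral_hawkes_abs_sum_tendsto:
  "(\<lambda>N. \<integral>\<^sup>+\<omega>. hawkes_abs_sum \<zeta> \<theta> (enat N) \<omega> \<partial>Q) \<longlonglongrightarrow> (\<integral>\<^sup>+\<omega>. hawkes_abs_sum \<zeta> \<theta> \<infinity> \<omega> \<partial>Q)"
proof (rule nn_integral_LIMSEQ)
  show "mono (\<lambda>N. hawkes_abs_sum \<zeta> \<theta> (enat N))"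
    unfolding hawkes_abs_sum_def by (intro monoI le_funI nn_integral_mono tree_nn_mono) simp
  show "(\<lambda>N. hawkes_abs_sum \<zeta> \<theta> (enat N) \<omega>) \<longlonglongrightarrow> hawkes_abs_sum \<zeta> \<theta> \<infinity> \<omega>" for \<omega>
    unfolding hawkes_abs_sum_def
  proof (rule nn_integral_LIMSEQ)
    show "mono (\<lambda>N i. abs_total (enat N) (snd (\<zeta> \<omega>) i) (\<lambda>u. \<theta> i u \<omega>))"
      by (intro monoI le_funI tree_nn_mono) simp
  qed (auto intro: tree_nn_tendsto)
qed (rule measurable_hawkes_abs_sum)

end

text \<open>
  Almost surely the truncated clusters are finite at all positions simultaneously, so that their
  absolute sums at the random positions of the immigrants are real-valued marks.
\<close>

lemma nn_integral_hawkes_abs_sum_le: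
  fixes A :: "nat \<Rightarrow> 'a set"
  assumes Q: "prob_space Q" and hawkes: "hawkes_family Q \<gamma> \<nu> \<zeta> \<theta>" and sets_\<nu>: "sets \<nu> = sets borel"
    and A: "range A \<subseteq> sets borel" "(\<Union>i. A i) = UNIV" "\<And>i. emeasure \<nu> (A i) < \<infinity>" "incseq A"
    and \<nu>_moments: "\<And>k. k \<ge> 1 \<Longrightarrow> (\<integral>\<^sup>+z. abs_moment k z \<partial>\<nu>) < \<infinity>"
  shows "(\<integral>\<^sup>+\<omega>. hawkes_abs_sum \<zeta> \<theta> (enat N) \<omega> \<partial>Q) \<le> (\<integral>\<^sup>+z. abs_moment 1 z \<partial>\<nu>)"
proof -
  interpret F: finite_moment_cluster P \<gamma> \<eta> "\<lambda>x. \<bar>f x\<bar>" by (rule abs_cluster)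
  have F_moment: "F.abs_moment k z = abs_moment k z" for k z
    by (simp add: F.abs_moment_def abs_moment_def)
  have \<nu>F: "(\<integral>\<^sup>+z. F.abs_moment k z \<partial>\<nu>) < \<infinity>" if "k \<ge> 1" for k
    using \<nu>_moments[OF that] by (simp add: F_moment)
  note setting = Q hawkes sets_\<nu> A \<nu>F
  note fam = hawkes_branching_family[OF Q hawkes sets_\<nu> A \<nu>_moments]
  interpret marked_poisson Q \<nu> \<zeta> genealogy_space "\<lambda>i \<omega> u. \<theta> i u \<omega>"
    by (rule hawkes_marked_poisson[OF Q hawkes sets_\<nu> A \<nu>_moments])
  let ?Y = "F.total (enat N)"
  have Y0: "0 \<le> ?Y z c" for z c
    by (simp add: tree_sum_def)
  have Yabs: "abs_mark ?Y = ?Y"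
    using Y0 by (simp add: fun_eq_iff abs_of_nonneg)
  note mom = F.hawkes_moments[OF setting, where L="enat N"]
  have S0: "0 \<le> mark_sum ?Y \<omega>" for \<omega>
    unfolding mark_sum_def by (intro Bochner_Integration.integral_nonneg Y0)
  have fin_abs: "AE \<omega> in Q. abs_mark_sum ?Y \<omega> \<noteq> \<infinity>"
    using mom(1)[of 1] by (intro nn_integral_PInf_AE measurable_mark_sum(2) F.hawkes_mark[OF setting]) simp_all
  have "(\<integral>\<^sup>+\<omega>. hawkes_abs_sum \<zeta> \<theta> (enat N) \<omega> \<partial>Q) = (\<integral>\<^sup>+\<omega>. ennreal (mark_sum ?Y \<omega>) \<partial>Q)"
  proof (rule nn_integral_cong_AE)
    have "AE \<omega> in Q. \<forall>i u. finite (indices (\<theta> i u \<omega>))"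
      by (subst AE_all_countable) (intro allI AE_finite_offspring[OF Q sets_\<gamma> fam \<gamma>_finite])
    with fin_abs show "AE \<omega> in Q. hawkes_abs_sum \<zeta> \<theta> (enat N) \<omega> = ennreal (mark_sum ?Y \<omega>)"
    proof eventually_elim
      case (elim \<omega>)
      have "abs_total (enat N) z (\<lambda>u. \<theta> i u \<omega>) = ennreal (?Y z (\<lambda>u. \<theta> i u \<omega>))" for i z
        using elim by (intro abs_tree_sum_le(2)[symmetric] tree_nn_abs_finite) auto
      then have "hawkes_abs_sum \<zeta> \<theta> (enat N) \<omega> = abs_mark_sum ?Y \<omega>"
        by (simp add: hawkes_abs_sum_def abs_mark_sum_def abs_of_nonneg[OF Y0])
      also have "\<dots> = ennreal (mark_sum ?Y \<omega>)"
        using abs_mark_sum_eq(1)[of ?Y \<omega>] elim by (simp add: Yabs less_top)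
      finally show ?case .
    qed
  qed
  also have "\<dots> = ennreal (\<integral>\<omega>. mark_sum ?Y \<omega> ^ 1 \<partial>Q)"
    using mom(2)[of 1] S0 by (subst nn_integral_eq_integral) auto
  also have "(\<integral>\<omega>. mark_sum ?Y \<omega> ^ 1 \<partial>Q) = (\<integral>x. F.moment (enat N) 1 x \<partial>\<nu>)"
  proof -
    have "mark_moment ?Y 1 = F.moment (enat N) 1"
      by (rule ext) (rule F.hawkes_mark_moment[OF setting])
    then show ?thesis
      using mom(3)[of 1] by (simp only: complete_bell_1)
  qed
  also have "ennreal \<dots> = (\<integral>\<^sup>+x. ennreal (F.moment (enat N) 1 x) \<partial>\<nu>)"
    by (rule nn_integral_eq_integral[symmetric, OF F.integrable_moment_\<nu>[OF setting]])
       (simp_all add: abs_moment_le_moment_abs(3))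
  also have "\<dots> \<le> (\<integral>\<^sup>+z. abs_moment 1 z \<partial>\<nu>)"
  proof (rule nn_integral_mono)
    fix x
    have "ennreal (F.moment (enat N) 1 x) \<le> ennreal \<bar>F.moment (enat N) 1 x\<bar>"
      by (rule ennreal_leI) simp
    also have "\<dots> \<le> abs_moment 1 x"
      unfolding F_moment[symmetric] by (rule F.abs_moment_le)
    finally show "ennreal (F.moment (enat N) 1 x) \<le> abs_moment 1 x" .
  qed
  finally show ?thesis .
qed

text \<open>The immigrants sit at random positions, so almost sure finiteness of the cluster sum at
  each fixed \<open>z\<close> does not settle absolute convergence over all points. The bound on the
  first absolute moment does, and only then does Fubini identify the Hawkes sum with a marked
  Poisson sum over the immigrants.\<close>

theorem hawkes_cumulants:
  fixes A :: "nat \<Rightarrow> 'a set"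
  assumes Q: "prob_space Q" and hawkes: "hawkes_family Q \<gamma> \<nu> \<zeta> \<theta>" and sets_\<nu>: "sets \<nu> = sets borel"
    and A: "range A \<subseteq> sets borel" "(\<Union>i. A i) = UNIV" "\<And>i. emeasure \<nu> (A i) < \<infinity>" "incseq A"
    and \<nu>_moments: "\<And>k. k \<ge> 1 \<Longrightarrow> (\<integral>\<^sup>+z. abs_moment k z \<partial>\<nu>) < \<infinity>"
  defines "H \<equiv> \<lambda>\<omega>. \<integral>x. f x \<partial>hawkes_process \<zeta> \<theta> \<omega>"
  shows "AE \<omega> in Q. integrable (hawkes_process \<zeta> \<theta> \<omega>) f"
    and "integrable Q (\<lambda>\<omega>. H \<omega> ^ m)"
    and "n \<ge> 1 \<Longrightarrow> cumulant Q H n = (\<integral>z. moment \<infinity> n z \<partial>\<nu>)"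
proof -
  note setting = Q hawkes sets_\<nu> A \<nu>_moments
  note fam = hawkes_branching_family[OF setting]
  note [measurable] = f_measurable
  interpret marked_poisson Q \<nu> \<zeta> genealogy_space "\<lambda>i \<omega> u. \<theta> i u \<omega>"
    by (rule hawkes_marked_poisson[OF setting])
  let ?I = "\<lambda>\<omega>. {(i, u). i \<in> indices (\<zeta> \<omega>) \<and> alive (\<lambda>v. \<theta> i v \<omega>) u}"
  let ?S = "\<lambda>\<omega>. SIGMA i:indices (\<zeta> \<omega>). individuals \<infinity> (\<lambda>v. \<theta> i v \<omega>)"
  let ?p = "\<lambda>\<omega> (i, u). snd (\<zeta> \<omega>) i + position (\<lambda>v. \<theta> i v \<omega>) u"
  let ?F = "\<lambda>\<omega> i u. f (snd (\<zeta> \<omega>) i + position (\<lambda>v. \<theta> i v \<omega>) u)"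
  have IS: "?I \<omega> = ?S \<omega>" for \<omega>
    by (auto simp: individuals_def)
  have H: "H \<omega> = (\<integral>p. ?F \<omega> (fst p) (snd p) \<partial>count_space (?I \<omega>))" for \<omega>
    unfolding H_def hawkes_process_def by (subst integral_points) (simp_all add: case_prod_beta)
  \<comment> \<open>The bound for finitely many generations is uniform in their number and passes to
    the whole clusters by monotone convergence.\<close>
  have "(\<integral>\<^sup>+\<omega>. hawkes_abs_sum \<zeta> \<theta> \<infinity> \<omega> \<partial>Q) \<le> (\<integral>\<^sup>+z. abs_moment 1 z \<partial>\<nu>)"
    by (rule LIMSEQ_le_const2[OF nn_integral_hawkes_abs_sum_tendsto[OF setting]])
       (use nn_integral_hawkes_abs_sum_le[OF setting] in auto)
  also have "\<dots> < \<infinity>"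
    by (rule \<nu>_moments) simp
  finally have "AE \<omega> in Q. hawkes_abs_sum \<zeta> \<theta> \<infinity> \<omega> \<noteq> \<infinity>"
    by (intro nn_integral_PInf_AE measurable_hawkes_abs_sum[OF setting]) auto
  then have int: "AE \<omega> in Q. integrable (count_space (?S \<omega>)) (\<lambda>p. ?F \<omega> (fst p) (snd p))"
  proof eventually_elim
    case (elim \<omega>)
    have "(\<integral>\<^sup>+p. ennreal (norm (?F \<omega> (fst p) (snd p))) \<partial>count_space (?S \<omega>)) = hawkes_abs_sum \<zeta> \<theta> \<infinity> \<omega>"
      unfolding hawkes_abs_sum_def tree_nn_def real_norm_def
      by (rule nn_integral_count_space_Sigma[where F="\<lambda>i u. ennreal \<bar>?F \<omega> i u\<bar>"])
    then show ?case
      using elim by (intro integrableI_bounded) (simp_all add: less_top)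
  qed
  then show "AE \<omega> in Q. integrable (hawkes_process \<zeta> \<theta> \<omega>) f"
  proof eventually_elim
    case (elim \<omega>)
    then show ?case
      unfolding hawkes_process_def points_def IS
      by (subst integrable_distr_eq) (simp_all add: case_prod_beta)
  qed
  let ?X = "mark_sum (total \<infinity>)"
  note Y = hawkes_mark[OF setting, of \<infinity>]
  note mom = hawkes_moments[OF setting, where L=\<infinity>]
  have H_eq: "AE \<omega> in Q. H \<omega> = ?X \<omega>"
    using int
  proof eventually_elim
    case (elim \<omega>)
    show ?case
      unfolding H IS mark_sum_def tree_sum_def by (rule integral_count_space_Sigma[OF elim])
  qed
  \<comment> \<open>As for single clusters, the almost sure identity \<open>H_eq\<close> does not by
    itself transfer measurability.\<close>
  have H_meas[measurable]: "H \<in> borel_measurable Q"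
  proof -
    note m = measurable_family_genealogy[OF Q sets_\<gamma> fam]
    have [measurable]: "(\<lambda>\<omega>. position (\<lambda>v. \<theta> i v \<omega>) u) \<in> borel_measurable Q" for i u
      using measurable_compose[OF m measurable_position] .
    have [measurable]: "Measurable.pred Q (\<lambda>\<omega>. alive (\<lambda>v. \<theta> i v \<omega>) u)" for i u
      using measurable_compose[OF m measurable_alive] .
    have "(\<lambda>\<omega>. \<integral>p. ?F \<omega> (fst p) (snd p) \<partial>count_space (?I \<omega>)) \<in> borel_measurable Q"
      by (intro borel_measurable_count_space_integral) (auto simp: case_prod_beta)
    then show ?thesis
      by (simp add: H[abs_def])
  qed
  note [measurable] = measurable_mark_sum(1)[OF Y]
  have H_pow: "AE \<omega> in Q. H \<omega> ^ k = ?X \<omega> ^ k" for k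
    using H_eq by eventually_elim simp
  show int_H: "integrable Q (\<lambda>\<omega>. H \<omega> ^ m)" for m
    using mom(2)[of m] by (subst integrable_cong_AE[OF _ _ H_pow]) simp_all
  assume "n \<ge> 1"
  have mm: "mark_moment (total \<infinity>) k = moment \<infinity> k" for k
    by (rule ext) (rule hawkes_mark_moment[OF setting])
  have "(\<integral>\<omega>. H \<omega> ^ k \<partial>Q) = complete_bell k (\<lambda>j. \<integral>z. moment \<infinity> j z \<partial>\<nu>)" if "k \<ge> 1" for k
  proof -
    have "(\<integral>\<omega>. H \<omega> ^ k \<partial>Q) = (\<integral>\<omega>. ?X \<omega> ^ k \<partial>Q)"
      by (rule integral_cong_AE[OF _ _ H_pow]) measurable
    also have "\<dots> = complete_bell k (\<lambda>j. \<integral>z. moment \<infinity> j z \<partial>\<nu>)"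
      using mom(3)[of k] that by (simp add: mm)
    finally show ?thesis .
  qed
  then show "cumulant Q H n = (\<integral>z. moment \<infinity> n z \<partial>\<nu>)"
    by (rule cumulant_eq[OF _ \<open>n \<ge> 1\<close>])
qed

end

theorem corollary3p4:
  fixes \<gamma> \<nu> :: "(real ^ 'd) measure"
    and f :: "real ^ 'd \<Rightarrow> real"
    and P :: "'p measure" and \<eta> :: "nat list \<Rightarrow> 'p \<Rightarrow> (real ^ 'd) enumeration"
    and Q :: "'q measure" and \<zeta> :: "'q \<Rightarrow> (real ^ 'd) enumeration"
    and \<theta> :: "nat \<Rightarrow> nat list \<Rightarrow> 'q \<Rightarrow> (real ^ 'd) enumeration"
    and n :: nat
  assumes "sets \<gamma> = sets borel" and "emeasure \<gamma> UNIV < 1"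
    and "sets \<nu> = sets borel" and "\<And>B. B \<in> sets borel \<Longrightarrow> bounded B \<Longrightarrow> emeasure \<nu> B < \<infinity>"
    and "prob_space P" and "branching_family P \<gamma> \<eta>"
    and "prob_space Q" and "hawkes_family Q \<gamma> \<nu> \<zeta> \<theta>"
    and "f \<in> borel_measurable borel"
    and "\<And>m z. m \<ge> 1 \<Longrightarrow> (\<integral>\<^sup>+\<omega>. abs_cluster_sum \<eta> f z \<omega> ^ m \<partial>P) < \<infinity>"
    and "\<And>m. m \<ge> 1 \<Longrightarrow> (\<integral>\<^sup>+z. (\<integral>\<^sup>+\<omega>. abs_cluster_sum \<eta> f z \<omega> ^ m \<partial>P) \<partial>\<nu>) < \<infinity>"
    and "n \<ge> 2"
  shows
    "let \<kappa>z = (\<lambda>z. cumulant P (cluster_sum \<eta> f z));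
         H = (\<lambda>\<omega>. \<integral>x. f x \<partial>hawkes_process \<zeta> \<theta> \<omega>);
         h = (\<lambda>y. complete_bell n (\<kappa>z y) - \<kappa>z y n);
         hk = (\<lambda>k y. partial_bell n k (\<kappa>z y))
     in (AE \<omega> in Q. integrable (hawkes_process \<zeta> \<theta> \<omega>) f) \<and>
        (\<forall>m. integrable Q (\<lambda>\<omega>. H \<omega> ^ m)) \<and>
        integrable \<nu> (\<lambda>z. complete_bell n (\<kappa>z z)) \<and>
        cumulant Q H n = (\<integral>z. complete_bell n (\<kappa>z z) \<partial>\<nu>) \<and>
        (\<forall>z. resolvent_defined \<gamma> h z \<and>
             (\<forall>k\<in>{2..n}. resolvent_defined \<gamma> (hk k) z) \<and>
             complete_bell n (\<kappa>z z) = resolvent \<gamma> h z \<and>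
             resolvent \<gamma> h z = (\<Sum>k=2..n. resolvent \<gamma> (hk k) z))"
proof -
  interpret P: prob_space P by fact
  interpret finite_moment_cluster P \<gamma> \<eta> f
  proof (rule finite_moment_cluster.intro)
    show "emeasure \<gamma> UNIV < \<infinity>"
      using assms(2) by (rule order.strict_trans) simp
    fix m z
    show "(\<integral>\<^sup>+\<omega>. tree_nn \<infinity> (\<lambda>x. ennreal \<bar>f x\<bar>) z (\<lambda>u. \<eta> u \<omega>) ^ m \<partial>P) < \<infinity>"
    \<comment> \<open>The hypothesis covers exponents from 1 on; exponent 0 gives the total mass
      1.\<close>
    proof (cases "m = 0")
      case False
      then show ?thesis
        using assms(10)[of m z] by (simp add: abs_cluster_sum_eq[OF assms(9)])
    qed (simp add: P.emeasure_space_1)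
  qed (rule assms(1,5,6,9))+
  have n1: "n \<ge> 1" using \<open>n \<ge> 2\<close> by simp
  have \<nu>_moments: "(\<integral>\<^sup>+z. abs_moment k z \<partial>\<nu>) < \<infinity>" if "k \<ge> 1" for k
    using assms(11)[OF that] by (simp add: abs_moment_def abs_cluster_sum_eq[OF assms(9)])
  \<comment> \<open>Closed balls of integer radius: local finiteness of \<open>\<nu>\<close> makes
    them an exhaustion by sets of finite intensity.\<close>
  let ?A = "\<lambda>i. cball (0 :: real ^ 'd) (real i)"
  have A: "range ?A \<subseteq> sets borel" "(\<Union>i. ?A i) = UNIV" "\<And>i. emeasure \<nu> (?A i) < \<infinity>" "incseq ?A"
  proof -
    show "(\<Union>i. ?A i) = UNIV"
      by (auto intro: real_arch_simple)
    show "emeasure \<nu> (?A i) < \<infinity>" for i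
      by (rule assms(4)) auto
    show "incseq ?A"
      by (auto simp: incseq_def)
  qed auto
  note setting = assms(7,8,3) A \<nu>_moments
  note hawkes = hawkes_cumulants[OF setting]
  let ?\<kappa> = "\<lambda>z. cumulant P (cluster_sum \<eta> f z)"
  \<comment> \<open>Cumulants and \<open>kappa\<close> are compared at indices from 1 on only, and
    Bell polynomials look at no others.\<close>
  have bell: "complete_bell n (?\<kappa> z) = complete_bell n (\<lambda>k. kappa \<infinity> k z)" for z
    by (rule complete_bell_cong) (rule cumulant_cluster_sum)
  have pbell: "partial_bell n k (?\<kappa> z) = partial_bell n k (\<lambda>k. kappa \<infinity> k z)" for k z
    by (rule partial_bell_cong) (rule cumulant_cluster_sum)
  have bell_moment: "complete_bell n (?\<kappa> z) = moment \<infinity> n z" for z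
    unfolding bell by (rule moment_kappa[OF n1, symmetric])
  have "integrable \<nu> (\<lambda>z. complete_bell n (?\<kappa> z))"
    unfolding bell_moment by (rule integrable_moment_\<nu>[OF setting n1])
  moreover have "cumulant Q (\<lambda>\<omega>. \<integral>x. f x \<partial>hawkes_process \<zeta> \<theta> \<omega>) n = (\<integral>z. complete_bell n (?\<kappa> z) \<partial>\<nu>)"
    unfolding bell_moment by (rule hawkes(3)[OF _ n1])
  ultimately show ?thesis
    unfolding Let_def
    using hawkes(1,2) resolvent_kappa[OF \<open>n \<ge> 2\<close>]
    by (simp add: bell pbell cumulant_cluster_sum[OF n1])
qed

end
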